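(* Let $A=\mathbb{F}_q[T]$. There is an algorithm that, given a monic irreducible $f\in A[x]$ and a nonzero prime ideal $\mathfrak p\subset A$, computes, for $R=A[x]/f(x)$, a finite set $\mathcal S$ of $A$-overorders of $R$ such that the map $$\mathcal S\to\{A_{\mathfrak p}\text{-overorders of }R_{\mathfrak p}\},\qquad S\mapsto S_{\mathfrak p},$$ is a bijection.
   Context: $K$ is the fraction field of $A[x]/f(x)$, a finite extension of $F=\mathbb{F}_q(T)$ (not assumed separable). An $A$-overorder of $R$ is an $A$-order $S$ in $K$ with $R\subseteq S$. $A_{\mathfrak p}$, $F_{\mathfrak p}$ denote completions at $\mathfrak p$, $K_{\mathfrak p}=K\otimes_F F_{\mathfrak p}$, and for an $A$-order $S$ in $K$, $S_{\mathfrak p}=S\otimes_A A_{\mathfrak p}\subset K_{\mathfrak p}$ is its completion at $\mathfrak p$. An $A_{\mathfrak p}$-overorder of $R_{\mathfrak p}$ is an $A_{\mathfrak p}$-order in $K_{\mathfrak p}$ containing $R_{\mathfrak p}$. An order is output by giving an $A$-basis. *)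

theory Defs
  imports
    "HOL-Computational_Algebra.Computational_Algebra"
    "HOL-Library.Nat_Bijection"
    "HOL-Algebra.Algebra"
    "HOL-Algebra.Algebraic_Closure_Type"
begin

section \<open>Algorithms: Kleene's partial recursive functions\<close>

datatype recf =
    Zero
  | Succ
  | Proj nat
  | Comp recf "recf list"
  | PrimRec recf recf
  | Mu recf

text \<open>\<open>rec_eval p xs y\<close>: the program \<open>p\<close> halts on the arguments \<open>xs\<close> with output \<open>y\<close>.\<close>

inductive rec_eval :: "recf \<Rightarrow> nat list \<Rightarrow> nat \<Rightarrow> bool" where
  eval_Zero: "rec_eval Zero xs 0"
| eval_Succ: "rec_eval Succ [x] (Suc x)"
| eval_Proj: "i < length xs \<Longrightarrow> rec_eval (Proj i) xs (xs ! i)"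
| eval_Comp: "list_all2 (\<lambda>g y. rec_eval g xs y) gs ys \<Longrightarrow> rec_eval p ys z
    \<Longrightarrow> rec_eval (Comp p gs) xs z"
| eval_PrimRec_0: "rec_eval p xs y \<Longrightarrow> rec_eval (PrimRec p g) (0 # xs) y"
| eval_PrimRec_Suc: "rec_eval (PrimRec p g) (n # xs) y \<Longrightarrow> rec_eval g (n # y # xs) z
    \<Longrightarrow> rec_eval (PrimRec p g) (Suc n # xs) z"
| eval_Mu: "rec_eval p (n # xs) 0 \<Longrightarrow> (\<And>m. m < n \<Longrightarrow> \<exists>y. rec_eval p (m # xs) (Suc y))
    \<Longrightarrow> rec_eval (Mu p) xs n"

inductive_cases rec_eval_ZeroE: "rec_eval Zero xs y"
inductive_cases rec_eval_SuccE: "rec_eval Succ xs y"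
inductive_cases rec_eval_ProjE: "rec_eval (Proj i) xs y"
inductive_cases rec_eval_CompE: "rec_eval (Comp p gs) xs y"
inductive_cases rec_eval_PrimRec0E: "rec_eval (PrimRec p g) (0 # xs) y"
inductive_cases rec_eval_PrimRecSucE: "rec_eval (PrimRec p g) (Suc n # xs) y"
inductive_cases rec_eval_MuE: "rec_eval (Mu p) xs y"

lemma rec_eval_deterministic: "rec_eval p xs y \<Longrightarrow> rec_eval p xs z \<Longrightarrow> y = z"
proof (induction arbitrary: z rule: rec_eval.induct)
  case (eval_Comp xs gs ys p w)
  from eval_Comp.prems obtain ys' where ys':
    "list_all2 (\<lambda>g y. rec_eval g xs y) gs ys'" "rec_eval p ys' z"
    by (rule rec_eval_CompE)
  have "ys = ys'"
    using eval_Comp.IH(1) ys'(1) by (fastforce simp: list_all2_conv_all_nth list_eq_iff_nth_eq)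
  then show ?case using eval_Comp.IH(2) ys'(2) by blast
next
  case (eval_Mu p n xs)
  from eval_Mu.prems have z: "rec_eval p (z # xs) 0"
    "\<And>m. m < z \<Longrightarrow> \<exists>y. rec_eval p (m # xs) (Suc y)"
    by (rule rec_eval_MuE, blast)+
  show ?case
  proof (rule linorder_cases[of n z])
    assume "n < z"
    then show ?thesis using z(2) eval_Mu.IH(1) by blast
  next
    assume "z < n"
    then show ?thesis using z(1) eval_Mu.IH(2) by blast
  qed
next
  case eval_Zero
  then show ?case by (blast elim: rec_eval_ZeroE)
next
  case eval_Succ
  then show ?case by (blast elim: rec_eval_SuccE)
next
  case eval_Proj
  then show ?case by (blast elim: rec_eval_ProjE)
next
  case eval_PrimRec_0
  then show ?case by (blast elim: rec_eval_PrimRec0E)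
next
  case (eval_PrimRec_Suc p g n xs y w)
  from eval_PrimRec_Suc.prems obtain y' where
    "rec_eval (PrimRec p g) (n # xs) y'" "rec_eval g (n # y' # xs) z"
    by (rule rec_eval_PrimRecSucE)
  then show ?case using eval_PrimRec_Suc.IH by blast
qed


section \<open>Fraction fields, completions and tensor products\<close>

subsection \<open>The fraction field of an integral domain\<close>

definition fraction :: "('r, 'm) ring_scheme \<Rightarrow> 'r \<Rightarrow> 'r \<Rightarrow> ('r \<times> 'r) set" where
  "fraction R a b =
     {(c, d) \<in> carrier R \<times> (carrier R - {\<zero>\<^bsub>R\<^esub>}). a \<otimes>\<^bsub>R\<^esub> d = c \<otimes>\<^bsub>R\<^esub> b}"

definition fraction_field :: "('r, 'm) ring_scheme \<Rightarrow> ('r \<times> 'r) set ring" where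
  "fraction_field R =
     \<lparr>carrier = {fraction R a b | a b. a \<in> carrier R \<and> b \<in> carrier R - {\<zero>\<^bsub>R\<^esub>}},
      monoid.mult = (\<lambda>U V. \<Union>(a, b)\<in>U. \<Union>(c, d)\<in>V. fraction R (a \<otimes>\<^bsub>R\<^esub> c) (b \<otimes>\<^bsub>R\<^esub> d)),
      one = fraction R \<one>\<^bsub>R\<^esub> \<one>\<^bsub>R\<^esub>,
      ring.zero = fraction R \<zero>\<^bsub>R\<^esub> \<one>\<^bsub>R\<^esub>,
      add = (\<lambda>U V. \<Union>(a, b)\<in>U. \<Union>(c, d)\<in>V.
               fraction R (a \<otimes>\<^bsub>R\<^esub> d \<oplus>\<^bsub>R\<^esub> c \<otimes>\<^bsub>R\<^esub> b) (b \<otimes>\<^bsub>R\<^esub> d))\<rparr>"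

subsection \<open>The completion of $F = \mathrm{Frac}(A)$ at a prime $P$ of $A$\<close>

primrec ideal_power :: "'a::idom set \<Rightarrow> nat \<Rightarrow> 'a set" where
  "ideal_power P 0 = UNIV"
| "ideal_power P (Suc n) = ideal_prod ring_of_type_algebra P (ideal_power P n)"

text \<open>The basic neighbourhood \<open>P\<^sup>n A\<^sub>(\<^sub>P\<^sub>)\<close> of 0 for the \<open>P\<close>-adic topology on \<open>F\<close>.\<close>

definition adic_nbhd :: "'a::idom set \<Rightarrow> nat \<Rightarrow> 'a fract set" where
  "adic_nbhd P n = {Fract a b | a b. a \<in> ideal_power P n \<and> b \<notin> P}"

definition adic_Cauchy :: "'a::idom set \<Rightarrow> (nat \<Rightarrow> 'a fract) \<Rightarrow> bool" where
  "adic_Cauchy P s \<longleftrightarrow> (\<forall>n. \<exists>N. \<forall>i\<ge>N. \<forall>j\<ge>N. s i - s j \<in> adic_nbhd P n)"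

definition adic_null :: "'a::idom set \<Rightarrow> (nat \<Rightarrow> 'a fract) set" where
  "adic_null P = {s. \<forall>n. \<exists>N. \<forall>i\<ge>N. s i \<in> adic_nbhd P n}"

definition Cauchy_ring :: "'a::idom set \<Rightarrow> (nat \<Rightarrow> 'a fract) ring" where
  "Cauchy_ring P =
     \<lparr>carrier = {s. adic_Cauchy P s},
      monoid.mult = (\<lambda>s t i. s i * t i),
      one = (\<lambda>i. 1),
      ring.zero = (\<lambda>i. 0),
      add = (\<lambda>s t i. s i + t i)\<rparr>"

definition completion_field :: "'a::idom set \<Rightarrow> (nat \<Rightarrow> 'a fract) set ring" where
  "completion_field P = Cauchy_ring P Quot adic_null P"

definition Cauchy_class :: "'a::idom set \<Rightarrow> (nat \<Rightarrow> 'a fract) \<Rightarrow> (nat \<Rightarrow> 'a fract) set" where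
  "Cauchy_class P s = adic_null P +>\<^bsub>Cauchy_ring P\<^esub> s"

definition to_completion :: "'a::idom set \<Rightarrow> 'a fract \<Rightarrow> (nat \<Rightarrow> 'a fract) set" where
  "to_completion P r = Cauchy_class P (\<lambda>i. r)"

text \<open>The completion of \<open>A\<close>: classes of Cauchy sequences with all terms in \<open>A\<close>.\<close>

definition completion_integers :: "'a::idom set \<Rightarrow> (nat \<Rightarrow> 'a fract) set set" where
  "completion_integers P =
     {Cauchy_class P (\<lambda>i. Fract (s i) 1) | s :: nat \<Rightarrow> 'a. adic_Cauchy P (\<lambda>i. Fract (s i) 1)}"

subsection \<open>The tensor product of two commutative algebras\<close>

text \<open>The monoid ring \<open>\<int>[M]\<close>: finitely supported functions with convolution.\<close>

definition monoid_ring :: "('m, 'x) monoid_scheme \<Rightarrow> ('m \<Rightarrow> int) ring" where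
  "monoid_ring M =
     \<lparr>carrier = {g. finite {m. g m \<noteq> 0} \<and> {m. g m \<noteq> 0} \<subseteq> carrier M},
      monoid.mult = (\<lambda>g h m. \<Sum>(u, v) | g u \<noteq> 0 \<and> h v \<noteq> 0 \<and> u \<otimes>\<^bsub>M\<^esub> v = m. g u * h v),
      one = (\<lambda>m. if m = \<one>\<^bsub>M\<^esub> then 1 else 0),
      ring.zero = (\<lambda>m. 0),
      add = (\<lambda>g h m. g m + h m)\<rparr>"

definition delta :: "'m \<Rightarrow> 'm \<Rightarrow> int" where
  "delta u = (\<lambda>m. if m = u then 1 else 0)"

text \<open>
  \<open>B\<close> and \<open>C\<close> are algebras over the type \<open>'f\<close> through \<open>i\<close> and \<open>j\<close>.  Products of the
  relations below with monoid elements are again such relations, so the ideal that they generate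
  in \<open>\<int>[B \<times> C]\<close> is the additive subgroup that they generate, and the quotient is the usual
  tensor product \<open>B \<otimes> C\<close> over \<open>'f\<close>.
\<close>

definition tensor_relations ::
  "('b, 'x) ring_scheme \<Rightarrow> ('c, 'y) ring_scheme \<Rightarrow> ('f \<Rightarrow> 'b) \<Rightarrow> ('f \<Rightarrow> 'c) \<Rightarrow> ('b \<times> 'c \<Rightarrow> int) set"
where
  "tensor_relations B C i j =
     {(\<lambda>m. delta (b \<oplus>\<^bsub>B\<^esub> b', c) m - delta (b, c) m - delta (b', c) m) | b b' c.
        b \<in> carrier B \<and> b' \<in> carrier B \<and> c \<in> carrier C} \<union>
     {(\<lambda>m. delta (b, c \<oplus>\<^bsub>C\<^esub> c') m - delta (b, c) m - delta (b, c') m) | b c c'.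
        b \<in> carrier B \<and> c \<in> carrier C \<and> c' \<in> carrier C} \<union>
     {(\<lambda>m. delta (i r \<otimes>\<^bsub>B\<^esub> b, c) m - delta (b, j r \<otimes>\<^bsub>C\<^esub> c) m) | r b c.
        b \<in> carrier B \<and> c \<in> carrier C}"

definition tensor_ideal ::
  "('b, 'x) ring_scheme \<Rightarrow> ('c, 'y) ring_scheme \<Rightarrow> ('f \<Rightarrow> 'b) \<Rightarrow> ('f \<Rightarrow> 'c) \<Rightarrow> ('b \<times> 'c \<Rightarrow> int) set"
where
  "tensor_ideal B C i j = genideal (monoid_ring (B \<times>\<times> C)) (tensor_relations B C i j)"

definition tensor_product ::
  "('b, 'x) ring_scheme \<Rightarrow> ('c, 'y) ring_scheme \<Rightarrow> ('f \<Rightarrow> 'b) \<Rightarrow> ('f \<Rightarrow> 'c)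
     \<Rightarrow> ('b \<times> 'c \<Rightarrow> int) set ring"
where
  "tensor_product B C i j = monoid_ring (B \<times>\<times> C) Quot tensor_ideal B C i j"

definition pure_tensor ::
  "('b, 'x) ring_scheme \<Rightarrow> ('c, 'y) ring_scheme \<Rightarrow> ('f \<Rightarrow> 'b) \<Rightarrow> ('f \<Rightarrow> 'c)
     \<Rightarrow> 'b \<Rightarrow> 'c \<Rightarrow> ('b \<times> 'c \<Rightarrow> int) set"
where
  "pure_tensor B C i j b c = tensor_ideal B C i j +>\<^bsub>monoid_ring (B \<times>\<times> C)\<^esub> delta (b, c)"


section \<open>Orders\<close>

text \<open>
  Here \<open>D\<close> is (the image in \<open>L\<close> of) a domain, \<open>E\<close> that of its fraction field, and \<open>L\<close> a finite
  commutative \<open>E\<close>-algebra.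
\<close>

definition is_order :: "('k, 'x) ring_scheme \<Rightarrow> 'k set \<Rightarrow> 'k set \<Rightarrow> 'k set \<Rightarrow> bool" where
  "is_order L D E S \<longleftrightarrow>
     subring S L \<and>
     (\<exists>us. set us \<subseteq> carrier L \<and> S = ring.Span L D us) \<and>
     (\<forall>x\<in>carrier L. \<exists>us. set us \<subseteq> S \<and> x \<in> ring.Span L E us)"

definition is_basis :: "('k, 'x) ring_scheme \<Rightarrow> 'k set \<Rightarrow> 'k set \<Rightarrow> 'k list \<Rightarrow> bool" where
  "is_basis L D S us \<longleftrightarrow>
     set us \<subseteq> carrier L \<and> S = ring.Span L D us \<and>
     (\<forall>ks. set ks \<subseteq> D \<and> length ks = length us \<and> ring.combine L ks us = \<zero>\<^bsub>L\<^esub>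
        \<longrightarrow> set ks \<subseteq> {\<zero>\<^bsub>L\<^esub>})"


section \<open>The rings attached to $f \in A[x]$, $A = \mathbb{F}_q[T]$\<close>

subsection \<open>$R = A[x]/f$ and its fraction field $K$\<close>

definition equation_ring :: "'a::field poly poly \<Rightarrow> 'a poly poly set ring" where
  "equation_ring f = ring_of_type_algebra Quot (PIdl\<^bsub>ring_of_type_algebra\<^esub> f)"

definition residue_class :: "'a::field poly poly \<Rightarrow> 'a poly poly \<Rightarrow> 'a poly poly set" where
  "residue_class f g = PIdl\<^bsub>ring_of_type_algebra\<^esub> f +>\<^bsub>ring_of_type_algebra\<^esub> g"

type_synonym 'a Kelem = "('a poly poly set \<times> 'a poly poly set) set"

definition K_field :: "'a::field poly poly \<Rightarrow> 'a Kelem ring" where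
  "K_field f = fraction_field (equation_ring f)"

definition K_frac :: "'a::field poly poly \<Rightarrow> 'a poly poly \<Rightarrow> 'a poly \<Rightarrow> 'a Kelem" where
  "K_frac f g d = fraction (equation_ring f) (residue_class f g) (residue_class f [:d:])"

definition F_to_K :: "'a::field poly poly \<Rightarrow> 'a poly fract \<Rightarrow> 'a Kelem" where
  "F_to_K f r = (THE k. \<exists>a b. b \<noteq> 0 \<and> r = Fract a b \<and> k = K_frac f [:a:] b)"

definition A_in_K :: "'a::field poly poly \<Rightarrow> 'a Kelem set" where
  "A_in_K f = range (\<lambda>a. K_frac f [:a:] 1)"

definition F_in_K :: "'a::field poly poly \<Rightarrow> 'a Kelem set" where
  "F_in_K f = range (F_to_K f)"

definition R_in_K :: "'a::field poly poly \<Rightarrow> 'a Kelem set" where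
  "R_in_K f = range (\<lambda>g. K_frac f g 1)"

definition A_overorders :: "'a::field poly poly \<Rightarrow> 'a Kelem set set" where
  "A_overorders f = {S. is_order (K_field f) (A_in_K f) (F_in_K f) S \<and> R_in_K f \<subseteq> S}"

subsection \<open>$K_P = K \otimes_F F_P$\<close>

type_synonym 'a KPelem = "('a Kelem \<times> (nat \<Rightarrow> 'a poly fract) set \<Rightarrow> int) set"

definition KP_ring :: "'a::field poly poly \<Rightarrow> 'a poly set \<Rightarrow> 'a KPelem ring" where
  "KP_ring f P = tensor_product (K_field f) (completion_field P) (F_to_K f) (to_completion P)"

definition KP_pure ::
  "'a::field poly poly \<Rightarrow> 'a poly set \<Rightarrow> 'a Kelem \<Rightarrow> (nat \<Rightarrow> 'a poly fract) set \<Rightarrow> 'a KPelem"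
where
  "KP_pure f P = pure_tensor (K_field f) (completion_field P) (F_to_K f) (to_completion P)"

definition AP_in_KP :: "'a::field poly poly \<Rightarrow> 'a poly set \<Rightarrow> 'a KPelem set" where
  "AP_in_KP f P = KP_pure f P \<one>\<^bsub>K_field f\<^esub> ` completion_integers P"

definition FP_in_KP :: "'a::field poly poly \<Rightarrow> 'a poly set \<Rightarrow> 'a KPelem set" where
  "FP_in_KP f P = KP_pure f P \<one>\<^bsub>K_field f\<^esub> ` carrier (completion_field P)"

text \<open>$S_P = S \otimes_A A_P$, as a subset of $K_P$.\<close>

definition completion_at ::
  "'a::field poly poly \<Rightarrow> 'a poly set \<Rightarrow> 'a Kelem set \<Rightarrow> 'a KPelem set"
where
  "completion_at f P S =
     generate (add_monoid (KP_ring f P)) {KP_pure f P s a | s a. s \<in> S \<and> a \<in> completion_integers P}"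

definition AP_overorders :: "'a::field poly poly \<Rightarrow> 'a poly set \<Rightarrow> 'a KPelem set set" where
  "AP_overorders f P =
     {S. is_order (KP_ring f P) (AP_in_KP f P) (FP_in_KP f P) S \<and>
         completion_at f P (R_in_K f) \<subseteq> S}"


section \<open>Input and output encodings\<close>

text \<open>\<open>e\<close> numbers the elements of the finite field of constants.\<close>

definition poly_code :: "('a::field \<Rightarrow> nat) \<Rightarrow> 'a poly \<Rightarrow> nat" where
  "poly_code e g = list_encode (map e (Polynomial.coeffs g))"

definition poly_poly_code :: "('a::field \<Rightarrow> nat) \<Rightarrow> 'a poly poly \<Rightarrow> nat" where
  "poly_poly_code e g = list_encode (map (poly_code e) (Polynomial.coeffs g))"

text \<open>The element \<open>g(x) / d\<close> of \<open>K\<close> is written as the pair \<open>(g, d)\<close> with \<open>d \<noteq> 0\<close> in \<open>A\<close>.\<close>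

definition bases_code :: "('a::field \<Rightarrow> nat) \<Rightarrow> ('a poly poly \<times> 'a poly) list list \<Rightarrow> nat" where
  "bases_code e bs =
     list_encode (map (\<lambda>us. list_encode
       (map (\<lambda>(g, d). prod_encode (poly_poly_code e g, poly_code e d)) us)) bs)"

definition lists_A_basis ::
  "'a::field poly poly \<Rightarrow> ('a poly poly \<times> 'a poly) list \<Rightarrow> 'a Kelem set \<Rightarrow> bool"
where
  "lists_A_basis f us S \<longleftrightarrow>
     (\<forall>(g, d)\<in>set us. d \<noteq> 0) \<and>
     is_basis (K_field f) (A_in_K f) S (map (\<lambda>(g, d). K_frac f g d) us)"

end

theory Submission
  imports Defs
begin

text \<open>
  Let \<open>n\<close> be the degree of \<open>f\<close>; the prime \<open>\<pi>\<close> is called \<open>p\<close> below.  The overorders of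
  \<open>R\<^sub>P\<close> correspond to the orders \<open>S\<close> with \<open>R \<subseteq> S \<subseteq> R[1/\<pi>]\<close>: to an order \<open>S'\<close> of \<open>K\<^sub>P\<close>
  belongs the ring of all \<open>y \<in> R[1/\<pi>]\<close> with \<open>y \<otimes> 1 \<in> S'\<close>, because every element of \<open>K\<^sub>P\<close> is
  the sum of one of \<open>R[1/\<pi>]\<close> and one of \<open>R\<^sub>P\<close>.

  All these \<open>S\<close> lie in \<open>\<pi>\<^sup>-\<^sup>M R\<close> for an explicit \<open>M\<close>, whether or not \<open>f\<close> is separable.  Give \<open>x\<close> a
  weight \<open>w\<close> that bounds the degrees of the coefficients of \<open>f\<close>, so that the elements of weighted
  degree at most \<open>d\<close> are filtered multiplicatively.  An element of \<open>S\<close> of negative degree is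
  nilpotent, hence zero, so that \<open>S\<close> has at most \<open>q^(n(d+1))\<close> elements of degree at most \<open>d\<close>, while
  \<open>R\<close> has at least \<open>q^(n(d+1-nw))\<close>.  So \<open>S/R\<close> has at most \<open>M = q^(nnw)\<close> elements, and among the
  multiples \<open>y, \<pi> y, \<dots>, \<pi>\<^sup>M y\<close> of \<open>y \<in> S\<close> two are congruent modulo \<open>R\<close>, which forces
  \<open>\<pi>\<^sup>M y \<in> R\<close>.

  The algorithm therefore lists the triangular bases with coefficients of degree at most
  \<open>M deg \<pi>\<close> and keeps those that span an order.
\<close>

section \<open>Computable functions between encoded types\<close>

text \<open>The discriminant, which usually bounds the index of R in a larger order, vanishes when
  \<open>f\<close> is inseparable. The degree on A takes its place, and the resulting exponent
  depends on \<open>f\<close> but not on \<open>p\<close>. Elements are handled through numerators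
  over a power of \<open>p\<close>: an order between R and p^-N R becomes an A-submodule
  \<open>G\<close> of the polynomials of degree below n, and closure under multiplication becomes
  the condition that products reduced modulo \<open>f\<close> lie in p^N G. Since \<open>G\<close>
  contains every p^N x^j, it has a triangular basis whose coefficients have at most the degree of
  p^N, which makes the search finite.

  On the local side the obstacle is that K_P is the quotient of a monoid ring by a generated ideal,
  in which nothing is visibly nonzero. The coordinates with respect to 1, x, ..., x^(n-1) are
  therefore built as maps that vanish on this ideal; membership in R_P, and the comparison of R[1/p]
  with R_P, are then read off coordinate by coordinate.\<close>

definition computable :: "('b \<Rightarrow> nat) \<Rightarrow> ('c \<Rightarrow> nat) \<Rightarrow> ('b \<Rightarrow> 'c) \<Rightarrow> bool" where
  "computable E E' F \<longleftrightarrow> (\<exists>p. \<forall>x. rec_eval p [E x] (E' (F x)))"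

definition nat_enc :: "nat \<Rightarrow> nat" where "nat_enc n = n"

text \<open>True has code 0 because \<open>Mu\<close> searches for a zero and \<open>if_prog\<close>
  branches on zero.\<close>

definition bool_enc :: "bool \<Rightarrow> nat" where "bool_enc b = (if b then 0 else 1)"

definition pair_enc :: "('b \<Rightarrow> nat) \<Rightarrow> ('c \<Rightarrow> nat) \<Rightarrow> 'b \<times> 'c \<Rightarrow> nat" where
  "pair_enc E E' z = prod_encode (E (fst z), E' (snd z))"

definition list_enc :: "('b \<Rightarrow> nat) \<Rightarrow> 'b list \<Rightarrow> nat" where
  "list_enc E xs = list_encode (map E xs)"

definition poly_enc :: "('b::zero \<Rightarrow> nat) \<Rightarrow> 'b poly \<Rightarrow> nat" where
  "poly_enc E p = list_enc E (coeffs p)"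

lemma rec_eval_Proj: "i < length xs \<Longrightarrow> y = xs ! i \<Longrightarrow> rec_eval (Proj i) xs y"
  by (simp add: eval_Proj)

lemma rec_eval_Proj_nth:
  "rec_eval (Proj 0) (x # xs) x" "rec_eval (Proj 1) (a # x # xs) x"
  "rec_eval (Proj 2) (a # b # x # xs) x" "rec_eval (Proj 3) (a # b # c # x # xs) x"
  by (rule rec_eval_Proj; simp)+

lemma rec_eval_Comp1: "rec_eval g xs y \<Longrightarrow> rec_eval p [y] z \<Longrightarrow> rec_eval (Comp p [g]) xs z"
  by (rule eval_Comp[of _ _ "[y]"]) auto

lemma rec_eval_Comp2:
  "rec_eval g xs y \<Longrightarrow> rec_eval g' xs y' \<Longrightarrow> rec_eval p [y, y'] z \<Longrightarrow> rec_eval (Comp p [g, g']) xs z"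
  by (rule eval_Comp[of _ _ "[y, y']"]) auto

lemma rec_eval_Comp3:
  "rec_eval g xs y \<Longrightarrow> rec_eval g' xs y' \<Longrightarrow> rec_eval g'' xs y'' \<Longrightarrow> rec_eval p [y, y', y''] z
    \<Longrightarrow> rec_eval (Comp p [g, g', g'']) xs z"
  by (rule eval_Comp[of _ _ "[y, y', y'']"]) auto

lemma rec_eval_PrimRec:
  assumes "rec_eval p xs (h 0)" "\<And>n. rec_eval g (n # h n # xs) (h (Suc n))"
  shows "rec_eval (PrimRec p g) (n # xs) (h n)"
  by (induction n) (auto intro: eval_PrimRec_0 eval_PrimRec_Suc assms)

section \<open>Programs for subtraction, Cantor pairing and branching\<close>

definition pred_prog :: recf where "pred_prog = PrimRec Zero (Proj 0)"
definition plus_prog :: recf where "plus_prog = PrimRec (Proj 0) (Comp Succ [Proj 1])"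
text \<open>\<open>PrimRec\<close> recurses on its first argument, so the number to be subtracted
  comes first.\<close>

definition monus_prog :: recf where "monus_prog = PrimRec (Proj 0) (Comp pred_prog [Proj 1])"
definition triangle_prog :: recf where
  "triangle_prog = PrimRec Zero (Comp plus_prog [Proj 1, Comp Succ [Proj 0]])"
definition pair_prog :: recf where
  "pair_prog = Comp plus_prog [Comp triangle_prog [plus_prog], Proj 0]"
text \<open>A code z = triangle (m + n) + m lies on the diagonal m + n, the least k with z <
  triangle (k + 1). Both components of the pair then follow by subtraction.\<close>

definition diag_prog :: recf where
  "diag_prog = Mu (Comp monus_prog [Comp triangle_prog [Comp Succ [Proj 0]], Comp Succ [Proj 1]])"
definition fst_prog :: recf where
  "fst_prog = Comp monus_prog [Comp triangle_prog [diag_prog], Proj 0]"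
definition snd_prog :: recf where
  "snd_prog = Comp monus_prog [fst_prog, diag_prog]"
text \<open>The recursion on the condition ignores the value found so far: the base case returns the
  second argument, every later step the third.\<close>

definition if_prog :: recf where "if_prog = PrimRec (Proj 0) (Proj 3)"

lemma pred_prog: "rec_eval pred_prog [n] (n - 1)"
  unfolding pred_prog_def
  by (rule rec_eval_PrimRec[where h = "\<lambda>n. n - 1"]) (auto intro!: rec_eval_Proj eval_Zero)

lemma plus_prog: "rec_eval plus_prog [m, n] (m + n)"
  unfolding plus_prog_def
  by (rule rec_eval_PrimRec[where h = "\<lambda>m. m + n"])
    (auto intro!: rec_eval_Proj rec_eval_Comp1 eval_Succ)

lemma monus_prog: "rec_eval monus_prog [m, n] (n - m)"
proof -
  have "rec_eval pred_prog [n - m] (n - Suc m)" for m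
    using pred_prog[of "n - m"] by simp
  then have "rec_eval (Comp pred_prog [Proj 1]) [m, n - m, n] (n - Suc m)" for m
    by (rule rec_eval_Comp1[OF rec_eval_Proj_nth(2)])
  then show ?thesis
    unfolding monus_prog_def
    by (intro rec_eval_PrimRec[where h = "\<lambda>m. n - m"]) (simp_all add: rec_eval_Proj_nth)
qed

lemma triangle_prog: "rec_eval triangle_prog [n] (triangle n)"
  unfolding triangle_prog_def
proof (rule rec_eval_PrimRec[where h = triangle])
  fix n
  show "rec_eval (Comp plus_prog [Proj 1, Comp Succ [Proj 0]]) [n, triangle n] (triangle (Suc n))"
    unfolding triangle_Suc
    by (rule rec_eval_Comp2[OF _ _ plus_prog])
      (auto intro!: rec_eval_Proj rec_eval_Comp1[of _ _ n] eval_Succ)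
qed (simp add: eval_Zero)

lemma pair_prog: "rec_eval pair_prog [m, n] (prod_encode (m, n))"
  unfolding pair_prog_def prod_encode_def split
  by (rule rec_eval_Comp2[OF _ _ plus_prog] rec_eval_Comp1[OF plus_prog] triangle_prog rec_eval_Proj_nth)+

lemma mono_triangle: "m \<le> n \<Longrightarrow> triangle m \<le> triangle n"
  by (induction n rule: dec_induct) auto

lemma diag_prog: "rec_eval diag_prog [prod_encode (m, n)] (m + n)"
proof -
  let ?q = "Comp monus_prog [Comp triangle_prog [Comp Succ [Proj 0]], Comp Succ [Proj 1]]"
  have q: "rec_eval ?q [k, z] (Suc z - triangle (Suc k))" for k z
    by (rule rec_eval_Comp2[OF _ _ monus_prog] rec_eval_Comp1[OF _ triangle_prog]
        rec_eval_Comp1[OF _ eval_Succ] rec_eval_Proj_nth)+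
  have "rec_eval ?q [m + n, prod_encode (m, n)] 0"
    using q[of "m + n" "prod_encode (m, n)"] by (simp add: prod_encode_def)
  moreover have "\<exists>y. rec_eval ?q [k, prod_encode (m, n)] (Suc y)" if "k < m + n" for k
  proof -
    have "triangle (Suc k) \<le> prod_encode (m, n)"
      using mono_triangle[of "Suc k" "m + n"] that by (simp add: prod_encode_def)
    then show ?thesis
      using q[of k "prod_encode (m, n)"] Suc_diff_le by metis
  qed
  ultimately show ?thesis
    unfolding diag_prog_def by (rule eval_Mu)
qed

lemma fst_prog: "rec_eval fst_prog [prod_encode (m, n)] m"
proof -
  have "rec_eval fst_prog [prod_encode (m, n)] (prod_encode (m, n) - triangle (m + n))"
    unfolding fst_prog_def
    by (rule rec_eval_Comp2[OF _ _ monus_prog] rec_eval_Comp1[OF diag_prog triangle_prog]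
        rec_eval_Proj_nth)+
  then show ?thesis by (simp add: prod_encode_def)
qed

lemma snd_prog: "rec_eval snd_prog [prod_encode (m, n)] n"
  using rec_eval_Comp2[OF fst_prog diag_prog monus_prog, of m n] unfolding snd_prog_def by simp

lemma if_prog: "rec_eval if_prog [c, a, b] (if c = 0 then a else b)"
  unfolding if_prog_def
  by (rule rec_eval_PrimRec[where h = "\<lambda>c. if c = 0 then a else b"]) (auto intro!: rec_eval_Proj)

lemma rec_eval_const: "\<exists>p. \<forall>xs. rec_eval p xs n"
proof (induction n)
  case 0
  show ?case using eval_Zero by blast
next
  case (Suc n)
  then show ?case using rec_eval_Comp1 eval_Succ by metis
qed

subsection \<open>Closure properties\<close>

lemma computable_id: "computable E E (\<lambda>x. x)"
  unfolding computable_def by (rule exI[of _ "Proj 0"]) (simp add: rec_eval_Proj)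

lemma computable_const: "computable E E' (\<lambda>x. c)"
  unfolding computable_def using rec_eval_const by blast

lemma computable_compose:
  assumes "computable E1 E2 G" "computable E E1 F"
  shows "computable E E2 (\<lambda>x. G (F x))"
proof -
  obtain p q where p: "\<And>x. rec_eval p [E1 x] (E2 (G x))" and q: "\<And>x. rec_eval q [E x] (E1 (F x))"
    using assms unfolding computable_def by blast
  show ?thesis unfolding computable_def
    by (rule exI[of _ "Comp p [q]"]) (auto intro: rec_eval_Comp1 p q)
qed

text \<open>A program sees only codes, so one for \<open>F\<close> also serves a function
  \<open>G\<close> with values in another type as long as the codes agree. This is how results move
  between numbers and structured data.\<close>

lemma computable_cong_code:
  assumes "computable E E1 F" "\<And>x. E2 (G x) = E1 (F x)"
  shows "computable E E2 G"
  using assms unfolding computable_def by simp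

lemma computable_Pair:
  assumes "computable E E1 F" "computable E E2 G"
  shows "computable E (pair_enc E1 E2) (\<lambda>x. (F x, G x))"
proof -
  obtain p q where p: "\<And>x. rec_eval p [E x] (E1 (F x))" and q: "\<And>x. rec_eval q [E x] (E2 (G x))"
    using assms unfolding computable_def by blast
  show ?thesis unfolding computable_def
    by (rule exI[of _ "Comp pair_prog [p, q]"])
      (auto simp: pair_enc_def intro: rec_eval_Comp2 p q pair_prog)
qed

lemma computable_fst:
  assumes "computable E (pair_enc E1 E2) F"
  shows "computable E E1 (\<lambda>x. fst (F x))"
  by (rule computable_compose[OF _ assms], unfold computable_def)
    (auto simp: pair_enc_def intro: fst_prog)

lemma computable_snd:
  assumes "computable E (pair_enc E1 E2) F"
  shows "computable E E2 (\<lambda>x. snd (F x))"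
  by (rule computable_compose[OF _ assms], unfold computable_def)
    (auto simp: pair_enc_def intro: snd_prog)

lemma computable_binary:
  assumes "computable (pair_enc E1 E2) E3 (\<lambda>z. H (fst z) (snd z))"
    "computable E E1 F" "computable E E2 G"
  shows "computable E E3 (\<lambda>x. H (F x) (G x))"
  using computable_compose[OF assms(1) computable_Pair[OF assms(2,3)]] by simp

text \<open>\<open>Comp\<close> evaluates both branches before choosing. This is harmless because
  the programs considered here halt on every code of an input.\<close>

lemma computable_if:
  assumes "computable E bool_enc C" "computable E E1 F" "computable E E1 G"
  shows "computable E E1 (\<lambda>x. if C x then F x else G x)"
proof -
  obtain p q r where p: "\<And>x. rec_eval p [E x] (bool_enc (C x))"
    and q: "\<And>x. rec_eval q [E x] (E1 (F x))" and r: "\<And>x. rec_eval r [E x] (E1 (G x))"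
    using assms unfolding computable_def by metis
  have "rec_eval (Comp if_prog [p, q, r]) [E x] (E1 (if C x then F x else G x))" for x
    using rec_eval_Comp3[OF p q r if_prog, of x] by (cases "C x") (auto simp: bool_enc_def)
  then show ?thesis unfolding computable_def by blast
qed

text \<open>Folds, powers and enumerations are all reduced to this loop. The step may consult the
  input \<open>x\<close>; the counter that \<open>PrimRec\<close> supplies is dropped by the two
  projections.\<close>

lemma computable_funpow:
  assumes "computable E nat_enc N" "computable E E1 I"
    "computable (pair_enc E1 E) E1 (\<lambda>z. S (fst z) (snd z))"
  shows "computable E E1 (\<lambda>x. ((\<lambda>y. S y x) ^^ N x) (I x))"
proof -
  obtain p q r where p: "\<And>x. rec_eval p [E x] (N x)"
    and q: "\<And>x. rec_eval q [E x] (E1 (I x))"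
    and r: "\<And>y x. rec_eval r [prod_encode (E1 y, E x)] (E1 (S y x))"
    using assms unfolding computable_def nat_enc_def pair_enc_def by (metis fst_conv snd_conv)
  have s: "rec_eval (Comp r [Comp pair_prog [Proj 1, Proj 2]]) [n, E1 y, E x] (E1 (S y x))" for n y x
    by (rule rec_eval_Comp1[OF _ r] rec_eval_Comp2[OF _ _ pair_prog] rec_eval_Proj_nth)+
  have "rec_eval (Comp (PrimRec q (Comp r [Comp pair_prog [Proj 1, Proj 2]])) [p, Proj 0]) [E x]
      (E1 (((\<lambda>y. S y x) ^^ N x) (I x)))" for x
    by (rule rec_eval_Comp2[OF p rec_eval_Proj_nth(1)
        rec_eval_PrimRec[where h = "\<lambda>n. E1 (((\<lambda>y. S y x) ^^ n) (I x))"]])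
      (simp_all add: q s[unfolded One_nat_def])
  then show ?thesis unfolding computable_def by blast
qed

text \<open>\<open>Mu\<close> demands a value at every smaller argument, which a decidable predicate
  supplies; the existence assumption makes the search stop for every \<open>x\<close>.\<close>

lemma computable_Least:
  assumes "computable (pair_enc nat_enc E) bool_enc (\<lambda>z. Q (fst z) (snd z))" "\<And>x. \<exists>n. Q n x"
  shows "computable E nat_enc (\<lambda>x. LEAST n. Q n x)"
proof -
  obtain p where p: "\<And>n x. rec_eval p [prod_encode (n, E x)] (bool_enc (Q n x))"
    using assms(1) unfolding computable_def nat_enc_def pair_enc_def by (metis fst_conv snd_conv)
  let ?q = "Comp p [Comp pair_prog [Proj 0, Proj 1]]"
  have q: "rec_eval ?q [n, E x] (bool_enc (Q n x))" for n x
    by (rule rec_eval_Comp1[OF _ p] rec_eval_Comp2[OF _ _ pair_prog] rec_eval_Proj_nth)+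
  have "rec_eval (Mu ?q) [E x] (LEAST n. Q n x)" for x
  proof (rule eval_Mu)
    show "rec_eval ?q [LEAST n. Q n x, E x] 0"
      using q[of "LEAST n. Q n x" x] LeastI_ex[OF assms(2), of x] by (simp add: bool_enc_def)
    show "\<exists>y. rec_eval ?q [m, E x] (Suc y)" if "m < (LEAST n. Q n x)" for m
      using q[of m x] not_less_Least[OF that] by (auto simp: bool_enc_def)
  qed
  then show ?thesis unfolding computable_def nat_enc_def by blast
qed

lemma computable_nat_basics:
  "computable nat_enc nat_enc Suc"
  "computable (pair_enc nat_enc nat_enc) nat_enc (\<lambda>z. fst z + snd z)"
  "computable (pair_enc nat_enc nat_enc) nat_enc (\<lambda>z. fst z - snd z)"
proof -
  show "computable nat_enc nat_enc Suc"
    unfolding computable_def nat_enc_def using eval_Succ by blast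
  have "rec_eval (Comp plus_prog [fst_prog, snd_prog]) [prod_encode (m, n)] (m + n)" for m n
    by (rule rec_eval_Comp2[OF fst_prog snd_prog plus_prog])
  then show "computable (pair_enc nat_enc nat_enc) nat_enc (\<lambda>z. fst z + snd z)"
    unfolding computable_def nat_enc_def pair_enc_def by blast
  have "rec_eval (Comp monus_prog [snd_prog, fst_prog]) [prod_encode (m, n)] (m - n)" for m n
    by (rule rec_eval_Comp2[OF snd_prog fst_prog monus_prog])
  then show "computable (pair_enc nat_enc nat_enc) nat_enc (\<lambda>z. fst z - snd z)"
    unfolding computable_def nat_enc_def pair_enc_def by blast
qed

lemmas computable_Suc = computable_compose[OF computable_nat_basics(1)]
lemmas computable_plus_nat = computable_binary[OF computable_nat_basics(2)]
lemmas computable_minus_nat = computable_binary[OF computable_nat_basics(3)]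

lemma computable_is_0:
  assumes "computable E nat_enc F"
  shows "computable E bool_enc (\<lambda>x. F x = 0)"
proof -
  obtain p where p: "\<And>x. rec_eval p [E x] (F x)"
    using assms unfolding computable_def nat_enc_def by blast
  obtain o1 where o1: "\<And>xs. rec_eval o1 xs 1" using rec_eval_const by blast
  have "rec_eval (Comp if_prog [p, Zero, o1]) [E x] (bool_enc (F x = 0))" for x
    using rec_eval_Comp3[OF p eval_Zero o1 if_prog, of x] by (simp add: bool_enc_def)
  then show ?thesis unfolding computable_def by blast
qed

text \<open>The same program, with its output now read as a number. Tests for equality or emptiness
  are carried out on codes in this way.\<close>

lemma computable_code:
  assumes "computable E E1 F"
  shows "computable E nat_enc (\<lambda>x. E1 (F x))"
  using assms unfolding computable_def nat_enc_def by simp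

lemma computable_conj:
  "computable E bool_enc A \<Longrightarrow> computable E bool_enc B \<Longrightarrow> computable E bool_enc (\<lambda>x. A x \<and> B x)"
  by (rule computable_cong_code[OF computable_if[OF _ _ computable_const, of E A bool_enc B False]])
    auto

lemma computable_disj:
  "computable E bool_enc A \<Longrightarrow> computable E bool_enc B \<Longrightarrow> computable E bool_enc (\<lambda>x. A x \<or> B x)"
  by (rule computable_cong_code[OF computable_if[OF _ computable_const, of E A bool_enc B True]])
    auto

lemma computable_eq:
  assumes "inj E1" "computable E E1 F" "computable E E1 G"
  shows "computable E bool_enc (\<lambda>x. F x = G x)"
proof -
  \<comment> \<open>Subtraction is truncated, so both differences vanish only when the codes are
    equal.\<close>
  have "computable E bool_enc (\<lambda>x. (E1 (F x) - E1 (G x)) + (E1 (G x) - E1 (F x)) = 0)"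
    by (intro computable_is_0 computable_plus_nat computable_minus_nat computable_code assms)
  then show ?thesis
    by (rule computable_cong_code) (use assms(1) in \<open>auto simp: inj_def intro!: arg_cong[of _ _ bool_enc]\<close>)
qed

lemma computable_less:
  assumes "computable E nat_enc F" "computable E nat_enc G"
  shows "computable E bool_enc (\<lambda>x. F x < G x)"
proof -
  have "computable E bool_enc (\<lambda>x. Suc (F x) - G x = 0)"
    by (intro computable_is_0 computable_minus_nat computable_Suc assms)
  then show ?thesis
    by (rule computable_cong_code) (auto intro!: arg_cong[of _ _ bool_enc])
qed

lemma inj_nat_enc: "inj nat_enc"
  by (simp add: inj_def nat_enc_def)

lemma inj_pair_enc: "inj E1 \<Longrightarrow> inj E2 \<Longrightarrow> inj (pair_enc E1 E2)"
  by (auto simp: inj_def pair_enc_def)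

lemma inj_list_enc: "inj E \<Longrightarrow> inj (list_enc E)"
  by (auto simp: inj_def list_enc_def list_encode_eq dest: map_injective[of E, unfolded inj_def] injD)

lemma inj_poly_enc: "inj E \<Longrightarrow> inj (poly_enc E)"
  using inj_list_enc[of E] by (auto simp: inj_def poly_enc_def coeffs_eq_iff)

subsection \<open>Lists\<close>

lemma list_enc_simps [simp]:
  "list_enc E [] = 0" "list_enc E (x # xs) = Suc (prod_encode (E x, list_enc E xs))"
  by (simp_all add: list_enc_def)

lemma computable_Cons:
  assumes "computable E E1 F" "computable E (list_enc E1) L"
  shows "computable E (list_enc E1) (\<lambda>x. F x # L x)"
proof -
  have "computable E nat_enc (\<lambda>x. Suc (pair_enc E1 (list_enc E1) (F x, L x)))"
    by (intro computable_Suc computable_code[OF computable_Pair] assms)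
  then show ?thesis
    by (rule computable_cong_code) (simp add: nat_enc_def pair_enc_def)
qed

text \<open>The code of a nonempty list is one more than the code of the pair of its head and tail,
  so taking off 1 exposes both.\<close>

lemma computable_case_list:
  assumes "computable E (list_enc E1) L" "computable E E2 N"
    "computable (pair_enc (pair_enc E1 (list_enc E1)) E) E2 (\<lambda>z. C (fst (fst z)) (snd (fst z)) (snd z))"
  shows "computable E E2 (\<lambda>x. case L x of [] \<Rightarrow> N x | y # ys \<Rightarrow> C y ys x)"
proof -
  \<comment> \<open>The value at \<open>[]\<close> is an arbitrary pair: both branches get
    evaluated, and the program for the second needs a genuine code as its argument.\<close>
  define yys where "yys x = (case L x of [] \<Rightarrow> (undefined, []) | y # ys \<Rightarrow> (y, ys))" for x
  have "computable E nat_enc (\<lambda>x. if list_enc E1 (L x) = 0 then pair_enc E1 (list_enc E1) (undefined, [])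
      else list_enc E1 (L x) - 1)"
    by (intro computable_if computable_is_0 computable_minus_nat computable_const
        computable_code[OF assms(1)])
  then have 1: "computable E (pair_enc E1 (list_enc E1)) yys"
    by (rule computable_cong_code)
      (auto simp: yys_def pair_enc_def nat_enc_def split: list.splits)
  have "computable E E2 (\<lambda>x. if list_enc E1 (L x) = 0 then N x
      else C (fst (yys x)) (snd (yys x)) x)"
    by (intro computable_if computable_is_0 computable_code[OF assms(1)] assms(2)
        computable_compose[OF assms(3) computable_Pair[OF 1 computable_id], simplified])
  then show ?thesis
    by (rule computable_cong_code) (auto simp: yys_def split: list.splits)
qed

text \<open>The code can thus serve as the number of rounds in a traversal of the list.\<close>

lemma length_le_list_enc: "length xs \<le> list_enc E xs"
proof (induction xs)
  case (Cons x xs)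
  then show ?case using le_prod_encode_2[of "list_enc E xs" "E x"] by simp
qed simp

text \<open>Surplus rounds do no harm because a state with empty list is fixed by the step.\<close>

lemma foldl_eq_funpow:
  assumes "length xs \<le> n"
  shows "foldl f a xs = snd (((\<lambda>s. case fst s of [] \<Rightarrow> ([], snd s)
    | y # ys \<Rightarrow> (ys, f (snd s) y)) ^^ n) (xs, a))" (is "_ = snd ((?S ^^ n) _)")
  using assms
proof (induction n arbitrary: xs a)
  case (Suc n)
  have nil: "(?S ^^ n) ([], a) = ([], a)" for n a
    by (induction n) auto
  show ?case
  proof (cases xs)
    case Nil
    then show ?thesis using nil[of "Suc n"] by simp
  next
    case (Cons y ys)
    then show ?thesis using Suc by (simp add: funpow_Suc_right del: funpow.simps)
  qed
qed simp

lemma computable_foldl: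
  fixes F :: "'d \<Rightarrow> 'c \<Rightarrow> 'b \<Rightarrow> 'd"
  assumes "computable (pair_enc E2 (pair_enc E1 E)) E2 (\<lambda>z. F (fst z) (fst (snd z)) (snd (snd z)))"
    "computable E E2 I" "computable E (list_enc E1) L"
  shows "computable E E2 (\<lambda>x. foldl (\<lambda>a y. F a y x) (I x) (L x))"
proof -
  let ?S = "\<lambda>s x. case fst s of [] \<Rightarrow> ([], snd s) | y # ys \<Rightarrow> (ys, F (snd s) y x)"
  have "computable (pair_enc (pair_enc (list_enc E1) E2) E) (pair_enc (list_enc E1) E2)
      (\<lambda>z. ?S (fst z) (snd z))"
    by (rule computable_case_list)
      (rule computable_fst computable_snd computable_id computable_const computable_Pair
        computable_compose[OF assms(1) computable_Pair[OF _ computable_Pair], simplified])+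
  then have "computable E E2 (\<lambda>x. snd (((\<lambda>y. ?S y x) ^^ list_enc E1 (L x)) (L x, I x)))"
    by (rule computable_snd[OF computable_funpow[OF computable_code[OF assms(3)]
        computable_Pair[OF assms(3,2)]]])
  then show ?thesis
    by (rule computable_cong_code) (subst foldl_eq_funpow[OF length_le_list_enc], rule refl)
qed

lemma computable_rev:
  fixes L :: "'b \<Rightarrow> 'c list"
  assumes "computable E (list_enc E1) L"
  shows "computable E (list_enc E1) (\<lambda>x. rev (L x))"
proof -
  have "foldl (\<lambda>a y. y # a) ys xs = rev xs @ ys" for xs ys :: "'c list"
    by (induction xs arbitrary: ys) auto
  from this[of "[]"] have "rev xs = foldl (\<lambda>a y. y # a) [] xs" for xs :: "'c list"
    by simp
  moreover have "computable E (list_enc E1) (\<lambda>x. foldl (\<lambda>a y. y # a) [] (L x))"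
    by (rule computable_foldl computable_Cons computable_fst computable_snd computable_id
        computable_const assms)+
  ultimately show ?thesis by simp
qed

lemma computable_foldr:
  fixes F :: "'c \<Rightarrow> 'd \<Rightarrow> 'b \<Rightarrow> 'd"
  assumes "computable (pair_enc (pair_enc E1 E2) E) E2 (\<lambda>z. F (fst (fst z)) (snd (fst z)) (snd z))"
    "computable E (list_enc E1) L" "computable E E2 I"
  shows "computable E E2 (\<lambda>x. foldr (\<lambda>y a. F y a x) (L x) (I x))"
proof -
  have "foldr g xs a = foldl (\<lambda>a y. g y a) a (rev xs)" for g :: "'c \<Rightarrow> 'd \<Rightarrow> 'd" and xs a
    by (simp add: foldr_conv_fold foldl_conv_fold)
  moreover have "computable E E2 (\<lambda>x. foldl (\<lambda>a y. F y a x) (I x) (rev (L x)))"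
    by (rule computable_foldl[OF _ assms(3) computable_rev[OF assms(2)]])
      (rule computable_compose[OF assms(1) computable_Pair[OF computable_Pair], simplified]
        computable_fst computable_snd computable_id)+
  ultimately show ?thesis by simp
qed

lemma computable_map:
  fixes F :: "'c \<Rightarrow> 'b \<Rightarrow> 'd"
  assumes "computable (pair_enc E1 E) E2 (\<lambda>z. F (fst z) (snd z))" "computable E (list_enc E1) L"
  shows "computable E (list_enc E2) (\<lambda>x. map (\<lambda>y. F y x) (L x))"
proof -
  have "map g xs = foldr (\<lambda>y a. g y # a) xs []" for g :: "'c \<Rightarrow> 'd" and xs
    by (induction xs) auto
  moreover have "computable E (list_enc E2) (\<lambda>x. foldr (\<lambda>y a. F y x # a) (L x) [])"
    by (rule computable_foldr[OF _ assms(2)] computable_Cons computable_const computable_fst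
        computable_snd computable_id computable_binary[OF assms(1)])+
  ultimately show ?thesis by simp
qed

lemma computable_filter:
  fixes Q :: "'c \<Rightarrow> 'b \<Rightarrow> bool"
  assumes "computable (pair_enc E1 E) bool_enc (\<lambda>z. Q (fst z) (snd z))" "computable E (list_enc E1) L"
  shows "computable E (list_enc E1) (\<lambda>x. filter (\<lambda>y. Q y x) (L x))"
proof -
  have "filter g xs = foldr (\<lambda>y a. if g y then y # a else a) xs []" for g :: "'c \<Rightarrow> bool" and xs
    by (induction xs) auto
  moreover have "computable E (list_enc E1) (\<lambda>x. foldr (\<lambda>y a. if Q y x then y # a else a) (L x) [])"
    by (rule computable_foldr[OF _ assms(2)] computable_if computable_Cons computable_const
        computable_fst computable_snd computable_id computable_binary[OF assms(1)])+
  ultimately show ?thesis by simp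
qed

lemma computable_Ball_set:
  fixes Q :: "'c \<Rightarrow> 'b \<Rightarrow> bool"
  assumes "computable (pair_enc E1 E) bool_enc (\<lambda>z. Q (fst z) (snd z))" "computable E (list_enc E1) L"
  shows "computable E bool_enc (\<lambda>x. \<forall>y\<in>set (L x). Q y x)"
proof -
  have "(\<forall>y\<in>set xs. g y) = foldr (\<lambda>y a. g y \<and> a) xs True" for g :: "'c \<Rightarrow> bool" and xs
    by (induction xs) auto
  moreover have "computable E bool_enc (\<lambda>x. foldr (\<lambda>y a. Q y x \<and> a) (L x) True)"
    by (rule computable_foldr[OF _ assms(2)] computable_conj computable_const
        computable_fst computable_snd computable_id computable_binary[OF assms(1)])+
  ultimately show ?thesis by simp
qed

lemma computable_append:
  fixes L :: "'b \<Rightarrow> 'c list"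
  assumes "computable E (list_enc E1) L" "computable E (list_enc E1) L'"
  shows "computable E (list_enc E1) (\<lambda>x. L x @ L' x)"
proof -
  have "xs @ ys = foldr (\<lambda>y a. y # a) xs ys" for xs ys :: "'c list"
    by (induction xs) auto
  moreover have "computable E (list_enc E1) (\<lambda>x. foldr (\<lambda>y a. y # a) (L x) (L' x))"
    by (rule computable_foldr[OF _ assms] computable_Cons computable_fst computable_snd
        computable_id)+
  ultimately show ?thesis by simp
qed

lemma computable_concat:
  fixes L :: "'b \<Rightarrow> 'c list list"
  assumes "computable E (list_enc (list_enc E1)) L"
  shows "computable E (list_enc E1) (\<lambda>x. concat (L x))"
proof -
  have "concat xs = foldr (\<lambda>y a. y @ a) xs []" for xs :: "'c list list"
    by (induction xs) auto
  moreover have "computable E (list_enc E1) (\<lambda>x. foldr (\<lambda>y a. y @ a) (L x) [])"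
    by (rule computable_foldr[OF _ assms] computable_append computable_const computable_fst
        computable_snd computable_id)+
  ultimately show ?thesis by simp
qed

lemma computable_length:
  fixes L :: "'b \<Rightarrow> 'c list"
  assumes "computable E (list_enc E1) L"
  shows "computable E nat_enc (\<lambda>x. length (L x))"
proof -
  have "length xs = foldr (\<lambda>y a. Suc a) xs 0" for xs :: "'c list"
    by (induction xs) auto
  moreover have "computable E nat_enc (\<lambda>x. foldr (\<lambda>y a. Suc a) (L x) 0)"
    by (rule computable_foldr[OF _ assms] computable_Suc computable_const computable_fst
        computable_snd computable_id)+
  ultimately show ?thesis by simp
qed

lemma computable_upt:
  assumes "computable E nat_enc N"
  shows "computable E (list_enc nat_enc) (\<lambda>x. [0..<N x])"
proof -
  \<comment> \<open>The length of the list built so far is its next entry, which saves a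
    counter.\<close>
  have "[0..<n] = ((\<lambda>ys. ys @ [length ys]) ^^ n) []" for n
  proof (induction n)
    case (Suc n)
    then show ?case by (simp flip: Suc)
  qed simp
  moreover have "computable E (list_enc nat_enc) (\<lambda>x. ((\<lambda>ys. ys @ [length ys]) ^^ N x) [])"
    by (rule computable_funpow[OF assms] computable_append computable_Cons computable_length
        computable_const computable_fst computable_snd computable_id)+
  ultimately show ?thesis by simp
qed

lemma computable_n_lists:
  fixes L :: "'b \<Rightarrow> 'c list"
  assumes "computable E nat_enc N" "computable E (list_enc E1) L"
  shows "computable E (list_enc (list_enc E1)) (\<lambda>x. List.n_lists (N x) (L x))"
proof -
  have "List.n_lists n xs = ((\<lambda>yss. concat (map (\<lambda>ys. map (\<lambda>y. y # ys) xs) yss)) ^^ n) [[]]"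
    for n and xs :: "'c list"
    by (induction n) auto
  moreover have "computable E (list_enc (list_enc E1))
    (\<lambda>x. ((\<lambda>yss. concat (map (\<lambda>ys. map (\<lambda>y. y # ys) (L x)) yss)) ^^ N x) [[]])"
    by (rule computable_funpow[OF assms(1)] computable_const computable_concat computable_map
      computable_Cons computable_compose[OF assms(2)] computable_fst computable_snd computable_id)+
  ultimately show ?thesis by simp
qed

lemma computable_nth_default:
  fixes L :: "'b \<Rightarrow> 'c list"
  assumes "computable E (list_enc E1) L" "computable E nat_enc N"
  shows "computable E E1 (\<lambda>x. nth_default d (L x) (N x))"
proof -
  have drop: "drop n xs = ((\<lambda>ys. case ys of [] \<Rightarrow> [] | y # ys \<Rightarrow> ys) ^^ n) xs" for n and xs :: "'c list"
  proof (induction n)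
    case (Suc n)
    have "drop (Suc n) xs = tl (drop n xs)"
      by (simp add: drop_Suc tl_drop)
    then show ?case by (simp add: tl_def flip: Suc)
  qed simp
  have "nth_default d xs n = (case drop n xs of [] \<Rightarrow> d | y # ys \<Rightarrow> y)" for n and xs :: "'c list"
    by (auto simp: nth_default_def Cons_nth_drop_Suc[symmetric])
  moreover have "computable E E1 (\<lambda>x. case ((\<lambda>ys. case ys of [] \<Rightarrow> [] | y # ys \<Rightarrow> ys) ^^ N x) (L x)
      of [] \<Rightarrow> d | y # ys \<Rightarrow> y)"
    by (rule computable_case_list computable_funpow[OF assms(2)] assms(1) computable_const
        computable_fst computable_snd computable_id)+
  ultimately show ?thesis by (simp add: drop)
qed

subsection \<open>Arithmetic of polynomials\<close>

lemma computable_times_nat: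
  assumes "computable E nat_enc F" "computable E nat_enc G"
  shows "computable E nat_enc (\<lambda>x. F x * G x)"
proof -
  have "m * n = ((\<lambda>y. y + n) ^^ m) 0" for m n :: nat
    by (induction m) auto
  moreover have "computable E nat_enc (\<lambda>x. ((\<lambda>y. y + G x) ^^ F x) 0)"
    by (rule computable_funpow[OF assms(1)] computable_const computable_plus_nat
        computable_compose[OF assms(2)] computable_fst computable_snd computable_id)+
  ultimately show ?thesis by simp
qed

lemma computable_power_nat:
  assumes "computable E nat_enc F" "computable E nat_enc G"
  shows "computable E nat_enc (\<lambda>x. F x ^ G x)"
proof -
  have "m ^ n = ((\<lambda>y. m * y) ^^ n) 1" for m n :: nat
    by (induction n) auto
  moreover have "computable E nat_enc (\<lambda>x. ((\<lambda>y. F x * y) ^^ G x) 1)"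
    by (rule computable_funpow[OF assms(2)] computable_const computable_times_nat
        computable_compose[OF assms(1)] computable_fst computable_snd computable_id)+
  ultimately show ?thesis by simp
qed

lemma computable_coeffs:
  "computable E (poly_enc E1) F \<Longrightarrow> computable E (list_enc E1) (\<lambda>x. coeffs (F x))"
  by (erule computable_cong_code) (simp add: poly_enc_def)

lemma computable_coeff:
  assumes "computable E (poly_enc E1) F" "computable E nat_enc N"
  shows "computable E E1 (\<lambda>x. coeff (F x) (N x))"
  using computable_nth_default[OF computable_coeffs[OF assms(1)] assms(2), of 0]
  by (simp add: nth_default_coeffs_eq)

lemma computable_degree:
  assumes "computable E (poly_enc E1) F"
  shows "computable E nat_enc (\<lambda>x. degree (F x))"
proof -
  have "computable E nat_enc (\<lambda>x. length (coeffs (F x)) - 1)"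
    by (rule computable_minus_nat computable_length computable_coeffs computable_const assms)+
  then show ?thesis by (simp add: degree_eq_length_coeffs)
qed

lemma computable_lead_coeff:
  assumes "computable E (poly_enc E1) F"
  shows "computable E E1 (\<lambda>x. lead_coeff (F x))"
  by (rule computable_coeff computable_degree assms)+

text \<open>\<open>coeffs\<close> never ends in a zero, so prepending 0 to the zero polynomial must
  give the empty list. The zero polynomial is recognised by its code 0.\<close>

lemma computable_pCons:
  assumes "inj E1" "computable E E1 F" "computable E (poly_enc E1) G"
  shows "computable E (poly_enc E1) (\<lambda>x. pCons (F x) (G x))"
proof -
  have "computable E (list_enc E1)
      (\<lambda>x. if F x = 0 \<and> poly_enc E1 (G x) = 0 then [] else F x # coeffs (G x))"
    by (intro computable_if computable_conj computable_eq[OF assms(1)] computable_is_0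
        computable_code[OF assms(3)] computable_Cons computable_coeffs assms computable_const)
  then show ?thesis
  proof (rule computable_cong_code)
    show "poly_enc E1 (pCons (F x) (G x))
      = list_enc E1 (if F x = 0 \<and> poly_enc E1 (G x) = 0 then [] else F x # coeffs (G x))" for x
      by (cases "coeffs (G x)") (auto simp: poly_enc_def cCons_def)
  qed
qed

lemma computable_Poly:
  assumes "inj E1" "computable E (list_enc E1) L"
  shows "computable E (poly_enc E1) (\<lambda>x. Poly (L x))"
proof -
  have "Poly xs = foldr (\<lambda>y a. pCons y a) xs 0" for xs :: "'a list"
    by (induction xs) auto
  moreover have "computable E (poly_enc E1) (\<lambda>x. foldr (\<lambda>y a. pCons y a) (L x) 0)"
    by (rule computable_foldr[OF _ assms(2)] computable_pCons[OF assms(1)] computable_const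
        computable_fst computable_snd computable_id)+
  ultimately show ?thesis by simp
qed

lemma computable_monom:
  assumes "inj E1" "computable E E1 F" "computable E nat_enc N"
  shows "computable E (poly_enc E1) (\<lambda>x. monom (F x) (N x))"
proof -
  have "monom c n = ((\<lambda>y. pCons 0 y) ^^ n) (pCons c 0)" for c :: 'a and n
    by (induction n) (auto simp: monom_0 monom_Suc)
  moreover have "computable E (poly_enc E1) (\<lambda>x. ((\<lambda>y. pCons 0 y) ^^ N x) (pCons (F x) 0))"
    by (rule computable_funpow[OF assms(3)] computable_pCons[OF assms(1)] computable_const assms(2)
        computable_fst computable_snd computable_id)+
  ultimately show ?thesis by simp
qed

definition ring_computable :: "('b::comm_ring_1 \<Rightarrow> nat) \<Rightarrow> bool" where
  "ring_computable E \<longleftrightarrow> inj E \<and>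
     computable (pair_enc E E) E (\<lambda>z. fst z + snd z) \<and>
     computable (pair_enc E E) E (\<lambda>z. fst z - snd z) \<and>
     computable (pair_enc E E) E (\<lambda>z. fst z * snd z)"

lemma ring_computableD:
  assumes "ring_computable E1"
  shows "inj E1"
    "computable E E1 F \<Longrightarrow> computable E E1 G \<Longrightarrow> computable E E1 (\<lambda>x. F x + G x)"
    "computable E E1 F \<Longrightarrow> computable E E1 G \<Longrightarrow> computable E E1 (\<lambda>x. F x - G x)"
    "computable E E1 F \<Longrightarrow> computable E E1 G \<Longrightarrow> computable E E1 (\<lambda>x. F x * G x)"
  using assms unfolding ring_computable_def by (blast, (blast intro: computable_binary[of E1 E1])+)

lemma computable_power:
  assumes "ring_computable E1" "computable E E1 F" "computable E nat_enc N"
  shows "computable E E1 (\<lambda>x. F x ^ N x)"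
proof -
  have "c ^ n = ((\<lambda>y. c * y) ^^ n) 1" for c :: 'a and n
    by (induction n) auto
  moreover have "computable E E1 (\<lambda>x. ((\<lambda>y. F x * y) ^^ N x) 1)"
    by (rule computable_funpow[OF assms(3)] ring_computableD(4)[OF assms(1)] computable_const
        computable_compose[OF assms(2)] computable_fst computable_snd computable_id)+
  ultimately show ?thesis by simp
qed

lemma computable_smult:
  assumes "ring_computable E1" "computable E E1 F" "computable E (poly_enc E1) G"
  shows "computable E (poly_enc E1) (\<lambda>x. smult (F x) (G x))"
proof -
  have "smult c p = Poly (map (\<lambda>y. c * y) (coeffs p))" for c :: 'a and p
    by (rule poly_eqI) (simp add: nth_default_map_eq[of _ 0 0] nth_default_coeffs_eq)
  moreover have "computable E (poly_enc E1) (\<lambda>x. Poly (map (\<lambda>y. F x * y) (coeffs (G x))))"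
    by (rule computable_Poly[OF ring_computableD(1)[OF assms(1)]] computable_map
        ring_computableD(4)[OF assms(1)] computable_coeffs[OF assms(3)]
        computable_compose[OF assms(2)] computable_fst computable_snd computable_id)+
  ultimately show ?thesis by simp
qed

text \<open>Beyond both lengths the coefficients of \<open>K\<close> vanish by
  \<open>H 0 0 = 0\<close>; the sum of the lengths is a convenient common bound. \<open>Poly\<close>
  removes the trailing zeros that cancellation and this generous bound produce.\<close>

lemma computable_coeffwise:
  fixes E1 :: "'b::zero \<Rightarrow> nat"
  assumes "inj E1" "H 0 0 = 0" "computable (pair_enc E1 E1) E1 (\<lambda>z. H (fst z) (snd z))"
    and F: "computable E (poly_enc E1) F" "computable E (poly_enc E1) G"
    and K: "\<And>x i. coeff (K x) i = H (coeff (F x) i) (coeff (G x) i)"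
  shows "computable E (poly_enc E1) K"
proof -
  have K_eq: "K x = Poly (map (\<lambda>i. H (coeff (F x) i) (coeff (G x) i))
        [0..<length (coeffs (F x)) + length (coeffs (G x))])" for x
  proof (rule poly_eqI)
    fix i
    show "coeff (K x) i = coeff (Poly (map (\<lambda>i. H (coeff (F x) i) (coeff (G x) i))
        [0..<length (coeffs (F x)) + length (coeffs (G x))])) i"
    proof (cases "i < length (coeffs (F x)) + length (coeffs (G x))")
      case True
      then show ?thesis by (simp add: nth_default_def K)
    next
      case False
      then have "coeff (F x) i = 0" "coeff (G x) i = 0"
        by (simp_all add: nth_default_coeffs_eq[symmetric] nth_default_beyond)
      then show ?thesis using False assms(2) by (simp add: nth_default_beyond K)
    qed
  qed
  have "computable E (poly_enc E1) (\<lambda>x. Poly (map (\<lambda>i. H (coeff (F x) i) (coeff (G x) i))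
        [0..<length (coeffs (F x)) + length (coeffs (G x))]))"
    by (rule computable_Poly[OF assms(1)] computable_map
        computable_binary[OF assms(3)] computable_upt computable_plus_nat computable_length
        computable_coeffs[OF F(1)] computable_coeffs[OF F(2)] computable_coeff
        computable_compose[OF F(1)] computable_compose[OF F(2)]
        computable_fst computable_snd computable_id)+
  then show ?thesis
    by (rule computable_cong_code) (simp only: K_eq)
qed

lemma computable_plus_poly:
  assumes "ring_computable E1" "computable E (poly_enc E1) F" "computable E (poly_enc E1) G"
  shows "computable E (poly_enc E1) (\<lambda>x. F x + G x)"
  by (rule computable_coeffwise[where H = "(+)", OF _ _ _ assms(2,3)])
    (use assms(1) in \<open>simp_all add: ring_computable_def\<close>)

lemma computable_minus_poly:
  assumes "ring_computable E1" "computable E (poly_enc E1) F" "computable E (poly_enc E1) G"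
  shows "computable E (poly_enc E1) (\<lambda>x. F x - G x)"
  by (rule computable_coeffwise[where H = "(-)", OF _ _ _ assms(2,3)])
    (use assms(1) in \<open>simp_all add: ring_computable_def\<close>)

lemma computable_times_poly:
  assumes E: "ring_computable E1" and "computable E (poly_enc E1) F" "computable E (poly_enc E1) G"
  shows "computable E (poly_enc E1) (\<lambda>x. F x * G x)"
proof -
  have "F x * G x = foldr (\<lambda>a r. smult a (G x) + pCons 0 r) (coeffs (F x)) 0" for x
    by (simp add: times_poly_def fold_coeffs_def)
  moreover have "computable E (poly_enc E1)
      (\<lambda>x. foldr (\<lambda>a r. smult a (G x) + pCons 0 r) (coeffs (F x)) 0)"
    by (rule computable_foldr computable_plus_poly[OF E] computable_smult[OF E]
        computable_pCons[OF ring_computableD(1)[OF E]] computable_coeffs[OF assms(2)]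
        computable_const computable_fst computable_snd computable_id
        computable_compose[OF assms(3)])+
  ultimately show ?thesis by simp
qed

lemma ring_computable_poly:
  assumes "ring_computable E"
  shows "ring_computable (poly_enc E)"
  unfolding ring_computable_def
  by (intro conjI inj_poly_enc ring_computableD(1)[OF assms] computable_plus_poly[OF assms]
      computable_minus_poly[OF assms] computable_times_poly[OF assms]
      computable_fst[OF computable_id] computable_snd[OF computable_id])

text \<open>A function on a finite type is a finite table, built here by adding one entry at a
  time.\<close>

lemma computable_finite:
  fixes F :: "'b::finite \<Rightarrow> 'c"
  assumes "inj E"
  shows "computable E E' F"
proof -
  have "computable E E' (\<lambda>x. if x \<in> A then F x else undefined)" for A
  proof (induction A rule: finite_induct[OF finite])
    case 1
    show ?case by (simp add: computable_const)
  next
    case (2 a A)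
    have "computable E E' (\<lambda>x. if x = a then F a else if x \<in> A then F x else undefined)"
      by (intro computable_if computable_eq[OF assms] computable_const computable_id 2)
    then show ?case
      by (rule computable_cong_code) auto
  qed
  from this[of UNIV] show ?thesis by simp
qed

lemma ring_computable_finite:
  fixes e :: "'b::{comm_ring_1, finite} \<Rightarrow> nat"
  assumes "inj e"
  shows "ring_computable e"
  unfolding ring_computable_def
  using assms computable_finite[OF inj_pair_enc[OF assms assms]] by blast

text \<open>A decoder for field elements. It has to answer on every number, because the search for a
  quotient also meets numbers that code no polynomial.\<close>

lemma computable_inv:
  fixes e :: "'b::finite \<Rightarrow> nat"
  assumes "inj e"
  shows "computable nat_enc e (\<lambda>m. if m \<in> range e then inv_into UNIV e m else undefined)"
proof -
  have "computable nat_enc e (\<lambda>m. if m \<in> e ` A then inv_into UNIV e m else undefined)" for A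
  proof (induction A rule: finite_induct[OF finite])
    case 1
    show ?case by (simp add: computable_const)
  next
    case (2 a A)
    have "computable nat_enc e (\<lambda>m. if m = e a then a else if m \<in> e ` A then inv_into UNIV e m else undefined)"
      by (intro computable_if computable_eq[OF inj_nat_enc] computable_const computable_id 2)
    then show ?case
      by (rule computable_cong_code) (use assms in auto)
  qed
  from this[of UNIV] show ?thesis by simp
qed

text \<open>Instead of long division, the polynomials \<open>d m\<close> are tried until the
  remainder is shorter than the divisor. Uniqueness of division with remainder identifies the one
  found with the value of \<open>div\<close>.\<close>

lemma computable_div_poly:
  fixes e :: "'b::{field, finite} \<Rightarrow> nat"
  assumes e: "inj e" and F: "computable E (poly_enc e) F" "computable E (poly_enc e) G"
  shows "computable E (poly_enc e) (\<lambda>x. F x div G x)"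
proof -
  note R = ring_computable_poly[OF ring_computable_finite[OF e]]
  define d where "d m = Poly (map (\<lambda>k. if k \<in> range e then inv_into UNIV e k else undefined) (list_decode m))" for m
  \<comment> \<open>The first disjunct follows the convention that division by 0 gives 0 and lets
    the search stop for a zero divisor.\<close>
  define Q where "Q m z \<longleftrightarrow> snd z = 0 \<and> d m = 0 \<or>
      length (coeffs (fst z - d m * snd z)) < length (coeffs (snd z))" for m z
  have list_decode: "computable nat_enc (list_enc nat_enc) list_decode"
    by (rule computable_cong_code[OF computable_id]) (simp add: list_enc_def nat_enc_def map_idI)
  have "computable nat_enc (poly_enc e) d"
    unfolding d_def by (rule computable_Poly[OF e] computable_map list_decode
        computable_compose[OF computable_inv[OF e]] computable_fst computable_id)+
  note dc = computable_compose[OF this]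
  have d_surj: "\<exists>m. d m = p" for p
    by (rule exI[of _ "list_encode (map e (coeffs p))"])
      (simp add: d_def comp_def inv_into_f_f[OF e])
  have Q_iff: "Q m (a, b) \<longleftrightarrow> d m = a div b" for m a b
  proof (cases "b = 0")
    case False
    have "Q m (a, b) \<longleftrightarrow> a - d m * b = 0 \<or> degree (a - d m * b) < degree b"
      using False by (cases "a = d m * b") (auto simp: Q_def length_coeffs)
    also have "\<dots> \<longleftrightarrow> d m = a div b"
    proof
      assume "a - d m * b = 0 \<or> degree (a - d m * b) < degree b"
      then have "(a - d m * b) div b = 0"
        using div_poly_less by auto
      moreover have "((a - d m * b) + d m * b) div b = d m + (a - d m * b) div b"
        by (rule div_mult_self1) (rule False)
      ultimately show "d m = a div b" by simp
    next
      assume "d m = a div b"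
      then have "a - d m * b = a mod b"
        by (simp add: minus_div_mult_eq_mod)
      then show "a - d m * b = 0 \<or> degree (a - d m * b) < degree b"
        using degree_mod_less[OF False, of a] by simp
    qed
    finally show ?thesis .
  qed (simp add: Q_def)
  have "computable (pair_enc nat_enc (pair_enc (poly_enc e) (poly_enc e))) bool_enc
      (\<lambda>z. Q (fst z) (snd z))"
    unfolding Q_def
    by (rule computable_disj computable_conj computable_eq[OF ring_computableD(1)[OF R]]
        computable_less computable_length computable_coeffs ring_computableD(3,4)[OF R] dc
        computable_fst computable_snd computable_id computable_const)+
  moreover have Q_ex: "\<exists>m. Q m z" for z
    using Q_iff[of _ "fst z" "snd z"] d_surj[of "fst z div snd z"] by simp
  ultimately have "computable (pair_enc (poly_enc e) (poly_enc e)) (poly_enc e) (\<lambda>z. d (LEAST m. Q m z))"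
    by (rule dc[OF computable_Least])
  moreover have "d (LEAST m. Q m z) = fst z div snd z" for z
  proof -
    have "Q (LEAST m. Q m z) z"
      by (rule LeastI_ex[OF Q_ex])
    then show ?thesis using Q_iff[of _ "fst z" "snd z"] by simp
  qed
  ultimately have "computable (pair_enc (poly_enc e) (poly_enc e)) (poly_enc e) (\<lambda>z. fst z div snd z)"
    by simp
  then show ?thesis by (rule computable_binary[OF _ F])
qed

section \<open>The algorithm\<close>

text \<open>Horner's scheme: after each multiplication by x the coefficient of x^n, n being the
  degree of \<open>f\<close>, is cancelled by a multiple of \<open>f\<close>. For monic
  \<open>f\<close> no division of coefficients is involved.\<close>

definition mod_monic :: "'b::comm_ring_1 poly \<Rightarrow> 'b poly \<Rightarrow> 'b poly" where
  "mod_monic f h =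
     foldr (\<lambda>c r. pCons c r - smult (coeff (pCons c r) (degree f)) f) (coeffs h) 0"

text \<open>\<open>foldr\<close> begins with the last entry, which in a triangular list has the
  highest degree. For such lists the result is zero exactly on the span, so that membership becomes
  decidable.\<close>

definition reduce :: "'b::field poly poly list \<Rightarrow> 'b poly poly \<Rightarrow> 'b poly poly" where
  "reduce us h = foldr (\<lambda>g h. h - smult (coeff h (degree g) div lead_coeff g) g) us h"

text \<open>The elements g / p^N, for g in the span, are to form an order. The second condition says
  that they include R. The third says that a product gh / p^(2N) is again some k / p^N, that is, gh
  = p^N k modulo \<open>f\<close>.\<close>

definition order_basis :: "'b::field poly poly \<Rightarrow> 'b poly \<Rightarrow> nat \<Rightarrow> 'b poly poly list \<Rightarrow> bool" where
  "order_basis f p N us \<longleftrightarrow>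
     map (\<lambda>g. length (coeffs g)) us = map Suc [0..<degree f] \<and>
     (\<forall>j\<in>set [0..<degree f]. reduce us (monom (p ^ N) j) = 0) \<and>
     (\<forall>g\<in>set us. \<forall>h\<in>set us. reduce (map (\<lambda>u. smult (p ^ N) u) us) (mod_monic f (g * h)) = 0)"

text \<open>Any enumeration will do: the list is a constant inside the program.\<close>

definition field_elements :: "'b::finite list" where
  "field_elements = (SOME xs. set xs = UNIV)"

definition candidates :: "nat \<Rightarrow> nat \<Rightarrow> 'b::{field, finite} poly poly list list" where
  "candidates n D = List.n_lists n (map (\<lambda>cs. Poly cs)
     (List.n_lists n (map (\<lambda>as. Poly as) (List.n_lists (Suc D) field_elements))))"

text \<open>This is the weight of x. A sum bounds the degrees of all coefficients just as a maximum
  would, and it is a plain fold.\<close>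

definition coeff_degrees :: "'b::zero poly poly \<Rightarrow> nat" where
  "coeff_degrees f = foldr (\<lambda>c a. degree c + a) (coeffs f) 0"

definition exponent_bound :: "'b::{field, finite} poly poly \<Rightarrow> nat" where
  "exponent_bound f = card (UNIV :: 'b set) ^ (degree f * degree f * coeff_degrees f)"

text \<open>The same order may be listed with several bases, since the candidates are not
  normalised.\<close>

definition overorder_bases ::
  "'b::{field, finite} poly poly \<Rightarrow> 'b poly \<Rightarrow> ('b poly poly \<times> 'b poly) list list" where
  "overorder_bases f p =
     map (\<lambda>us. map (\<lambda>g. (g, p ^ exponent_bound f)) us)
       (filter (\<lambda>us. order_basis f p (exponent_bound f) us)
         (candidates (degree f) (exponent_bound f * degree p)))"

text \<open>All definitions of the algorithm are composed of folds, maps, filters and arithmetic, so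
  the closure rules follow their syntax.\<close>

lemma computable_overorder_bases:
  fixes e :: "'b::{field, finite} \<Rightarrow> nat"
  assumes e: "inj e"
  defines "E \<equiv> poly_enc (poly_enc e)"
  shows "computable (pair_enc E (poly_enc e)) (list_enc (list_enc (pair_enc E (poly_enc e))))
    (\<lambda>z. overorder_bases (fst z) (snd z))"
proof -
  note R1 = ring_computable_finite[OF e]
  note R2 = ring_computable_poly[OF R1]
  note R3 = ring_computable_poly[OF R2, folded E_def]
  note inj = ring_computableD(1)[OF R1] ring_computableD(1)[OF R2] ring_computableD(1)[OF R3]
  note projs = computable_fst computable_snd computable_id computable_const
  note E_rules = computable_smult[OF R2, folded E_def] computable_pCons[OF inj(2), folded E_def]
    computable_monom[OF inj(2), folded E_def] computable_Poly[OF inj(2), folded E_def]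
    computable_coeff[where ?E1.0 = "poly_enc e", folded E_def]
    computable_coeffs[where ?E1.0 = "poly_enc e", folded E_def]
    computable_degree[where ?E1.0 = "poly_enc e", folded E_def]
    computable_lead_coeff[where ?E1.0 = "poly_enc e", folded E_def]
  have "computable (pair_enc E E) E (\<lambda>z. mod_monic (fst z) (snd z))"
    unfolding mod_monic_def
    by (rule computable_foldr ring_computableD(3)[OF R3] E_rules projs)+
  note mod_monic = computable_binary[OF this]
  have "computable (pair_enc (list_enc E) E) E (\<lambda>z. reduce (fst z) (snd z))"
    unfolding reduce_def
    by (rule computable_foldr ring_computableD(3)[OF R3] computable_div_poly[OF e] E_rules projs)+
  note reduce = computable_binary[OF this]
  have "computable (pair_enc E (pair_enc (poly_enc e) (pair_enc nat_enc (list_enc E)))) bool_enc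
    (\<lambda>z. order_basis (fst z) (fst (snd z)) (fst (snd (snd z))) (snd (snd (snd z))))"
    unfolding order_basis_def
    by (rule computable_conj computable_eq[OF inj_list_enc[OF inj_nat_enc]] computable_eq[OF inj(3)]
        computable_map computable_length computable_upt computable_Suc
        computable_Ball_set computable_power[OF R2] reduce mod_monic
        ring_computableD(4)[OF R3] E_rules projs)+
  note order_basis = computable_compose[OF this computable_Pair[OF _ computable_Pair[OF _ computable_Pair]],
      unfolded fst_conv snd_conv]
  have "computable (pair_enc nat_enc nat_enc) (list_enc (list_enc E)) (\<lambda>z. candidates (fst z) (snd z))"
    unfolding candidates_def
    by (rule computable_n_lists computable_map E_rules computable_Poly[OF inj(1)] computable_Suc projs)+
  note candidates = computable_binary[OF this]
  have "computable E nat_enc coeff_degrees"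
    unfolding coeff_degrees_def
    by (rule computable_foldr computable_plus_nat E_rules computable_degree[where ?E1.0 = e] projs)+
  note coeff_degrees = computable_compose[OF this]
  have "computable E nat_enc exponent_bound"
    unfolding exponent_bound_def
    by (rule computable_power_nat computable_times_nat coeff_degrees E_rules projs)+
  note exponent_bound = computable_compose[OF this]
  show ?thesis
    unfolding overorder_bases_def
    by (rule computable_map computable_filter order_basis candidates computable_Pair
        exponent_bound computable_power[OF R2] computable_times_nat E_rules
        computable_degree[where ?E1.0 = e] projs)+
qed

lemma overorder_bases_program:
  fixes e :: "'a::{field, finite} \<Rightarrow> nat"
  assumes "inj e"
  shows "\<exists>prog. \<forall>f p. rec_eval prog [poly_poly_code e f, poly_code e p]
    (bases_code e (overorder_bases f p))"
proof -
  have codes: "poly_code e = poly_enc e"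
    by (simp add: fun_eq_iff poly_code_def poly_enc_def list_enc_def)
  have codes2: "poly_poly_code e = poly_enc (poly_enc e)"
    by (simp add: fun_eq_iff poly_poly_code_def codes poly_enc_def list_enc_def)
  have codes3: "bases_code e = list_enc (list_enc (pair_enc (poly_enc (poly_enc e)) (poly_enc e)))"
    unfolding bases_code_def codes codes2 list_enc_def pair_enc_def case_prod_unfold by (rule refl)
  obtain q where "\<And>z. rec_eval q [pair_enc (poly_enc (poly_enc e)) (poly_enc e) z]
      (bases_code e (overorder_bases (fst z) (snd z)))"
    using computable_overorder_bases[OF assms]
    unfolding computable_def codes3 by (auto simp only:)
  from this[of "(f, p)" for f p]
  have "rec_eval q [prod_encode (poly_poly_code e f, poly_code e p)]
      (bases_code e (overorder_bases f p))" for f p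
    unfolding pair_enc_def codes codes2 fst_conv snd_conv .
  then have "rec_eval (Comp q [pair_prog]) [poly_poly_code e f, poly_code e p]
      (bases_code e (overorder_bases f p))" for f p
    by (rule rec_eval_Comp1[OF pair_prog])
  then show ?thesis by blast
qed

section \<open>Reduction modulo a monic polynomial\<close>

lemma mod_monic_0 [simp]: "mod_monic f 0 = 0"
  by (simp add: mod_monic_def)

lemma mod_monic_pCons:
  "mod_monic f (pCons c h) = pCons c (mod_monic f h)
     - smult (coeff (pCons c (mod_monic f h)) (degree f)) f"
  by (cases "c = 0 \<and> h = 0") (auto simp: mod_monic_def)

locale monic_poly =
  fixes f :: "'a::idom poly"
  assumes monic: "lead_coeff f = 1" and degree_pos: "degree f > 0"
begin

text \<open>A remainder of degree below n has degree at most n after multiplication by x, and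
  subtracting a multiple of the monic \<open>f\<close> removes the term of degree n without creating
  higher ones.\<close>

lemma coeff_mod_monic: "degree f \<le> i \<Longrightarrow> coeff (mod_monic f h) i = 0"
proof (induction h arbitrary: i)
  case (pCons c h)
  show ?case
  proof (cases "i = degree f")
    case True
    then show ?thesis using monic by (simp add: mod_monic_pCons)
  next
    case False
    with pCons.prems obtain k where "i = Suc k" "degree f \<le> k"
      by (cases i) auto
    then show ?thesis using pCons.IH by (simp add: mod_monic_pCons coeff_eq_0)
  qed
qed simp

lemma degree_mod_monic: "degree (mod_monic f h) < degree f"
  by (rule degree_lessI) (use degree_pos coeff_mod_monic in auto)

lemma mod_monic_dvd: "f dvd h - mod_monic f h"
proof (induction h)
  case (pCons c h)
  have "pCons c h - mod_monic f (pCons c h)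
      = [:0, 1:] * (h - mod_monic f h) + smult (coeff (pCons c (mod_monic f h)) (degree f)) f"
    by (simp add: mod_monic_pCons algebra_simps)
  also have "f dvd \<dots>"
    by (intro dvd_add dvd_mult dvd_smult pCons.IH dvd_refl)
  finally show ?case .
qed simp

lemma dvd_degree_less_eq_0: "f dvd g \<Longrightarrow> degree g < degree f \<Longrightarrow> g = 0"
  using dvd_imp_degree_le[of f g] by (cases "g = 0") auto

lemma mod_monic_unique:
  assumes "degree r < degree f" "f dvd h - r"
  shows "mod_monic f h = r"
proof -
  have "f dvd (h - r) - (h - mod_monic f h)"
    by (intro dvd_diff assms mod_monic_dvd)
  then have "f dvd mod_monic f h - r" by simp
  moreover have "degree (mod_monic f h - r) < degree f"
    by (intro degree_diff_less degree_mod_monic assms)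
  ultimately have "mod_monic f h - r = 0" by (rule dvd_degree_less_eq_0)
  then show ?thesis by simp
qed

lemma mod_monic_self: "degree r < degree f \<Longrightarrow> mod_monic f r = r"
  by (rule mod_monic_unique) auto

lemma mod_monic_eq_0_iff: "mod_monic f h = 0 \<longleftrightarrow> f dvd h"
  using mod_monic_dvd[of h] mod_monic_unique[of 0 h] degree_pos by auto

lemma mod_monic_add: "mod_monic f (g + h) = mod_monic f g + mod_monic f h"
proof (rule mod_monic_unique)
  have "f dvd (g - mod_monic f g) + (h - mod_monic f h)"
    by (intro dvd_add mod_monic_dvd)
  then show "f dvd g + h - (mod_monic f g + mod_monic f h)"
    by (simp add: algebra_simps)
qed (intro degree_add_less degree_mod_monic)

lemma mod_monic_smult: "mod_monic f (smult c h) = smult c (mod_monic f h)"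
proof (rule mod_monic_unique)
  have "f dvd smult c (h - mod_monic f h)"
    by (intro dvd_smult mod_monic_dvd)
  then show "f dvd smult c h - smult c (mod_monic f h)"
    by (simp add: smult_diff_right)
  show "degree (smult c (mod_monic f h)) < degree f"
    using degree_smult_le degree_mod_monic by (rule le_less_trans)
qed

end

section \<open>Triangular bases of modules of polynomials\<close>

text \<open>A module over the ring of coefficients, not an ideal of polynomials.\<close>

definition poly_submodule :: "'a::comm_ring_1 poly set \<Rightarrow> bool" where
  "poly_submodule G \<longleftrightarrow> 0 \<in> G \<and> (\<forall>g\<in>G. \<forall>h\<in>G. g + h \<in> G) \<and> (\<forall>c. \<forall>g\<in>G. smult c g \<in> G)"

text \<open>The recursion is that of \<open>ring.Span\<close>, so the two can be compared by
  induction on the list.\<close>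

fun poly_span :: "'a::comm_ring_1 poly list \<Rightarrow> 'a poly set" where
  "poly_span [] = {0}"
| "poly_span (g # gs) = {smult c g + h | c h. h \<in> poly_span gs}"

lemma poly_submoduleD:
  assumes "poly_submodule G"
  shows "0 \<in> G" "g \<in> G \<Longrightarrow> h \<in> G \<Longrightarrow> g + h \<in> G" "g \<in> G \<Longrightarrow> smult c g \<in> G"
    "g \<in> G \<Longrightarrow> h \<in> G \<Longrightarrow> g - h \<in> G"
proof -
  show "0 \<in> G" "g \<in> G \<Longrightarrow> h \<in> G \<Longrightarrow> g + h \<in> G" "g \<in> G \<Longrightarrow> smult c g \<in> G" for g h c
    using assms by (auto simp: poly_submodule_def)
  then have "g \<in> G \<Longrightarrow> h \<in> G \<Longrightarrow> g + smult (- 1) h \<in> G" for g h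
    by blast
  then show "g \<in> G \<Longrightarrow> h \<in> G \<Longrightarrow> g - h \<in> G" by simp
qed

lemma poly_span_ConsI: "h \<in> poly_span gs \<Longrightarrow> smult c g + h \<in> poly_span (g # gs)"
  by auto

lemma poly_submodule_poly_span: "poly_submodule (poly_span us)"
proof (induction us)
  case (Cons g gs)
  note IH = poly_submoduleD[OF Cons]
  show ?case unfolding poly_submodule_def
  proof (intro conjI ballI allI)
    show "0 \<in> poly_span (g # gs)"
      using poly_span_ConsI[OF IH(1), of 0 g] by simp
  next
    fix h h' assume "h \<in> poly_span (g # gs)" "h' \<in> poly_span (g # gs)"
    then obtain c k c' k' where "h = smult c g + k" "h' = smult c' g + k'"
      "k \<in> poly_span gs" "k' \<in> poly_span gs" by auto
    then show "h + h' \<in> poly_span (g # gs)"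
      using poly_span_ConsI[OF IH(2)[of k k'], of "c + c'" g] by (simp add: smult_add_left algebra_simps)
  next
    fix d h assume "h \<in> poly_span (g # gs)"
    then obtain c k where "h = smult c g + k" "k \<in> poly_span gs" by auto
    then show "smult d h \<in> poly_span (g # gs)"
      using poly_span_ConsI[OF IH(3)[of k d], of "d * c" g] by (simp add: smult_add_right)
  qed
qed (simp add: poly_submodule_def)

lemma poly_span_superset: "set us \<subseteq> poly_span us"
proof (induction us)
  case (Cons g gs)
  have "g \<in> poly_span (g # gs)"
    using poly_span_ConsI[OF poly_submoduleD(1)[OF poly_submodule_poly_span, of gs], of 1 g] by simp
  moreover have "poly_span gs \<subseteq> poly_span (g # gs)"
    using poly_span_ConsI[of _ gs 0 g] by auto
  ultimately show ?case using Cons by (auto simp del: poly_span.simps)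
qed simp

lemma poly_span_least: "poly_submodule G \<Longrightarrow> set us \<subseteq> G \<Longrightarrow> poly_span us \<subseteq> G"
  by (induction us) (auto intro: poly_submoduleD)

lemma poly_span_map_smult: "poly_span (map (smult a) us) = smult a ` poly_span us"
proof (induction us)
  case (Cons g gs)
  have "x \<in> poly_span (map (smult a) (g # gs)) \<longleftrightarrow>
      (\<exists>c h. h \<in> poly_span gs \<and> x = smult c (smult a g) + smult a h)" for x
    unfolding list.map poly_span.simps Cons by blast
  also have "\<dots> x \<longleftrightarrow> (\<exists>c h. h \<in> poly_span gs \<and> x = smult a (smult c g + h))" for x
    by (simp add: smult_add_right mult.commute)
  also have "\<dots> x \<longleftrightarrow> x \<in> smult a ` poly_span (g # gs)" for x
    unfolding poly_span.simps by blast
  finally show ?case by blast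
qed simp

text \<open>The last generator of a triangular list has the highest degree, so elimination takes
  lists apart at their end.\<close>

lemma poly_span_snoc: "poly_span (us @ [g]) = {h + smult c g | c h. h \<in> poly_span us}"
proof (induction us)
  case (Cons u us)
  show ?case
  proof (intro equalityI subsetI)
    fix x assume "x \<in> poly_span ((u # us) @ [g])"
    then obtain b c h where "x = smult b u + (h + smult c g)" "h \<in> poly_span us"
      using Cons by auto
    then show "x \<in> {h + smult c g | c h. h \<in> poly_span (u # us)}"
      using poly_span_ConsI[of h us b u] by (simp add: add.assoc[symmetric]) blast
  next
    fix x assume "x \<in> {h + smult c g | c h. h \<in> poly_span (u # us)}"
    then obtain b c h where "x = smult b u + (h + smult c g)" "h \<in> poly_span us"
      by (auto simp: add.assoc)
    then show "x \<in> poly_span ((u # us) @ [g])"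
      using Cons by auto
  qed
qed (auto intro!: exI[of _ 0])

text \<open>The entry at position i has degree i. Lengths of coefficient lists express this by one
  equation that also excludes zero entries.\<close>

definition triangular :: "'a::zero poly list \<Rightarrow> bool" where
  "triangular us \<longleftrightarrow> map (\<lambda>g. length (coeffs g)) us = map Suc [0..<length us]"

lemma triangular_snoc:
  "triangular (us @ [g]) \<longleftrightarrow> triangular us \<and> g \<noteq> 0 \<and> degree g = length us"
  by (cases "g = 0") (auto simp: triangular_def length_coeffs)

lemma triangular_poly_span_coeff:
  "triangular us \<Longrightarrow> h \<in> poly_span us \<Longrightarrow> length us \<le> i \<Longrightarrow> coeff h i = 0"
  by (induction us arbitrary: h rule: rev_induct)
    (auto simp: poly_span_snoc triangular_snoc coeff_eq_0)

lemma reduce_snoc: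
  "reduce (us @ [g]) h = reduce us (h - smult (coeff h (degree g) div lead_coeff g) g)"
  by (simp add: reduce_def)

lemma diff_reduce_in_span: "h - reduce us h \<in> poly_span us"
proof (induction us)
  case (Cons g us)
  have "h - reduce (g # us) h = smult (coeff (reduce us h) (degree g) div lead_coeff g) g + (h - reduce us h)"
    by (simp add: reduce_def)
  then show ?case using poly_span_ConsI[OF Cons] by metis
qed (simp add: reduce_def)

text \<open>Let h = k + c g with k in the span of the shorter list. Then k has no term in the degree
  of g, so dividing by the leading coefficient of g recovers c exactly and leaves k.\<close>

lemma reduce_eq_0_iff:
  assumes "triangular us"
  shows "reduce us h = 0 \<longleftrightarrow> h \<in> poly_span us"
proof
  show "h \<in> poly_span us" if "reduce us h = 0"
    using diff_reduce_in_span[of h us] that by simp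
  show "reduce us h = 0" if "h \<in> poly_span us"
    using assms that
  proof (induction us arbitrary: h rule: rev_induct)
    case (snoc g us)
    from snoc.prems have tri: "triangular us" "g \<noteq> 0" "degree g = length us"
      by (auto simp: triangular_snoc)
    from snoc.prems obtain c k where h: "h = k + smult c g" "k \<in> poly_span us"
      by (auto simp: poly_span_snoc)
    have "coeff k (degree g) = 0"
      using triangular_poly_span_coeff[OF tri(1) h(2)] tri(3) by simp
    then have "h - smult (coeff h (degree g) div lead_coeff g) g = k"
      using tri(2) h(1) by simp
    then show ?case using snoc.IH[OF tri(1) h(2)] by (simp add: reduce_snoc)
  qed (simp add: reduce_def)
qed

lemma triangular_map_smult:
  fixes a :: "'a::idom"
  assumes "a \<noteq> 0"
  shows "triangular (map (smult a) us) \<longleftrightarrow> triangular us"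
proof -
  have "length (coeffs (smult a g)) = length (coeffs g)" for g
    using assms by (cases "g = 0") (auto simp: length_coeffs)
  then show ?thesis by (simp add: triangular_def comp_def)
qed

section \<open>Irreducible monic polynomials over $\mathbb{F}_q[T]$\<close>

lemma exists_prime_elem_dvd:
  fixes c :: "'a::field poly"
  assumes "degree c > 0"
  shows "\<exists>p. prime_elem p \<and> p dvd c"
  using assms
proof (induction "degree c" arbitrary: c rule: less_induct)
  case less
  show ?case
  proof (cases "Factorial_Ring.irreducible c")
    case True
    then show ?thesis
      by (intro exI[of _ c] conjI field_poly_irreducible_imp_prime dvd_refl)
  next
    case False
    have "c \<noteq> 0" using less.prems by auto
    have "\<not> is_unit c" using less.prems is_unit_iff_degree[OF \<open>c \<noteq> 0\<close>] by simp
    with False \<open>c \<noteq> 0\<close> obtain a b where ab: "c = a * b" "\<not> is_unit a" "\<not> is_unit b"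
      by (auto simp: Factorial_Ring.irreducible_def)
    have "a \<noteq> 0" "b \<noteq> 0" using ab(1) \<open>c \<noteq> 0\<close> by auto
    then have "degree a > 0" "degree b > 0" "degree c = degree a + degree b"
      using ab is_unit_iff_degree by (auto simp: degree_mult_eq)
    then have "\<exists>p. prime_elem p \<and> p dvd a" using less.hyps[of a] by simp
    then show ?thesis unfolding ab(1) using dvd_mult2 by blast
  qed
qed

text \<open>Gauss's lemma with denominators cleared: \<open>f\<close> admits no proper factorisation
  over the fraction field either. A prime factor of \<open>c\<close> remains prime in the larger
  polynomial ring, so it divides \<open>w\<close> or \<open>q\<close> and can be cancelled; when
  \<open>c\<close> is a unit, the irreducibility of \<open>f\<close> applies directly.\<close>

lemma irreducible_smult_eq_mult:
  fixes f :: "'a::field poly poly"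
  assumes "Factorial_Ring.irreducible f" "c \<noteq> 0" "smult c f = w * q"
  shows "degree w = 0 \<or> degree q = 0"
  using assms(2,3)
proof (induction "degree c" arbitrary: c w q rule: less_induct)
  case less
  show ?case
  proof (cases "degree c = 0")
    case True
    then have "is_unit c" using less.prems(1) by (simp add: is_unit_iff_degree)
    then obtain d where d: "d * c = 1" by (auto simp: dvd_def mult.commute)
    have "f = smult d (smult c f)" by (simp add: d)
    also have "\<dots> = smult d w * q" by (simp only: less.prems(2) mult_smult_left)
    finally have "f = smult d w * q" .
    then have unit: "is_unit (smult d w) \<or> is_unit q"
      using assms(1) by (auto simp: Factorial_Ring.irreducible_def)
    have unit_deg: "degree g = 0" if "is_unit g" for g :: "'a poly poly"
    proof -
      from that obtain k where "1 = g * k" by (rule dvdE)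
      then have k: "g * k = 1" by (rule sym)
      then have "g \<noteq> 0" "k \<noteq> 0" by auto
      then show ?thesis using arg_cong[OF k, of degree] by (simp add: degree_mult_eq)
    qed
    from unit have "degree (smult d w) = 0 \<or> degree q = 0"
      by (rule disj_forward) (rule unit_deg, assumption)+
    moreover have "d \<noteq> 0" using d by auto
    ultimately show ?thesis by simp
  next
    case False
    then obtain p where p: "prime_elem p" "p dvd c"
      using exists_prime_elem_dvd[of c] by auto
    from p(2) obtain c' where c': "c = p * c'" by (rule dvdE)
    have "c' \<noteq> 0" "p \<noteq> 0" using c' less.prems by auto
    have "degree p > 0"
      using prime_elem_not_unit[OF p(1)] is_unit_iff_degree[OF \<open>p \<noteq> 0\<close>] by simp
    then have lt: "degree c' < degree c"
      using c' \<open>c' \<noteq> 0\<close> \<open>p \<noteq> 0\<close> by (simp add: degree_mult_eq)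
    have eq: "[:p:] * smult c' f = w * q"
      using less.prems(2) c' by (simp add: mult.commute)
    then have "[:p:] dvd w * q" by (rule dvdI[OF sym])
    then have "[:p:] dvd w \<or> [:p:] dvd q"
      by (rule prime_elem_dvd_multD[OF lift_prime_elem_poly[OF p(1)]])
    then show ?thesis
    proof
      assume "[:p:] dvd w"
      then obtain w' where w': "w = [:p:] * w'" by (rule dvdE)
      have "[:p:] * smult c' f = [:p:] * (w' * q)"
        using eq w' by (simp only: mult.assoc)
      then have "smult c' f = w' * q"
        using \<open>p \<noteq> 0\<close> by (subst (asm) mult_cancel_left) auto
      from less.hyps[OF lt \<open>c' \<noteq> 0\<close> this] show ?thesis
        using w' by (auto simp: \<open>p \<noteq> 0\<close>)
    next
      assume "[:p:] dvd q"
      then obtain q' where q': "q = [:p:] * q'" by (rule dvdE)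
      have "[:p:] * smult c' f = [:p:] * (w * q')"
        using eq q' by (simp only: mult.left_commute)
      then have "smult c' f = w * q'"
        using \<open>p \<noteq> 0\<close> by (subst (asm) mult_cancel_left) auto
      from less.hyps[OF lt \<open>c' \<noteq> 0\<close> this] show ?thesis
        using q' by (auto simp: \<open>p \<noteq> 0\<close>)
    qed
  qed
qed

locale order_setup =
  fixes f :: "'a::{field, finite} poly poly" and p :: "'a poly"
  assumes lead_coeff_f: "lead_coeff f = 1" and irreducible_f: "Factorial_Ring.irreducible f"
    and prime_p: "prime_elem p"
begin

sublocale monic_poly f
proof
  show "degree f > 0"
  proof (rule ccontr)
    assume "\<not> degree f > 0"
    then have "f = 1"
      using lead_coeff_f by (metis degree_eq_zeroE gr0I lead_coeff_pCons(2) one_pCons)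
    then show False using irreducible_f by simp
  qed
qed (rule lead_coeff_f)

lemma p_nonzero: "p \<noteq> 0" "p ^ N \<noteq> 0"
  using prime_p by auto

lemma degree_p_power: "degree (p ^ N) = N * degree p"
  using degree_power_eq[OF p_nonzero(1)] by simp

text \<open>A nonzero \<open>w\<close> of least degree in the ideal of \<open>s\<close> and
  \<open>f\<close> divides a multiple c f, by pseudo-division. If \<open>w\<close> were not
  constant, Gauss's lemma would give it the degree of \<open>f\<close>, which exceeds that of
  \<open>s\<close>. This makes nonzero residues invertible up to a denominator in A.\<close>

lemma bezout_constant:
  assumes "s \<noteq> 0" "degree s < degree f"
  shows "\<exists>u v d. d \<noteq> 0 \<and> u * s + v * f = [:d:]"
proof -
  define W where "W = {w. w \<noteq> 0 \<and> (\<exists>u v. w = u * s + v * f)}"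
  have "s = 1 * s + 0 * f" by simp
  with assms(1) have "s \<in> W" unfolding W_def by blast
  obtain w where w: "w \<in> W" and min: "\<And>x. x \<in> W \<Longrightarrow> degree w \<le> degree x"
    using ex_has_least_nat[of "\<lambda>w. w \<in> W" s degree] \<open>s \<in> W\<close> by auto
  then have "w \<noteq> 0" unfolding W_def by simp
  from w obtain u v where uv: "w = u * s + v * f" unfolding W_def by auto
  obtain q r where qr: "pseudo_divmod f w = (q, r)" by fastforce
  define c where "c = lead_coeff w ^ (Suc (degree f) - degree w)"
  have c: "c \<noteq> 0" unfolding c_def using \<open>w \<noteq> 0\<close> by simp
  from pseudo_divmod[OF \<open>w \<noteq> 0\<close> qr]
  have eq: "smult c f = w * q + r" and r: "r = 0 \<or> degree r < degree w"
    by (simp_all add: c_def)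
  have "r = (- q * u) * s + ([:c:] - q * v) * f"
    using eq uv by (simp add: algebra_simps)
  then have "r \<notin> W \<Longrightarrow> r = 0" unfolding W_def by blast
  with r min[of r] have "r = 0" by fastforce
  with eq have eq: "smult c f = w * q" by simp
  have "degree w = 0"
  proof (rule ccontr)
    assume "degree w \<noteq> 0"
    with irreducible_smult_eq_mult[OF irreducible_f c eq] have "degree q = 0" by simp
    moreover have "q \<noteq> 0" using eq c lead_coeff_f by auto
    ultimately have "degree f = degree w"
      using arg_cong[OF eq, of degree] c \<open>w \<noteq> 0\<close> by (simp add: degree_mult_eq)
    then show False using min[OF \<open>s \<in> W\<close>] assms(2) by simp
  qed
  then obtain d where "w = [:d:]" by (metis degree_eq_zeroE)
  moreover from this \<open>w \<noteq> 0\<close> have "d \<noteq> 0" by auto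
  ultimately show ?thesis using uv by (intro exI[of _ u] exI[of _ v] exI[of _ d]) simp
qed

text \<open>Since \<open>f\<close> is monic, A[x]/f is free over A and hence has no torsion.\<close>

lemma dvd_smult_iff: "d \<noteq> 0 \<Longrightarrow> f dvd smult d h \<longleftrightarrow> f dvd h"
  unfolding mod_monic_eq_0_iff[symmetric] mod_monic_smult by simp

text \<open>If \<open>f\<close> does not divide \<open>g\<close>, then u g = d modulo
  \<open>f\<close> for some u and some nonzero constant d. Multiplying by \<open>h\<close> shows
  that \<open>f\<close> divides d h.\<close>

lemma f_dvd_mult:
  assumes "f dvd g * h"
  shows "f dvd g \<or> f dvd h"
proof (cases "mod_monic f g = 0")
  case False
  from bezout_constant[OF this degree_mod_monic] obtain u v d
    where d: "d \<noteq> 0" "u * mod_monic f g + v * f = [:d:]" by blast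
  have "smult d h = (u * mod_monic f g + v * f) * h"
    by (simp add: d(2))
  also have "\<dots> = u * (g * h) - u * ((g - mod_monic f g) * h) + v * f * h"
    by (simp add: algebra_simps)
  also have "f dvd \<dots>"
    by (intro dvd_add dvd_diff dvd_mult[OF assms] dvd_mult[OF dvd_mult2[OF mod_monic_dvd]])
      simp
  finally show ?thesis using d(1) dvd_smult_iff by blast
qed (simp add: mod_monic_eq_0_iff)


text \<open>The set \<open>G\<close> of numerators of an \<open>A\<close>-order between \<open>R\<close> and \<open>p\<^sup>-\<^sup>N R\<close>.\<close>

definition lattice_order :: "nat \<Rightarrow> 'a poly poly set \<Rightarrow> bool" where
  "lattice_order N G \<longleftrightarrow> poly_submodule G \<and> (\<forall>g\<in>G. degree g < degree f) \<and>
     (\<forall>j<degree f. monom (p ^ N) j \<in> G) \<and>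
     (\<forall>g\<in>G. \<forall>h\<in>G. mod_monic f (g * h) \<in> smult (p ^ N) ` G)"

lemma smult_image_submodule: "poly_submodule G \<Longrightarrow> poly_submodule (smult a ` G)" for a :: "'a poly"
  unfolding poly_submodule_def
  by (auto simp: image_iff smult_add_right[symmetric]) (metis mult.commute smult_smult smult_0_right)+

lemma order_basis_iff:
  "order_basis f p N us \<longleftrightarrow> triangular us \<and> length us = degree f \<and> lattice_order N (poly_span us)"
proof (cases "triangular us \<and> length us = degree f")
  case True
  note tri = conjunct1[OF True] and len = conjunct2[OF True]
  let ?H = "smult (p ^ N) ` poly_span us"
  have sub: "poly_submodule (poly_span us)" by (rule poly_submodule_poly_span)
  have H: "poly_submodule ?H" by (rule smult_image_submodule[OF sub])
  have deg: "degree g < degree f" if "g \<in> poly_span us" for g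
    using triangular_poly_span_coeff[OF tri that] len degree_pos by (intro degree_lessI) auto
  have 1: "reduce us h = 0 \<longleftrightarrow> h \<in> poly_span us" for h
    by (rule reduce_eq_0_iff[OF tri])
  have tri': "triangular (map (smult (p ^ N)) us)"
    using tri triangular_map_smult[OF p_nonzero(2)] by blast
  have 2: "reduce (map (smult (p ^ N)) us) h = 0 \<longleftrightarrow> h \<in> ?H" for h
    using reduce_eq_0_iff[OF tri'] by (simp add: poly_span_map_smult)
  \<comment> \<open>For fixed \<open>h\<close> the admissible \<open>g\<close> form a submodule, so
    the condition passes from generators to their span. By commutativity the same argument then
    treats the other factor.\<close>
  have sub1: "poly_submodule {g. mod_monic f (g * h) \<in> ?H}" for h
    unfolding poly_submodule_def
    using poly_submoduleD[OF H] by (auto simp: distrib_right mod_monic_add mod_monic_smult)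
  have gens: "(\<forall>g\<in>set us. \<forall>h\<in>set us. mod_monic f (g * h) \<in> ?H) \<longleftrightarrow>
      (\<forall>g\<in>poly_span us. \<forall>h\<in>poly_span us. mod_monic f (g * h) \<in> ?H)" (is "?L \<longleftrightarrow> ?R")
  proof
    assume ?L
    have "mod_monic f (g * h) \<in> ?H" if "g \<in> poly_span us" "h \<in> set us" for g h
      using poly_span_least[OF sub1[of h], of us] \<open>?L\<close> that by auto
    note 3 = this
    have "mod_monic f (g * h) \<in> ?H" if "g \<in> poly_span us" "h \<in> poly_span us" for g h
    proof -
      have "set us \<subseteq> {k. mod_monic f (k * g) \<in> ?H}"
        using 3[OF that(1)] by (auto simp only: mult.commute[of _ g])
      then show ?thesis
        using poly_span_least[OF sub1[of g]] that(2) by (auto simp only: mult.commute[of g])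
    qed
    then show ?R by blast
  qed (use poly_span_superset[of us] in blast)
  have "map (\<lambda>g. length (coeffs g)) us = map Suc [0..<degree f]"
    using tri len by (simp add: triangular_def)
  then show ?thesis
    unfolding order_basis_def lattice_order_def
    using True sub deg 1 2 gens by auto
next
  case False
  have "triangular us \<and> length us = degree f"
    if eq: "map (\<lambda>g. length (coeffs g)) us = map Suc [0..<degree f]"
  proof -
    have "length us = degree f" using arg_cong[OF eq, of length] by simp
    then show ?thesis using eq by (simp add: triangular_def)
  qed
  then show ?thesis using False unfolding order_basis_def by blast
qed

lemma lattice_orderD:
  assumes "lattice_order N G"
  shows "poly_submodule G" "g \<in> G \<Longrightarrow> degree g < degree f" "j < degree f \<Longrightarrow> monom (p ^ N) j \<in> G"
    "g \<in> G \<Longrightarrow> h \<in> G \<Longrightarrow> \<exists>k\<in>G. mod_monic f (g * h) = smult (p ^ N) k"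
  using assms by (auto simp: lattice_order_def image_iff)

section \<open>Triangular bases with coefficients of bounded degree\<close>

lemma poly_submodule_sum: "poly_submodule G \<Longrightarrow> (\<And>x. x \<in> Y \<Longrightarrow> g x \<in> G) \<Longrightarrow> sum g Y \<in> G"
  by (induction Y rule: infinite_finite_induct) (auto intro: poly_submoduleD)

lemma poly_eq_sum_monom: "degree g < n \<Longrightarrow> g = (\<Sum>j<n. monom (coeff g j) j)"
  by (rule poly_eqI) (auto simp: coeff_sum if_distrib coeff_eq_0 cong: if_cong)

lemma smult_sum_right: "smult a (sum g Y) = (\<Sum>y\<in>Y. smult a (g y))"
  by (induction Y rule: infinite_finite_induct) (auto simp: smult_add_right)

text \<open>These are the elements of R, written with denominator p^N.\<close>

lemma smult_p_power_mem:
  assumes "lattice_order N G" "degree g < degree f"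
  shows "smult (p ^ N) g \<in> G"
proof -
  have "smult (p ^ N) g = (\<Sum>j<degree f. smult (coeff g j) (monom (p ^ N) j))"
    by (subst poly_eq_sum_monom[OF assms(2)])
      (simp add: smult_sum_right smult_monom mult.commute)
  also have "\<dots> \<in> G"
    using lattice_orderD(1,3)[OF assms(1)] by (intro poly_submodule_sum poly_submoduleD) auto
  finally show ?thesis .
qed

text \<open>Among the elements of degree i, one is chosen whose leading coefficient has least
  degree; since p^N x^i competes, that degree is at most N deg p. The lower coefficients are
  replaced by their remainders modulo p^N, which stays in \<open>G\<close> because p^N R
  does.\<close>

lemma exists_reduced_generator:
  assumes G: "lattice_order N G" and i: "i < degree f"
  shows "\<exists>g\<in>G. g \<noteq> 0 \<and> degree g = i \<and> (\<forall>j. degree (coeff g j) \<le> N * degree p) \<and>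
    (\<forall>h\<in>G. h \<noteq> 0 \<and> degree h = i \<longrightarrow> degree (lead_coeff g) \<le> degree (lead_coeff h))"
proof -
  define Y where "Y = {g \<in> G. g \<noteq> 0 \<and> degree g = i}"
  have m: "monom (p ^ N) i \<in> Y"
    unfolding Y_def using lattice_orderD(3)[OF G i] p_nonzero by (simp add: degree_monom_eq)
  obtain g where g: "g \<in> Y" "\<And>h. h \<in> Y \<Longrightarrow> degree (lead_coeff g) \<le> degree (lead_coeff h)"
    using ex_has_least_nat[of "\<lambda>g. g \<in> Y" _ "\<lambda>g. degree (lead_coeff g)"] m by blast
  define r where "r = (\<Sum>j<i. monom (coeff g j div p ^ N) j)"
  define h where "h = g - smult (p ^ N) r"
  have "degree r < degree f"
    unfolding r_def using i degree_pos
    by (intro degree_sum_less) (auto intro: le_less_trans[OF degree_monom_le])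
  then have h_G: "h \<in> G"
    unfolding h_def using g(1) poly_submoduleD(4)[OF lattice_orderD(1)[OF G]] smult_p_power_mem[OF G]
    by (auto simp: Y_def)
  have coeff_r: "coeff r j = (if j < i then coeff g j div p ^ N else 0)" for j
    by (simp add: r_def coeff_sum if_distrib cong: if_cong)
  have coeff_h: "coeff h j = (if j < i then coeff g j mod p ^ N else coeff g j)" for j
    by (simp add: h_def coeff_r minus_mult_div_eq_mod)
  have deg_g: "degree g = i" "g \<noteq> 0" using g(1) by (auto simp: Y_def)
  have h_i: "coeff h i = lead_coeff g" using coeff_h deg_g by simp
  then have "h \<noteq> 0" using deg_g by auto
  moreover have "degree h = i"
  proof (rule antisym)
    show "degree h \<le> i"
      by (rule degree_le) (use coeff_h deg_g in \<open>auto simp: coeff_eq_0\<close>)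
    show "i \<le> degree h"
      by (rule le_degree) (use h_i deg_g in auto)
  qed
  moreover have "degree (coeff h j) \<le> N * degree p" for j
  proof (cases "j < i")
    case True
    then show ?thesis
      using coeff_h degree_mod_less[OF p_nonzero(2), of "coeff g j" N] degree_p_power[of N]
      by (cases "coeff g j mod p ^ N = 0") auto
  next
    case False
    then show ?thesis
      using g(2)[OF m] p_nonzero deg_g coeff_h degree_p_power[of N]
      by (cases "j = i") (auto simp: degree_monom_eq coeff_eq_0)
  qed
  moreover have "degree (lead_coeff h) \<le> degree (lead_coeff k)" if "k \<in> Y" for k
    using g(2)[OF that] h_i \<open>degree h = i\<close> by simp
  ultimately show ?thesis
    using h_G unfolding Y_def by blast
qed

text \<open>The leading coefficients of the elements of degree i, together with 0, form an ideal of
  A, generated by any nonzero member of least degree. Subtracting a multiple of the chosen element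
  removes the top coefficient, and elimination proceeds downwards.\<close>

lemma exists_triangular_basis:
  assumes G: "lattice_order N G"
  shows "\<exists>us. triangular us \<and> length us = degree f \<and> poly_span us = G \<and>
    (\<forall>g\<in>set us. degree g < degree f \<and> (\<forall>j. degree (coeff g j) \<le> N * degree p))"
proof -
  define Q where "Q i g \<longleftrightarrow> g \<in> G \<and> g \<noteq> 0 \<and> degree g = i \<and> (\<forall>j. degree (coeff g j) \<le> N * degree p) \<and>
    (\<forall>h\<in>G. h \<noteq> 0 \<and> degree h = i \<longrightarrow> degree (lead_coeff g) \<le> degree (lead_coeff h))" for i g
  have "\<exists>g. Q i g" if "i < degree f" for i
    using exists_reduced_generator[OF G that] unfolding Q_def by blast
  then obtain u where "\<And>i. i < degree f \<Longrightarrow> Q i (u i)" by metis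
  then have u:
    "\<And>i. i < degree f \<Longrightarrow> u i \<in> G" "\<And>i. i < degree f \<Longrightarrow> u i \<noteq> 0"
    "\<And>i. i < degree f \<Longrightarrow> degree (u i) = i"
    "\<And>i j. i < degree f \<Longrightarrow> degree (coeff (u i) j) \<le> N * degree p"
    "\<And>i h. i < degree f \<Longrightarrow> h \<in> G \<Longrightarrow> h \<noteq> 0 \<Longrightarrow> degree h = i
      \<Longrightarrow> degree (lead_coeff (u i)) \<le> degree (lead_coeff h)"
    unfolding Q_def by blast+
  define us where "us = map u [0..<degree f]"
  have "h \<in> poly_span (map u [0..<m])" if "m \<le> degree f" "h \<in> G" "\<forall>i\<ge>m. coeff h i = 0" for m h
    using that
  proof (induction m arbitrary: h)
    case 0
    then have "h = 0" by (intro poly_eqI) auto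
    then show ?case by simp
  next
    case (Suc m)
    define k where "k = coeff h m div lead_coeff (u m)"
    define h' where "h' = h - smult k (u m)"
    have m: "m < degree f" using Suc.prems by simp
    have h'_G: "h' \<in> G"
      unfolding h'_def using Suc.prems u(1)[OF m] lattice_orderD(1)[OF G] by (auto intro: poly_submoduleD)
    have coeff_m: "coeff h' m = coeff h m mod lead_coeff (u m)"
      using u(3)[OF m] by (simp add: h'_def k_def minus_div_mult_eq_mod)
    have above: "coeff h' i = 0" if "i > m" for i
      using Suc.prems(3) that u(3)[OF m] by (simp add: h'_def coeff_eq_0)
    \<comment> \<open>Otherwise this remainder would be the leading coefficient of an element of
      degree m, and of smaller degree than the minimal one.\<close>
    have "coeff h' m = 0"
    proof (rule ccontr)
      assume ne: "coeff h' m \<noteq> 0"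
      then have "h' \<noteq> 0" by auto
      have deg: "degree h' = m"
        using above ne by (intro antisym degree_le le_degree) auto
      have "degree (lead_coeff (u m)) \<le> degree (coeff h' m)"
        using u(5)[OF m h'_G \<open>h' \<noteq> 0\<close> deg] deg by simp
      moreover have "lead_coeff (u m) \<noteq> 0" using u(2)[OF m] by simp
      ultimately show False
        using degree_mod_less[of "lead_coeff (u m)" "coeff h m"] ne coeff_m by simp
    qed
    with above have "\<forall>i\<ge>m. coeff h' i = 0" by (metis le_neq_implies_less)
    with Suc.IH h'_G m have "h' \<in> poly_span (map u [0..<m])" by simp
    moreover have "h = h' + smult k (u m)" by (simp add: h'_def)
    ultimately show ?case by (auto simp: poly_span_snoc)
  qed
  note span = this
  have "G \<subseteq> poly_span us"
  proof
    fix h assume "h \<in> G"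
    moreover from this have "\<forall>i\<ge>degree f. coeff h i = 0"
      using lattice_orderD(2)[OF G] coeff_eq_0 by (meson less_le_trans)
    ultimately show "h \<in> poly_span us" unfolding us_def by (intro span) auto
  qed
  moreover have "poly_span us \<subseteq> G"
    using lattice_orderD(1)[OF G] u(1) by (intro poly_span_least) (auto simp: us_def)
  moreover have "triangular us"
    unfolding triangular_def us_def using u(2,3) by (auto simp: length_coeffs)
  ultimately show ?thesis
    using u(3,4) by (intro exI[of _ us]) (auto simp: us_def)
qed

lemma set_field_elements: "set (field_elements :: 'b::finite list) = UNIV"
  unfolding field_elements_def by (rule someI_ex) (rule finite_list[OF finite])

lemma Poly_map_coeff: "(\<And>i. n \<le> i \<Longrightarrow> coeff g i = 0) \<Longrightarrow> Poly (map (coeff g) [0..<n]) = g"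
  by (rule poly_eqI) (simp add: nth_default_def)

lemma candidatesI:
  fixes us :: "'b::{field, finite} poly poly list"
  assumes "length us = n" "\<And>g. g \<in> set us \<Longrightarrow> degree g < n \<and> (\<forall>j. degree (coeff g j) \<le> D)"
  shows "us \<in> set (candidates n D)"
proof -
  let ?polys = "map Poly (List.n_lists (Suc D) (field_elements :: 'b list))"
  have polys: "c \<in> set ?polys" if "degree c \<le> D" for c
  proof -
    have "c = Poly (map (coeff c) [0..<Suc D])"
      using that by (intro Poly_map_coeff[symmetric]) (auto simp: coeff_eq_0)
    moreover have "map (coeff c) [0..<Suc D] \<in> set (List.n_lists (Suc D) (field_elements :: 'b list))"
      by (simp add: set_n_lists set_field_elements del: upt_Suc List.n_lists.simps)
    ultimately show ?thesis by (metis image_eqI list.set_map)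
  qed
  have "g \<in> set (map Poly (List.n_lists n ?polys))" if "g \<in> set us" for g
  proof -
    have "g = Poly (map (coeff g) [0..<n])"
      using assms(2)[OF that] by (intro Poly_map_coeff[symmetric]) (auto simp: coeff_eq_0)
    moreover have "map (coeff g) [0..<n] \<in> set (List.n_lists n ?polys)"
      using polys assms(2)[OF that] by (auto simp: set_n_lists)
    ultimately show ?thesis by (metis image_eqI list.set_map)
  qed
  then show ?thesis
    unfolding candidates_def using assms(1) by (auto simp: set_n_lists)
qed

subsection \<open>Bounding the orders containing $A[x]/f$\<close>

text \<open>Giving \<open>x\<close> the weight \<open>w\<close>, where \<open>w\<close> bounds the degrees of the coefficients of \<open>f\<close>, makes
  reduction modulo \<open>f\<close> compatible with the weighted degree.\<close>

definition weight_less :: "nat \<Rightarrow> 'a poly poly \<Rightarrow> bool" where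
  "weight_less k g \<longleftrightarrow> (\<forall>j. coeff g j \<noteq> 0 \<longrightarrow> degree (coeff g j) + coeff_degrees f * j < k)"

lemma degree_coeff_le: "degree (coeff g j) \<le> coeff_degrees g"
proof -
  have "degree c \<le> foldr (\<lambda>c a. degree c + a) cs 0" if "c \<in> set cs" for c cs
    using that by (induction cs) auto
  moreover have "coeff g j \<in> set (coeffs g) \<or> coeff g j = 0"
    using range_coeff[of g] by blast
  ultimately show ?thesis unfolding coeff_degrees_def by auto
qed

text \<open>With a strict inequality the bound 0 leaves only the zero polynomial; this is where the
  later descent must end.\<close>

lemma weight_less_0: "weight_less 0 g \<Longrightarrow> g = 0"
  by (rule poly_eqI) (auto simp: weight_less_def)

text \<open>Because \<open>degree 0 = 0\<close>, the bound is assumed only for nonzero summands and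
  claimed only for a nonzero sum.\<close>

lemma degree_less_sum:
  fixes h :: "'c \<Rightarrow> 'a poly"
  assumes "finite Y" "\<And>x. x \<in> Y \<Longrightarrow> h x \<noteq> 0 \<Longrightarrow> degree (h x) + c < k" "sum h Y \<noteq> 0"
  shows "degree (sum h Y) + c < k"
  using assms
proof (induction Y rule: finite_induct)
  case (insert x Y)
  show ?case
  proof (cases "h x = 0 \<or> sum h Y = 0")
    case False
    then have "max (degree (h x)) (degree (sum h Y)) + c < k"
      using insert by (auto simp: max_def)
    then show ?thesis
      using insert degree_add_le_max[of "h x" "sum h Y"] by simp
  qed (use insert in auto)
qed simp

lemma weight_less_mult:
  assumes "weight_less (Suc a) g" "weight_less (Suc b) h"
  shows "weight_less (Suc (a + b)) (g * h)"
  unfolding weight_less_def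
proof (intro allI impI)
  fix j assume ne: "coeff (g * h) j \<noteq> 0"
  show "degree (coeff (g * h) j) + coeff_degrees f * j < Suc (a + b)"
    unfolding coeff_mult
  proof (rule degree_less_sum)
    fix i assume i: "i \<in> {..j}" "coeff g i * coeff h (j - i) \<noteq> 0"
    then have "degree (coeff g i) + coeff_degrees f * i < Suc a"
      "degree (coeff h (j - i)) + coeff_degrees f * (j - i) < Suc b"
      using assms by (auto simp: weight_less_def)
    moreover have "coeff_degrees f * i + coeff_degrees f * (j - i) = coeff_degrees f * j"
      using i by (simp flip: add_mult_distrib2)
    ultimately show "degree (coeff g i * coeff h (j - i)) + coeff_degrees f * j < Suc (a + b)"
      using degree_mult_le[of "coeff g i" "coeff h (j - i)"] by linarith
  qed (use ne in \<open>simp_all add: coeff_mult\<close>)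
qed

lemma weight_less_diff:
  assumes "weight_less k g" "weight_less k h"
  shows "weight_less k (g - h)"
  unfolding weight_less_def
proof (intro allI impI)
  fix j assume ne: "coeff (g - h) j \<noteq> 0"
  show "degree (coeff (g - h) j) + coeff_degrees f * j < k"
  proof (cases "coeff g j = 0 \<or> coeff h j = 0")
    case True
    then show ?thesis using assms ne by (auto simp: weight_less_def)
  next
    case False
    then have "max (degree (coeff g j)) (degree (coeff h j)) + coeff_degrees f * j < k"
      using assms by (auto simp: weight_less_def max_def)
    then show ?thesis using degree_diff_le_max[of "coeff g j" "coeff h j"] by simp
  qed
qed

text \<open>Let w be the weight of x. A term of \<open>f\<close> of degree j < n has weight at most
  w + w j, hence at most w n, the weight of its leading term. So replacing x^n by lower terms does
  not raise weights.\<close>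

lemma weight_less_smult_f:
  assumes "degree c + coeff_degrees f * degree f < k"
  shows "weight_less k (smult c f)"
  unfolding weight_less_def
proof (intro allI impI)
  fix j assume ne: "coeff (smult c f) j \<noteq> 0"
  then have "j \<le> degree f" by (auto intro: le_degree)
  have "degree (coeff f j) + coeff_degrees f * j \<le> coeff_degrees f * degree f"
  proof (cases "j = degree f")
    case False
    then have "coeff_degrees f * Suc j \<le> coeff_degrees f * degree f"
      using \<open>j \<le> degree f\<close> by (intro mult_le_mono2) simp
    then show ?thesis using degree_coeff_le[of f j] by simp
  qed (simp add: lead_coeff_f)
  then show "degree (coeff (smult c f) j) + coeff_degrees f * j < k"
    using assms degree_mult_le[of c "coeff f j"] by simp
qed

lemma weight_less_mod_monic:
  "weight_less k h \<Longrightarrow> weight_less k (mod_monic f h)"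
proof (induction h arbitrary: k)
  case (pCons c h)
  let ?s = "pCons c (mod_monic f h)"
  \<comment> \<open>In \<open>pCons c h\<close> the polynomial \<open>h\<close> is shifted by one
    power of x, which costs one weight of x.\<close>
  have "weight_less (k - coeff_degrees f) h"
    unfolding weight_less_def
  proof (intro allI impI)
    fix j assume "coeff h j \<noteq> 0"
    then have "degree (coeff h j) + coeff_degrees f * Suc j < k"
      using pCons.prems unfolding weight_less_def by (metis coeff_pCons_Suc)
    then show "degree (coeff h j) + coeff_degrees f * j < k - coeff_degrees f" by simp
  qed
  from pCons.IH[OF this] have s: "weight_less k ?s"
    using pCons.prems by (auto simp: weight_less_def coeff_pCons split: nat.splits)
  show ?case
  proof (cases "coeff ?s (degree f) = 0")
    case True
    then show ?thesis using s by (simp add: mod_monic_pCons)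
  next
    case False
    with s have "degree (coeff ?s (degree f)) + coeff_degrees f * degree f < k"
      by (simp add: weight_less_def)
    then show ?thesis
      using weight_less_diff[OF s weight_less_smult_f] by (simp add: mod_monic_pCons)
  qed
qed simp

text \<open>Repeated multiplication by g / p^N stays inside the order and, as \<open>f\<close> is
  prime, never turns a nonzero element into zero. But each time the weight bound of the numerator
  drops by 1, which cannot go on.\<close>

lemma lattice_order_weight_eq_0:
  assumes G: "lattice_order N G" and g: "g \<in> G" "weight_less (N * degree p) g"
  shows "g = 0"
proof (rule ccontr)
  assume "g \<noteq> 0"
  let ?m = "N * degree p"
  have "\<exists>h\<in>G. h \<noteq> 0 \<and> weight_less (?m - k) h" for k
  proof (induction k)
    case 0
    show ?case using g \<open>g \<noteq> 0\<close> by auto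
  next
    case (Suc k)
    then obtain h where h: "h \<in> G" "h \<noteq> 0" "weight_less (?m - k) h" by blast
    then have pos: "?m - k > 0" using weight_less_0 by (cases "?m - k") auto
    obtain h' where h': "h' \<in> G" "mod_monic f (g * h) = smult (p ^ N) h'"
      using lattice_orderD(4)[OF G g(1) h(1)] by blast
    have "\<not> f dvd g * h"
      using f_dvd_mult dvd_degree_less_eq_0 lattice_orderD(2)[OF G] g(1) h \<open>g \<noteq> 0\<close> by blast
    then have "mod_monic f (g * h) \<noteq> 0" unfolding mod_monic_eq_0_iff .
    then have "h' \<noteq> 0" unfolding h'(2) by auto
    moreover have "weight_less (?m - Suc k) h'"
      unfolding weight_less_def
    proof (intro allI impI)
      fix j assume ne: "coeff h' j \<noteq> 0"
      have "weight_less (Suc ((?m - 1) + (?m - k - 1))) (g * h)"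
      proof (rule weight_less_mult)
        have "Suc (?m - 1) = ?m" "Suc (?m - k - 1) = ?m - k" using pos by auto
        then show "weight_less (Suc (?m - 1)) g" "weight_less (Suc (?m - k - 1)) h"
          using g(2) h(3) by (simp_all only:)
      qed
      then have "weight_less (Suc ((?m - 1) + (?m - k - 1))) (smult (p ^ N) h')"
        using weight_less_mod_monic h'(2) by metis
      then have "degree (p ^ N * coeff h' j) + coeff_degrees f * j < Suc ((?m - 1) + (?m - k - 1))"
        using ne p_nonzero by (simp add: weight_less_def)
      \<comment> \<open>With m = N deg p, the strict bound for the product is 2m - k - 1, and
        removing the factor p^N takes off m.\<close>
      then show "degree (coeff h' j) + coeff_degrees f * j < ?m - Suc k"
        using ne p_nonzero pos by (simp add: degree_mult_eq degree_p_power)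
    qed
    ultimately show ?case using h'(1) by blast
  qed
  from this[of ?m] show False using weight_less_0 by auto
qed

text \<open>The coefficients of the monomials T^a x^j whose weight a + w j equals m + s with s < d,
  where w is the weight of x. The case distinction excludes negative a, for which truncated
  subtraction would pick a wrong coefficient.\<close>

definition leading_part :: "nat \<Rightarrow> nat \<Rightarrow> 'a poly poly \<Rightarrow> nat \<times> nat \<Rightarrow> 'a" where
  "leading_part m d h = (\<lambda>(j, s)\<in>{..<degree f} \<times> {..<d}.
     if coeff_degrees f * j \<le> m + s then coeff (coeff h j) (m + s - coeff_degrees f * j) else 0)"

text \<open>Elements with the same leading part differ by an element of weight below N deg p, which
  is zero. So at most q^(n d) elements of \<open>G\<close> have weight below N deg p + d.\<close>

lemma leading_part_inj:
  assumes G: "lattice_order N G"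
  shows "inj_on (leading_part (N * degree p) d) {h \<in> G. weight_less (N * degree p + d) h}"
proof (rule inj_onI)
  let ?m = "N * degree p" and ?w = "coeff_degrees f"
  fix g h assume g: "g \<in> {h \<in> G. weight_less (?m + d) h}" and h: "h \<in> {h \<in> G. weight_less (?m + d) h}"
    and eq: "leading_part ?m d g = leading_part ?m d h"
  have "weight_less ?m (g - h)"
    unfolding weight_less_def
  proof (intro allI impI, rule ccontr)
    fix j assume ne: "coeff (g - h) j \<noteq> 0" and "\<not> degree (coeff (g - h) j) + ?w * j < ?m"
    then have ge: "?m \<le> degree (coeff (g - h) j) + ?w * j" by simp
    have "weight_less (?m + d) (g - h)" using weight_less_diff g h by simp
    then have lt: "degree (coeff (g - h) j) + ?w * j < ?m + d"
      using ne by (simp add: weight_less_def)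
    \<comment> \<open>The position of the leading coefficient of the j-th coefficient of g - h. As
      both leading parts agree there, that coefficient would vanish.\<close>
    define s where "s = degree (coeff (g - h) j) + ?w * j - ?m"
    have "j < degree f"
      using ne lattice_orderD(2)[OF G] g h
      by (metis (no_types, lifting) coeff_diff coeff_eq_0 diff_zero linorder_not_less mem_Collect_eq order_less_le_trans)
    then have "leading_part ?m d g (j, s) = leading_part ?m d h (j, s)" "(j, s) \<in> {..<degree f} \<times> {..<d}"
      using eq lt ge by (auto simp: s_def)
    moreover have "?w * j \<le> ?m + s" "?m + s - ?w * j = degree (coeff (g - h) j)"
      using ge by (auto simp: s_def)
    ultimately have "coeff (coeff g j) (degree (coeff (g - h) j)) = coeff (coeff h j) (degree (coeff (g - h) j))"
      by (simp add: leading_part_def)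
    then have "lead_coeff (coeff (g - h) j) = 0" by (simp only: coeff_diff right_minus_eq)
    then show False using ne unfolding leading_coeff_0_iff by simp
  qed
  moreover have "g - h \<in> G" using g h poly_submoduleD(4)[OF lattice_orderD(1)[OF G]] by auto
  ultimately have "g - h = 0" by (intro lattice_order_weight_eq_0[OF G])
  then show "g = h" by simp
qed

text \<open>Coefficients are given by a function on a grid, so that a box of polynomials can be
  counted as a function space.\<close>

definition box_poly :: "nat \<Rightarrow> (nat \<times> nat \<Rightarrow> 'a) \<Rightarrow> 'a poly poly" where
  "box_poly m c = (\<Sum>j<degree f. monom (\<Sum>t<m. monom (c (j, t)) t) j)"

lemma coeff_box_poly:
  "coeff (box_poly m c) j = (if j < degree f then \<Sum>t<m. monom (c (j, t)) t else 0)"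
  by (simp add: box_poly_def coeff_sum if_distrib cong: if_cong)

lemma coeff_coeff_box_poly:
  "coeff (coeff (box_poly m c) j) t = (if j < degree f \<and> t < m then c (j, t) else 0)"
  by (simp add: coeff_box_poly coeff_sum if_distrib cong: if_cong)

lemma p_power_dvd_cancel:
  assumes "\<not> p dvd u" "p ^ N dvd y * u"
  shows "p ^ N dvd y"
  using assms(2)
proof (induction N arbitrary: y)
  case (Suc N)
  then have "p dvd y * u" by (metis dvd_mult_left power_Suc)
  then have "p dvd y" using assms(1) prime_elem_dvd_multD[OF prime_p] by blast
  then obtain z where z: "y = p * z" by (rule dvdE)
  then have "p ^ N dvd z * u"
    using Suc.prems p_nonzero(1) by (simp add: mult.assoc)
  then have "p ^ N dvd z" by (rule Suc.IH)
  then show ?case unfolding z power_Suc by (rule mult_dvd_mono[OF dvd_refl])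
qed simp

text \<open>The pigeonhole argument is made without forming S/R. The expressions p^i g + p^N r, with
  i \<le> M and r in a box of q^(n m) polynomials, are too numerous for the weight bound that they
  obey, so two of them coincide; their exponents i must differ.\<close>

theorem lattice_order_bound:
  assumes G: "lattice_order N G" and g: "g \<in> G"
  shows "p ^ N dvd p ^ exponent_bound f * coeff g c"
proof -
  let ?w = "coeff_degrees f" and ?n = "degree f" and ?q = "card (UNIV :: 'a set)"
  define M where "M = exponent_bound f"
  \<comment> \<open>Large enough that all p^i g with i \<le> M obey the weight bound below, whatever
    \<open>g\<close> is.\<close>
  define m where "m = M * degree p + coeff_degrees g + ?w * ?n + 1"
  \<comment> \<open>With w the weight of x, p^N times a box polynomial has weight below N deg p + m
    + w n. The excess w n in each of the n coordinates gives the factor q^(n n w), which is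
    \<open>M\<close>: only M q^(n m) values are possible for (M + 1) q^(n m) expressions.\<close>
  define d where "d = m + ?w * ?n"
  define T where "T = {h \<in> G. weight_less (N * degree p + d) h}"
  define \<Phi> where "\<Phi> m = ({..<?n} \<times> {..<m} \<rightarrow>\<^sub>E (UNIV :: 'a set))" for m :: nat
  have card_\<Phi>: "finite (\<Phi> m)" "card (\<Phi> m) = ?q ^ (?n * m)" for m :: nat
    by (auto simp: \<Phi>_def card_PiE intro!: finite_PiE)
  have T: "finite T" "card T \<le> ?q ^ (?n * d)"
  proof -
    have img: "leading_part (N * degree p) d ` T \<subseteq> \<Phi> d"
      by (intro image_subsetI) (simp add: leading_part_def \<Phi>_def restrict_PiE_iff)
    have inj: "inj_on (leading_part (N * degree p) d) T"
      unfolding T_def by (rule leading_part_inj[OF G])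
    show "finite T" by (rule inj_on_finite[OF inj img card_\<Phi>(1)])
    show "card T \<le> ?q ^ (?n * d)" using card_inj_on_le[OF inj img card_\<Phi>(1)] card_\<Phi>(2) by simp
  qed
  define \<psi> where "\<psi> = (\<lambda>(i, \<phi>). smult (p ^ i) g + smult (p ^ N) (box_poly m \<phi>))"
  have deg_box: "degree (box_poly m \<phi>) < ?n" for \<phi>
    using coeff_box_poly degree_pos by (intro degree_lessI) auto
  have \<psi>_T: "\<psi> ` ({..M} \<times> \<Phi> m) \<subseteq> T"
  proof clarify
    fix i \<phi> assume i: "i \<le> M"
    \<comment> \<open>The sum is written as a difference so that \<open>weight_less_diff\<close>
      applies.\<close>
    have "weight_less (N * degree p + d) (smult (p ^ i) g - smult (- (p ^ N)) (box_poly m \<phi>))"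
    proof (rule weight_less_diff; unfold weight_less_def; intro allI impI)
      fix j assume "coeff (smult (p ^ i) g) j \<noteq> 0"
      then have "coeff g j \<noteq> 0" by auto
      then have "j \<le> ?n" using lattice_orderD(2)[OF G g] le_degree[of g j] by simp
      then have "?w * j \<le> ?w * ?n" by (intro mult_le_mono2) simp
      moreover have "degree (p ^ i * coeff g j) \<le> M * degree p + coeff_degrees g"
        using degree_mult_le[of "p ^ i" "coeff g j"] degree_coeff_le[of g j]
          mult_le_mono1[OF i, of "degree p"] unfolding degree_p_power by linarith
      ultimately show "degree (coeff (smult (p ^ i) g) j) + ?w * j < N * degree p + d"
        unfolding d_def m_def coeff_smult by linarith
    next
      fix j assume ne: "coeff (smult (- (p ^ N)) (box_poly m \<phi>)) j \<noteq> 0"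
      then have "j < ?n" by (auto simp: coeff_box_poly split: if_splits)
      then have "?w * j \<le> ?w * ?n" by (intro mult_le_mono2) simp
      moreover have "degree (coeff (box_poly m \<phi>) j) < m"
        by (rule degree_lessI) (auto simp: coeff_coeff_box_poly m_def)
      ultimately show "degree (coeff (smult (- (p ^ N)) (box_poly m \<phi>)) j) + ?w * j < N * degree p + d"
        using degree_mult_le[of "- (p ^ N)" "coeff (box_poly m \<phi>) j"]
        unfolding d_def coeff_smult degree_minus degree_p_power by linarith
    qed
    moreover have "smult (p ^ i) g + smult (p ^ N) (box_poly m \<phi>) \<in> G"
      using poly_submoduleD(2,3)[OF lattice_orderD(1)[OF G]] g smult_p_power_mem[OF G deg_box] by blast
    ultimately show "\<psi> (i, \<phi>) \<in> T" by (simp add: \<psi>_def T_def)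
  qed
  have "\<not> inj_on \<psi> ({..M} \<times> \<Phi> m)"
  proof
    assume "inj_on \<psi> ({..M} \<times> \<Phi> m)"
    then have "card ({..M} \<times> \<Phi> m) \<le> card T"
      using \<psi>_T T(1) by (intro card_inj_on_le)
    then have "Suc M * ?q ^ (?n * m) \<le> ?q ^ (?n * d)"
      using T(2) by (simp add: card_cartesian_product card_\<Phi>)
    also have "\<dots> = M * ?q ^ (?n * m)"
      by (simp add: d_def M_def exponent_bound_def distrib_left power_add ac_simps)
    finally show False using card_gt_0_iff[of "UNIV :: 'a set"] by auto
  qed
  then obtain i \<phi> j \<chi> where ij: "i \<le> M" "j \<le> M" "\<phi> \<in> \<Phi> m" "\<chi> \<in> \<Phi> m" "(i, \<phi>) \<noteq> (j, \<chi>)"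
    "\<psi> (i, \<phi>) = \<psi> (j, \<chi>)"
    unfolding inj_on_def by auto
  have diff: "smult (p ^ i - p ^ j) g = smult (p ^ N) (box_poly m \<chi> - box_poly m \<phi>)"
    using ij(6) by (simp add: \<psi>_def smult_diff_left smult_diff_right algebra_simps)
  have "i \<noteq> j"
  proof
    assume "i = j"
    with diff p_nonzero(2) have "box_poly m \<chi> = box_poly m \<phi>" by auto
    then have "\<chi> (k, t) = \<phi> (k, t)" if "k < ?n" "t < m" for k t
      using that coeff_coeff_box_poly by metis
    then have "\<chi> = \<phi>"
      using ij(3,4) unfolding \<Phi>_def by (intro PiE_ext) auto
    then show False using ij(5) \<open>i = j\<close> by simp
  qed
  have key: "p ^ N dvd p ^ M * coeff g c"
    if lt: "i < j" "j \<le> M" and dvd: "p ^ N dvd (p ^ i - p ^ j) * coeff g c" for i j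
  proof -
    have "p ^ j = p ^ i * p ^ (j - i)" using lt by (simp flip: power_add)
    then have "(p ^ i - p ^ j) * coeff g c = (p ^ i * coeff g c) * (1 - p ^ (j - i))"
      by (simp add: algebra_simps)
    moreover have "\<not> p dvd 1 - p ^ (j - i)"
    proof
      assume "p dvd 1 - p ^ (j - i)"
      moreover have "p dvd p ^ (j - i)" using lt by (intro dvd_power) simp
      ultimately have "p dvd (1 - p ^ (j - i)) + p ^ (j - i)" by (rule dvd_add)
      then show False using prime_elem_not_unit[OF prime_p] by simp
    qed
    ultimately have "p ^ N dvd p ^ i * coeff g c"
      using p_power_dvd_cancel dvd by metis
    moreover have "p ^ M = p ^ (M - i) * p ^ i" using lt by (simp flip: power_add)
    ultimately show ?thesis by (simp add: mult.assoc dvd_mult)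
  qed
  have "(p ^ i - p ^ j) * coeff g c = p ^ N * coeff (box_poly m \<chi> - box_poly m \<phi>) c"
    using arg_cong[OF diff, of "\<lambda>h. coeff h c"] by simp
  then have "p ^ N dvd (p ^ i - p ^ j) * coeff g c" by simp
  moreover from this have "p ^ N dvd (p ^ j - p ^ i) * coeff g c"
    by (metis dvd_minus_iff minus_diff_eq minus_mult_left)
  ultimately show ?thesis
    using key[of i j] key[of j i] ij(1,2) \<open>i \<noteq> j\<close> unfolding M_def by (metis linorder_neqE_nat)
qed

end

section \<open>The fraction field of a domain\<close>

context domain
begin

lemma mem_fraction:
  "z \<in> fraction R a b \<longleftrightarrow> fst z \<in> carrier R \<and> snd z \<in> carrier R - {\<zero>} \<and> a \<otimes> snd z = fst z \<otimes> b"
  by (auto simp: fraction_def)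

lemma fraction_eq_iff:
  assumes "a \<in> carrier R" "b \<in> carrier R - {\<zero>}" "c \<in> carrier R" "d \<in> carrier R - {\<zero>}"
  shows "fraction R a b = fraction R c d \<longleftrightarrow> a \<otimes> d = c \<otimes> b"
proof
  assume "fraction R a b = fraction R c d"
  moreover have "(c, d) \<in> fraction R c d" using assms by (simp add: mem_fraction)
  ultimately have "(c, d) \<in> fraction R a b" by simp
  then show "a \<otimes> d = c \<otimes> b" by (simp add: mem_fraction)
next
  assume eq: "a \<otimes> d = c \<otimes> b"
  have "a \<otimes> v = u \<otimes> b \<longleftrightarrow> c \<otimes> v = u \<otimes> d"
    if u: "u \<in> carrier R" "v \<in> carrier R - {\<zero>}" for u v
  proof -
    have "a \<otimes> v = u \<otimes> b \<longleftrightarrow> d \<otimes> (a \<otimes> v) = d \<otimes> (u \<otimes> b)"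
      using assms u m_lcancel[of d] by auto
    also have "d \<otimes> (a \<otimes> v) = b \<otimes> (c \<otimes> v)"
      using assms u eq by (simp add: m_assoc m_comm m_lcomm) (metis m_assoc m_comm)
    also have "d \<otimes> (u \<otimes> b) = b \<otimes> (u \<otimes> d)"
      using assms u by (simp add: m_assoc m_comm m_lcomm)
    also have "b \<otimes> (c \<otimes> v) = b \<otimes> (u \<otimes> d) \<longleftrightarrow> c \<otimes> v = u \<otimes> d"
      using assms u m_lcancel[of b] by auto
    finally show ?thesis .
  qed
  then show "fraction R a b = fraction R c d"
    by (auto simp: mem_fraction)
qed

text \<open>Operations on fractions are unions over all representatives. If the result does not
  depend on them, all members of the union are one and the same class.\<close>

lemma UN_fraction_eq:
  assumes "a \<in> carrier R" "b \<in> carrier R - {\<zero>}" "c \<in> carrier R" "d \<in> carrier R - {\<zero>}"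
    and "\<And>a' b' c' d'. a' \<in> carrier R \<Longrightarrow> b' \<in> carrier R - {\<zero>} \<Longrightarrow> a \<otimes> b' = a' \<otimes> b
      \<Longrightarrow> c' \<in> carrier R \<Longrightarrow> d' \<in> carrier R - {\<zero>} \<Longrightarrow> c \<otimes> d' = c' \<otimes> d \<Longrightarrow> H a' b' c' d' = K"
  shows "(\<Union>(a', b')\<in>fraction R a b. \<Union>(c', d')\<in>fraction R c d. H a' b' c' d') = K"
proof -
  have "(a, b) \<in> fraction R a b" "(c, d) \<in> fraction R c d"
    using assms(1-4) by (simp_all add: mem_fraction)
  moreover have "H (fst z) (snd z) (fst w) (snd w) = K"
    if "z \<in> fraction R a b" "w \<in> fraction R c d" for z w
    using that assms(5) by (simp add: mem_fraction)
  ultimately show ?thesis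
    by (auto simp: case_prod_unfold)
qed

lemma fraction_field_mult:
  assumes "a \<in> carrier R" "b \<in> carrier R - {\<zero>}" "c \<in> carrier R" "d \<in> carrier R - {\<zero>}"
  shows "fraction R a b \<otimes>\<^bsub>fraction_field R\<^esub> fraction R c d = fraction R (a \<otimes> c) (b \<otimes> d)"
proof -
  have "(\<Union>(a', b')\<in>fraction R a b. \<Union>(c', d')\<in>fraction R c d. fraction R (a' \<otimes> c') (b' \<otimes> d'))
      = fraction R (a \<otimes> c) (b \<otimes> d)"
  proof (rule UN_fraction_eq[OF assms])
    fix a' b' c' d' assume a': "a' \<in> carrier R" "b' \<in> carrier R - {\<zero>}" "a \<otimes> b' = a' \<otimes> b"
      and c': "c' \<in> carrier R" "d' \<in> carrier R - {\<zero>}" "c \<otimes> d' = c' \<otimes> d"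
    have "(a \<otimes> c) \<otimes> (b' \<otimes> d') = (a \<otimes> b') \<otimes> (c \<otimes> d')"
      using assms a'(1,2) c'(1,2) by (simp add: m_assoc m_lcomm)
    also have "\<dots> = (a' \<otimes> b) \<otimes> (c' \<otimes> d)"
      by (simp only: a' c')
    also have "\<dots> = (a' \<otimes> c') \<otimes> (b \<otimes> d)"
      using assms a'(1,2) c'(1,2) by (simp add: m_assoc m_lcomm)
    finally show "fraction R (a' \<otimes> c') (b' \<otimes> d') = fraction R (a \<otimes> c) (b \<otimes> d)"
      using assms a' c' by (subst fraction_eq_iff) (auto simp: integral_iff)
  qed
  then show ?thesis by (simp add: fraction_field_def)
qed

lemma fraction_field_add:
  assumes "a \<in> carrier R" "b \<in> carrier R - {\<zero>}" "c \<in> carrier R" "d \<in> carrier R - {\<zero>}"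
  shows "fraction R a b \<oplus>\<^bsub>fraction_field R\<^esub> fraction R c d
    = fraction R (a \<otimes> d \<oplus> c \<otimes> b) (b \<otimes> d)"
proof -
  have "(\<Union>(a', b')\<in>fraction R a b. \<Union>(c', d')\<in>fraction R c d.
      fraction R (a' \<otimes> d' \<oplus> c' \<otimes> b') (b' \<otimes> d'))
      = fraction R (a \<otimes> d \<oplus> c \<otimes> b) (b \<otimes> d)"
  proof (rule UN_fraction_eq[OF assms])
    fix a' b' c' d' assume a': "a' \<in> carrier R" "b' \<in> carrier R - {\<zero>}" "a \<otimes> b' = a' \<otimes> b"
      and c': "c' \<in> carrier R" "d' \<in> carrier R - {\<zero>}" "c \<otimes> d' = c' \<otimes> d"
    have "(a \<otimes> d \<oplus> c \<otimes> b) \<otimes> (b' \<otimes> d') = (a \<otimes> b') \<otimes> (d \<otimes> d') \<oplus> (c \<otimes> d') \<otimes> (b \<otimes> b')"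
      using assms a'(1,2) c'(1,2) by (simp add: l_distr r_distr m_assoc m_comm m_lcomm)
    also have "\<dots> = (a' \<otimes> b) \<otimes> (d \<otimes> d') \<oplus> (c' \<otimes> d) \<otimes> (b \<otimes> b')"
      by (simp only: a' c')
    also have "\<dots> = (a' \<otimes> d' \<oplus> c' \<otimes> b') \<otimes> (b \<otimes> d)"
      using assms a'(1,2) c'(1,2) by (simp add: l_distr r_distr m_assoc m_comm m_lcomm)
    finally show "fraction R (a' \<otimes> d' \<oplus> c' \<otimes> b') (b' \<otimes> d') = fraction R (a \<otimes> d \<oplus> c \<otimes> b) (b \<otimes> d)"
      using assms a' c' by (subst fraction_eq_iff) (auto simp: integral_iff)
  qed
  then show ?thesis by (simp add: fraction_field_def)
qed

end

section \<open>The ring $A[x]/f$ and its fraction field\<close>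

lemma type_algebra_simps [simp]:
  "carrier ring_of_type_algebra = UNIV" "\<one>\<^bsub>ring_of_type_algebra\<^esub> = 1"
  "\<zero>\<^bsub>ring_of_type_algebra\<^esub> = 0" "a \<otimes>\<^bsub>ring_of_type_algebra\<^esub> b = a * b"
  "a \<oplus>\<^bsub>ring_of_type_algebra\<^esub> b = a + b"
  by (simp_all add: ring_of_type_algebra_def)

lemma PIdl_type_algebra: "PIdl\<^bsub>ring_of_type_algebra\<^esub> a = {b::'b::comm_ring_1. a dvd b}"
  by (auto simp: cgenideal_def dvd_def mult.commute)

lemma residue_class_eq: "residue_class f g = {h. f dvd h - g}"
proof -
  have "h \<in> (\<Union>k\<in>{b. f dvd b}. {k + g}) \<longleftrightarrow> f dvd h - g" for h
    by (auto intro: bexI[of _ "h - g"])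
  then show ?thesis
    by (auto simp: residue_class_def PIdl_type_algebra a_r_coset_def')
qed

lemma residue_class_eq_iff: "residue_class f g = residue_class f h \<longleftrightarrow> f dvd g - h"
proof
  assume "residue_class f g = residue_class f h"
  moreover have "g \<in> residue_class f g" by (simp add: residue_class_eq)
  ultimately show "f dvd g - h" by (simp add: residue_class_eq)
next
  assume d: "f dvd g - h"
  have "f dvd k - g \<longleftrightarrow> f dvd k - h" for k
    using dvd_add_left_iff[OF d, of "k - g"] by simp
  then show "residue_class f g = residue_class f h" by (simp add: residue_class_eq)
qed

lemma PIdl_ideal: "ideal (PIdl\<^bsub>ring_of_type_algebra\<^esub> (f::'b::comm_ring_1)) ring_of_type_algebra"
  by (rule cring.cgenideal_ideal[OF cring_from_type_algebra]) simp

lemma equation_ring_simps: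
  "carrier (equation_ring f) = range (residue_class f)"
  "\<one>\<^bsub>equation_ring f\<^esub> = residue_class f 1" "\<zero>\<^bsub>equation_ring f\<^esub> = residue_class f 0"
  "residue_class f g \<otimes>\<^bsub>equation_ring f\<^esub> residue_class f h = residue_class f (g * h)"
  "residue_class f g \<oplus>\<^bsub>equation_ring f\<^esub> residue_class f h = residue_class f (g + h)"
  "cring (equation_ring f)"
proof -
  note I = PIdl_ideal[of f]
  note hom = ideal.rcos_ring_hom[OF I]
  show "carrier (equation_ring f) = range (residue_class f)"
    by (auto simp: equation_ring_def FactRing_def A_RCOSETS_def' residue_class_def)
  show "\<one>\<^bsub>equation_ring f\<^esub> = residue_class f 1"
    by (simp add: equation_ring_def FactRing_def residue_class_def)
  show "\<zero>\<^bsub>equation_ring f\<^esub> = residue_class f 0"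
    by (simp add: equation_ring_def FactRing_def residue_class_eq PIdl_type_algebra)
  show "residue_class f g \<otimes>\<^bsub>equation_ring f\<^esub> residue_class f h = residue_class f (g * h)"
    using ring_hom_mult[OF hom, of g h] by (simp add: equation_ring_def residue_class_def)
  show "residue_class f g \<oplus>\<^bsub>equation_ring f\<^esub> residue_class f h = residue_class f (g + h)"
    using ring_hom_add[OF hom, of g h] by (simp add: equation_ring_def residue_class_def)
  show "cring (equation_ring f)"
    unfolding equation_ring_def by (rule ideal.quotient_is_cring[OF I cring_from_type_algebra])
qed

context order_setup
begin

abbreviation "K \<equiv> K_field f"

lemma domain_equation_ring: "domain (equation_ring f)"
proof (rule domain.intro[OF equation_ring_simps(6) domain_axioms.intro])
  have "\<not> f dvd 1" using dvd_degree_less_eq_0[of 1] degree_pos by auto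
  then show "\<one>\<^bsub>equation_ring f\<^esub> \<noteq> \<zero>\<^bsub>equation_ring f\<^esub>"
    by (simp add: equation_ring_simps residue_class_eq_iff)
next
  fix a b assume ab: "a \<otimes>\<^bsub>equation_ring f\<^esub> b = \<zero>\<^bsub>equation_ring f\<^esub>"
    "a \<in> carrier (equation_ring f)" "b \<in> carrier (equation_ring f)"
  then obtain g h where gh: "a = residue_class f g" "b = residue_class f h"
    by (auto simp: equation_ring_simps)
  with ab(1) have "f dvd g * h" by (simp add: equation_ring_simps residue_class_eq_iff)
  then have "f dvd g \<or> f dvd h" by (rule f_dvd_mult)
  then show "a = \<zero>\<^bsub>equation_ring f\<^esub> \<or> b = \<zero>\<^bsub>equation_ring f\<^esub>"
    by (simp add: gh equation_ring_simps residue_class_eq_iff)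
qed

lemma const_residue_nonzero:
  "d \<noteq> 0 \<Longrightarrow> residue_class f [:d:] \<in> carrier (equation_ring f) - {\<zero>\<^bsub>equation_ring f\<^esub>}"
  using dvd_degree_less_eq_0[of "[:d:]"] degree_pos
  by (auto simp: equation_ring_simps residue_class_eq_iff)

lemma residue_carrier: "residue_class f g \<in> carrier (equation_ring f)"
  by (simp add: equation_ring_simps)

lemma K_frac_eq_iff:
  assumes "d \<noteq> 0" "e \<noteq> 0"
  shows "K_frac f g d = K_frac f h e \<longleftrightarrow> f dvd smult e g - smult d h"
  unfolding K_frac_def
  using domain.fraction_eq_iff[OF domain_equation_ring residue_carrier const_residue_nonzero[OF assms(1)]
    residue_carrier const_residue_nonzero[OF assms(2)]]
  by (simp add: equation_ring_simps residue_class_eq_iff)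

lemma K_frac_mult:
  assumes "d \<noteq> 0" "e \<noteq> 0"
  shows "K_frac f g d \<otimes>\<^bsub>K\<^esub> K_frac f h e = K_frac f (g * h) (d * e)"
  unfolding K_frac_def K_field_def
  using domain.fraction_field_mult[OF domain_equation_ring residue_carrier const_residue_nonzero[OF assms(1)]
    residue_carrier const_residue_nonzero[OF assms(2)]]
  by (simp add: equation_ring_simps mult.commute)

lemma K_frac_add:
  assumes "d \<noteq> 0" "e \<noteq> 0"
  shows "K_frac f g d \<oplus>\<^bsub>K\<^esub> K_frac f h e = K_frac f (smult e g + smult d h) (d * e)"
  unfolding K_frac_def K_field_def
  using domain.fraction_field_add[OF domain_equation_ring residue_carrier const_residue_nonzero[OF assms(1)]
    residue_carrier const_residue_nonzero[OF assms(2)]]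
  by (simp add: equation_ring_simps mult.commute)

lemma K_one: "\<one>\<^bsub>K\<^esub> = K_frac f 1 1" and K_zero: "\<zero>\<^bsub>K\<^esub> = K_frac f 0 1"
  by (simp_all add: K_field_def fraction_field_def K_frac_def equation_ring_simps one_pCons)

text \<open>A denominator s can be moved into A: if u s = d modulo \<open>f\<close>, then g / s = g
  u / d.\<close>

lemma K_carrier: "carrier K = {K_frac f g d | g d. d \<noteq> 0}"
proof (intro equalityI subsetI)
  fix k assume "k \<in> carrier K"
  then obtain g s where k: "k = fraction (equation_ring f) (residue_class f g) (residue_class f s)"
    and s: "residue_class f s \<noteq> residue_class f 0"
    by (auto simp: K_field_def fraction_field_def equation_ring_simps)
  then have "mod_monic f s \<noteq> 0" by (simp add: residue_class_eq_iff mod_monic_eq_0_iff)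
  from bezout_constant[OF this degree_mod_monic] obtain u v d
    where d: "d \<noteq> 0" "u * mod_monic f s + v * f = [:d:]" by blast
  have "g * [:d:] - g * u * s = f * (g * v) - g * u * (s - mod_monic f s)"
    by (simp add: d(2)[symmetric] algebra_simps)
  also have "f dvd \<dots>"
    by (intro dvd_diff dvd_triv_left dvd_mult mod_monic_dvd)
  finally have "k = K_frac f (g * u) d"
    unfolding k K_frac_def using s
    by (subst domain.fraction_eq_iff[OF domain_equation_ring residue_carrier _ residue_carrier const_residue_nonzero[OF d(1)]])
      (auto simp: equation_ring_simps residue_class_eq_iff mult.assoc)
  then show "k \<in> {K_frac f g d | g d. d \<noteq> 0}" using d(1) by blast
next
  fix k assume "k \<in> {K_frac f g d | g d. d \<noteq> 0}"
  then obtain g d where "d \<noteq> 0" "k = K_frac f g d" by blast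
  then show "k \<in> carrier K"
    using residue_carrier[of g] const_residue_nonzero[of d]
    unfolding K_field_def fraction_field_def K_frac_def by auto
qed

lemma K_frac_carrier [simp]: "d \<noteq> 0 \<Longrightarrow> K_frac f g d \<in> carrier K"
  using K_carrier by blast

lemma K_cases:
  assumes "k \<in> carrier K"
  obtains g d where "d \<noteq> 0" "k = K_frac f g d"
  using assms K_carrier by auto

lemma K_frac_cong:
  "d \<noteq> 0 \<Longrightarrow> e \<noteq> 0 \<Longrightarrow> smult e g = smult d h \<Longrightarrow> K_frac f g d = K_frac f h e"
  by (simp add: K_frac_eq_iff)

lemma cring_K: "cring K"
proof (rule cringI)
  show "abelian_group K"
  proof (rule abelian_groupI)
    show "\<zero>\<^bsub>K\<^esub> \<in> carrier K" by (simp add: K_zero)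
    fix k l assume k: "k \<in> carrier K" and l: "l \<in> carrier K"
    obtain g d h e where gh: "d \<noteq> 0" "e \<noteq> 0" "k = K_frac f g d" "l = K_frac f h e"
      using k l by (metis K_cases)
    show "k \<oplus>\<^bsub>K\<^esub> l \<in> carrier K" using gh by (simp add: K_frac_add)
    show "k \<oplus>\<^bsub>K\<^esub> l = l \<oplus>\<^bsub>K\<^esub> k" using gh by (simp add: K_frac_add add.commute mult.commute)
    show "\<zero>\<^bsub>K\<^esub> \<oplus>\<^bsub>K\<^esub> k = k" using gh by (simp add: K_zero K_frac_add)
    have "K_frac f (- g) d \<oplus>\<^bsub>K\<^esub> k = \<zero>\<^bsub>K\<^esub>"
      using gh by (simp add: K_zero K_frac_add K_frac_eq_iff)
    then show "\<exists>y\<in>carrier K. y \<oplus>\<^bsub>K\<^esub> k = \<zero>\<^bsub>K\<^esub>" using gh by (intro bexI[of _ "K_frac f (- g) d"]) auto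
    fix m assume "m \<in> carrier K"
    then obtain i c where "c \<noteq> 0" "m = K_frac f i c" by (metis K_cases)
    then show "k \<oplus>\<^bsub>K\<^esub> l \<oplus>\<^bsub>K\<^esub> m = k \<oplus>\<^bsub>K\<^esub> (l \<oplus>\<^bsub>K\<^esub> m)"
      using gh by (simp add: K_frac_add smult_add_right add.assoc mult_ac)
  qed
  show "Group.comm_monoid K"
  proof (rule comm_monoidI)
    show "\<one>\<^bsub>K\<^esub> \<in> carrier K" by (simp add: K_one)
    fix k l assume k: "k \<in> carrier K" and l: "l \<in> carrier K"
    obtain g d h e where gh: "d \<noteq> 0" "e \<noteq> 0" "k = K_frac f g d" "l = K_frac f h e"
      using k l by (metis K_cases)
    show "k \<otimes>\<^bsub>K\<^esub> l \<in> carrier K" using gh by (simp add: K_frac_mult)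
    show "k \<otimes>\<^bsub>K\<^esub> l = l \<otimes>\<^bsub>K\<^esub> k" using gh by (simp add: K_frac_mult mult.commute)
    show "\<one>\<^bsub>K\<^esub> \<otimes>\<^bsub>K\<^esub> k = k" using gh by (simp add: K_one K_frac_mult)
    fix m assume "m \<in> carrier K"
    then obtain i c where "c \<noteq> 0" "m = K_frac f i c" by (metis K_cases)
    then show "k \<otimes>\<^bsub>K\<^esub> l \<otimes>\<^bsub>K\<^esub> m = k \<otimes>\<^bsub>K\<^esub> (l \<otimes>\<^bsub>K\<^esub> m)"
      using gh by (simp add: K_frac_mult mult.assoc)
  qed
  fix k l m assume k: "k \<in> carrier K" and l: "l \<in> carrier K" and m: "m \<in> carrier K"
  obtain g d h e i c where "d \<noteq> 0" "e \<noteq> 0" "k = K_frac f g d" "l = K_frac f h e"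
      "c \<noteq> 0" "m = K_frac f i c"
    using k l m by (metis K_cases)
  then show "(k \<oplus>\<^bsub>K\<^esub> l) \<otimes>\<^bsub>K\<^esub> m = k \<otimes>\<^bsub>K\<^esub> m \<oplus>\<^bsub>K\<^esub> l \<otimes>\<^bsub>K\<^esub> m"
    by (simp add: K_frac_add K_frac_mult)
      (rule K_frac_cong; simp add: smult_add_right distrib_left distrib_right mult_ac)
qed

lemma ring_K: "ring K"
  using cring_K by (rule cring.axioms)

lemma K_frac_same_denominator_add:
  "d \<noteq> 0 \<Longrightarrow> K_frac f g d \<oplus>\<^bsub>K\<^esub> K_frac f h d = K_frac f (g + h) d"
  unfolding K_frac_add by (rule K_frac_cong) (simp_all add: smult_add_right)

lemma K_frac_0: "d \<noteq> 0 \<Longrightarrow> K_frac f 0 d = \<zero>\<^bsub>K\<^esub>"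
  unfolding K_zero by (rule K_frac_cong) simp_all

lemma K_frac_eq_0_iff: "d \<noteq> 0 \<Longrightarrow> K_frac f g d = \<zero>\<^bsub>K\<^esub> \<longleftrightarrow> f dvd g"
  by (simp add: K_zero K_frac_eq_iff)

lemma K_frac_minus: "d \<noteq> 0 \<Longrightarrow> \<ominus>\<^bsub>K\<^esub> K_frac f g d = K_frac f (- g) d"
  using abelian_group.minus_equality[OF ring.is_abelian_group[OF ring_K], of "K_frac f (- g) d" "K_frac f g d"]
  by (simp add: K_frac_same_denominator_add K_frac_0)

lemma K_frac_mod_monic: "d \<noteq> 0 \<Longrightarrow> K_frac f (mod_monic f g) d = K_frac f g d"
  using mod_monic_dvd[of g] by (simp add: K_frac_eq_iff dvd_smult_iff smult_diff_right[symmetric])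
    (metis dvd_minus_iff minus_diff_eq)

lemma F_to_K_Fract:
  assumes "b \<noteq> 0"
  shows "F_to_K f (Fract a b) = K_frac f [:a:] b"
  unfolding F_to_K_def
proof (rule the_equality)
  show "\<exists>a' b'. b' \<noteq> 0 \<and> Fract a b = Fract a' b' \<and> K_frac f [:a:] b = K_frac f [:a':] b'"
    using assms by blast
  fix k assume "\<exists>a' b'. b' \<noteq> 0 \<and> Fract a b = Fract a' b' \<and> k = K_frac f [:a':] b'"
  then obtain a' b' where k: "b' \<noteq> 0" "Fract a b = Fract a' b'" "k = K_frac f [:a':] b'" by blast
  then have "a * b' = a' * b" using assms by (simp add: eq_fract)
  then show "k = K_frac f [:a:] b"
    unfolding k(3) by (intro K_frac_cong) (use assms k in \<open>auto simp: mult.commute\<close>)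
qed

lemma fract_cases:
  fixes r :: "'b::idom fract"
  obtains a b where "b \<noteq> 0" "r = Fract a b"
  by (cases r) auto

subsection \<open>Coordinates\<close>

text \<open>The coefficient of x^j in the F-basis 1, x, ..., x^(n-1) of K.\<close>

definition coord :: "nat \<Rightarrow> 'a Kelem \<Rightarrow> 'a poly fract" where
  "coord j k = (THE r. \<exists>g d. d \<noteq> 0 \<and> k = K_frac f g d \<and> r = Fract (coeff (mod_monic f g) j) d)"

lemma coord_K_frac:
  assumes "d \<noteq> 0"
  shows "coord j (K_frac f g d) = Fract (coeff (mod_monic f g) j) d"
  unfolding coord_def
proof (rule the_equality)
  show "\<exists>g' d'. d' \<noteq> 0 \<and> K_frac f g d = K_frac f g' d' \<and>
      Fract (coeff (mod_monic f g) j) d = Fract (coeff (mod_monic f g') j) d'"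
    using assms by blast
  fix r assume "\<exists>g' d'. d' \<noteq> 0 \<and> K_frac f g d = K_frac f g' d' \<and> r = Fract (coeff (mod_monic f g') j) d'"
  then obtain g' d' where r: "d' \<noteq> 0" "K_frac f g d = K_frac f g' d'"
    "r = Fract (coeff (mod_monic f g') j) d'" by blast
  then have "f dvd smult d' g - smult d g'" using assms by (simp add: K_frac_eq_iff)
  then have "f dvd smult d' g + smult (- d) g'" by simp
  then have "mod_monic f (smult d' g + smult (- d) g') = 0" unfolding mod_monic_eq_0_iff .
  then have "smult d' (mod_monic f g) = smult d (mod_monic f g')"
    unfolding mod_monic_add mod_monic_smult by simp
  then have "d' * coeff (mod_monic f g) j = d * coeff (mod_monic f g') j"
    by (metis coeff_smult)
  then show "r = Fract (coeff (mod_monic f g) j) d"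
    unfolding r(3) using assms r(1) by (simp add: eq_fract mult.commute)
qed

lemma coord_add:
  assumes "k \<in> carrier K" "l \<in> carrier K"
  shows "coord j (k \<oplus>\<^bsub>K\<^esub> l) = coord j k + coord j l"
proof -
  obtain g d h e where "d \<noteq> 0" "e \<noteq> 0" "k = K_frac f g d" "l = K_frac f h e"
    using assms by (metis K_cases)
  then show ?thesis
    by (simp add: K_frac_add coord_K_frac mod_monic_add mod_monic_smult mult.commute)
qed

lemma coord_scale:
  assumes "k \<in> carrier K"
  shows "coord j (F_to_K f r \<otimes>\<^bsub>K\<^esub> k) = r * coord j k"
proof -
  obtain g d where "d \<noteq> 0" "k = K_frac f g d" using assms by (metis K_cases)
  moreover obtain a b where "b \<noteq> 0" "r = Fract a b" by (rule fract_cases)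
  ultimately show ?thesis
    by (simp add: F_to_K_Fract K_frac_mult coord_K_frac mod_monic_smult)
qed

end

section \<open>Orders between $R$ and $R[1/\pi]$\<close>

context order_setup
begin

definition order_of :: "nat \<Rightarrow> 'a poly poly set \<Rightarrow> 'a Kelem set" where
  "order_of N G = (\<lambda>g. K_frac f g (p ^ N)) ` G"

text \<open>The degree bound makes the numerator of each element unique.\<close>

definition numerators :: "nat \<Rightarrow> 'a Kelem set \<Rightarrow> 'a poly poly set" where
  "numerators N S = {g. degree g < degree f \<and> K_frac f g (p ^ N) \<in> S}"

text \<open>The orders between R and R[1/p]. The common exponent \<open>N\<close> stands for finite
  generation over A.\<close>

definition p_overorder :: "'a Kelem set \<Rightarrow> bool" where
  "p_overorder S \<longleftrightarrow> subring S K \<and> R_in_K f \<subseteq> S \<and> (\<exists>N. \<forall>x\<in>S. \<exists>g. x = K_frac f g (p ^ N))"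

lemma K_frac_p_power_mult:
  "K_frac f g (p ^ N) \<otimes>\<^bsub>K\<^esub> K_frac f h (p ^ M) = K_frac f (g * h) (p ^ (N + M))"
  using p_nonzero by (simp add: K_frac_mult power_add)

lemma K_frac_scale: "d \<noteq> 0 \<Longrightarrow> K_frac f [:c:] 1 \<otimes>\<^bsub>K\<^esub> K_frac f g d = K_frac f (smult c g) d"
  by (simp add: K_frac_mult)

lemma K_frac_cancel: "K_frac f (smult (p ^ M) g) (p ^ (N + M)) = K_frac f g (p ^ N)"
  by (rule K_frac_cong) (use p_nonzero in \<open>simp_all add: power_add\<close>)

lemma R_in_order:
  assumes "R_in_K f \<subseteq> S"
  shows "K_frac f g 1 \<in> S"
  using assms by (auto simp: R_in_K_def)

lemma order_of_p_overorder:
  assumes G: "lattice_order N G"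
  shows "p_overorder (order_of N G)"
proof -
  note sub = poly_submoduleD[OF lattice_orderD(1)[OF G]]
  have R: "K_frac f g 1 \<in> order_of N G" for g
  proof -
    have "K_frac f g 1 = K_frac f (mod_monic f g) (p ^ 0)" by (simp add: K_frac_mod_monic)
    also have "\<dots> = K_frac f (smult (p ^ N) (mod_monic f g)) (p ^ N)"
      using K_frac_cancel[of N "mod_monic f g" 0] by simp
    finally show ?thesis
      unfolding order_of_def using smult_p_power_mem[OF G degree_mod_monic] by blast
  qed
  have "subring (order_of N G) K"
  proof (rule ring.subringI[OF ring_K])
    show "order_of N G \<subseteq> carrier K" using p_nonzero by (auto simp: order_of_def)
    show "\<one>\<^bsub>K\<^esub> \<in> order_of N G" unfolding K_one by (rule R)
    fix x assume x: "x \<in> order_of N G"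
    then obtain g where g: "g \<in> G" "x = K_frac f g (p ^ N)" by (auto simp: order_of_def)
    have "- g \<in> G" using sub(3)[OF g(1), of "- 1"] by simp
    then show "\<ominus>\<^bsub>K\<^esub> x \<in> order_of N G"
      using p_nonzero by (simp add: g(2) K_frac_minus order_of_def)
    fix y assume "y \<in> order_of N G"
    then obtain h where h: "h \<in> G" "y = K_frac f h (p ^ N)" by (auto simp: order_of_def)
    show "x \<oplus>\<^bsub>K\<^esub> y \<in> order_of N G"
      using sub(2)[OF g(1) h(1)] p_nonzero g h by (simp add: K_frac_same_denominator_add order_of_def)
    obtain k where k: "k \<in> G" "mod_monic f (g * h) = smult (p ^ N) k"
      using lattice_orderD(4)[OF G g(1) h(1)] by blast
    have "x \<otimes>\<^bsub>K\<^esub> y = K_frac f (mod_monic f (g * h)) (p ^ (N + N))"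
      using p_nonzero by (simp add: g h K_frac_p_power_mult K_frac_mod_monic)
    also have "\<dots> = K_frac f k (p ^ N)" unfolding k(2) by (rule K_frac_cancel)
    finally show "x \<otimes>\<^bsub>K\<^esub> y \<in> order_of N G" using k(1) by (simp add: order_of_def)
  qed
  moreover have "\<forall>x\<in>order_of N G. \<exists>g. x = K_frac f g (p ^ N)"
    by (auto simp: order_of_def)
  moreover have "R_in_K f \<subseteq> order_of N G"
    using R by (auto simp: R_in_K_def)
  ultimately show ?thesis unfolding p_overorder_def by blast
qed

lemma order_of_numerators:
  assumes "\<forall>x\<in>S. \<exists>g. x = K_frac f g (p ^ N)"
  shows "order_of N (numerators N S) = S"
proof (intro equalityI subsetI)
  fix x assume x: "x \<in> S"
  then obtain g where "x = K_frac f g (p ^ N)" using assms by blast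
  then have "x = K_frac f (mod_monic f g) (p ^ N)" using p_nonzero by (simp add: K_frac_mod_monic)
  then show "x \<in> order_of N (numerators N S)"
    using x degree_mod_monic unfolding order_of_def numerators_def by blast
qed (auto simp: order_of_def numerators_def)

text \<open>A product of two elements has denominator p^(2N) at first sight; lying in
  \<open>S\<close>, it also has denominator p^N. Comparing both forms shows that gh is p^N times a
  numerator modulo \<open>f\<close>.\<close>

lemma lattice_order_numerators:
  assumes S: "subring S K" "R_in_K f \<subseteq> S" and N: "\<forall>x\<in>S. \<exists>g. x = K_frac f g (p ^ N)"
  shows "lattice_order N (numerators N S)"
  unfolding lattice_order_def
proof (intro conjI ballI allI impI)
  note sub = subringE[OF S(1)]
  show "poly_submodule (numerators N S)"
    unfolding poly_submodule_def
  proof (intro conjI ballI allI)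
    show "0 \<in> numerators N S"
      using sub(2) degree_pos p_nonzero by (simp add: numerators_def K_frac_0)
    fix g assume g: "g \<in> numerators N S"
    show "smult c g \<in> numerators N S" for c
      using sub(6)[OF R_in_order[OF S(2), of "[:c:]"], of "K_frac f g (p ^ N)"] g p_nonzero
        le_less_trans[OF degree_smult_le[of c g]]
      by (auto simp: numerators_def K_frac_scale)
    fix h assume h: "h \<in> numerators N S"
    show "g + h \<in> numerators N S"
      using sub(7)[of "K_frac f g (p ^ N)" "K_frac f h (p ^ N)"] g h p_nonzero
      by (auto simp: numerators_def K_frac_same_denominator_add degree_add_less)
  qed
  show "degree g < degree f" if "g \<in> numerators N S" for g
    using that by (simp add: numerators_def)
  show "monom (p ^ N) j \<in> numerators N S" if "j < degree f" for j
  proof -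
    have "monom (p ^ N) j = smult (p ^ N) (monom 1 j)" by (simp add: smult_monom)
    then have "K_frac f (monom (p ^ N) j) (p ^ N) = K_frac f (monom 1 j) 1"
      using K_frac_cancel[of N "monom 1 j" 0] by simp
    then show ?thesis
      using R_in_order[OF S(2)] that le_less_trans[OF degree_monom_le]
      by (simp add: numerators_def)
  qed
  fix g h assume g: "g \<in> numerators N S" and h: "h \<in> numerators N S"
  then have gh: "K_frac f (g * h) (p ^ (N + N)) \<in> S"
    using sub(6)[of "K_frac f g (p ^ N)" "K_frac f h (p ^ N)"]
    by (simp add: numerators_def K_frac_p_power_mult)
  then obtain k where k: "K_frac f (g * h) (p ^ (N + N)) = K_frac f k (p ^ N)" using N by blast
  then have "K_frac f (g * h) (p ^ (N + N)) = K_frac f (smult (p ^ N) k) (p ^ (N + N))"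
    by (simp add: K_frac_cancel)
  then have "f dvd smult (p ^ (N + N)) (g * h - smult (p ^ N) k)"
    using p_nonzero by (subst (asm) K_frac_eq_iff) (simp_all add: smult_diff_right)
  then have "f dvd g * h - smult (p ^ N) k"
    using dvd_smult_iff p_nonzero by blast
  then have "f dvd g * h - smult (p ^ N) k + smult (p ^ N) (k - mod_monic f k)"
    by (intro dvd_add dvd_smult mod_monic_dvd)
  then have "f dvd g * h - smult (p ^ N) (mod_monic f k)"
    by (simp add: smult_diff_right)
  then have "mod_monic f (g * h) = smult (p ^ N) (mod_monic f k)"
    using le_less_trans[OF degree_smult_le degree_mod_monic] by (intro mod_monic_unique)
  moreover have "mod_monic f k \<in> numerators N S"
    using degree_mod_monic gh k p_nonzero by (simp add: numerators_def K_frac_mod_monic)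
  ultimately show "mod_monic f (g * h) \<in> smult (p ^ N) ` numerators N S" by blast
qed

text \<open>The exponent N belonging to the particular order is traded for the uniform M: since p^N
  divides every coefficient of p^M g, the element g / p^N equals some k / p^M.\<close>

lemma p_overorder_bound:
  assumes "p_overorder S"
  shows "\<forall>x\<in>S. \<exists>g. x = K_frac f g (p ^ exponent_bound f)"
proof
  fix x assume x: "x \<in> S"
  let ?M = "exponent_bound f"
  from assms obtain N where N: "subring S K" "R_in_K f \<subseteq> S" "\<forall>x\<in>S. \<exists>g. x = K_frac f g (p ^ N)"
    unfolding p_overorder_def by blast
  from x obtain g where g: "g \<in> numerators N S" "x = K_frac f g (p ^ N)"
    using order_of_numerators[OF N(3)] unfolding order_of_def by blast
  have "\<forall>c. p ^ N dvd coeff (smult (p ^ ?M) g) c"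
    using lattice_order_bound[OF lattice_order_numerators[OF N] g(1)] by simp
  then have "[:p ^ N:] dvd smult (p ^ ?M) g"
    unfolding const_poly_dvd_iff .
  then obtain k where "smult (p ^ ?M) g = [:p ^ N:] * k" by (rule dvdE)
  then have "K_frac f g (p ^ N) = K_frac f k (p ^ ?M)"
    using p_nonzero by (intro K_frac_cong) auto
  then show "\<exists>g. x = K_frac f g (p ^ ?M)" using g(2) by blast
qed

lemma p_overorder_listed:
  assumes "p_overorder S"
  defines "M \<equiv> exponent_bound f"
  shows "\<exists>us\<in>set (candidates (degree f) (M * degree p)).
    order_basis f p M us \<and> S = order_of M (poly_span us)"
proof -
  have S: "subring S K" "R_in_K f \<subseteq> S" "\<forall>x\<in>S. \<exists>g. x = K_frac f g (p ^ M)"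
    using assms(1) p_overorder_bound[OF assms(1)] unfolding p_overorder_def M_def by blast+
  note G = lattice_order_numerators[OF S]
  obtain us where us: "triangular us" "length us = degree f" "poly_span us = numerators M S"
    "\<forall>g\<in>set us. degree g < degree f \<and> (\<forall>j. degree (coeff g j) \<le> M * degree p)"
    using exists_triangular_basis[OF G] by blast
  then have "us \<in> set (candidates (degree f) (M * degree p))"
    by (intro candidatesI) auto
  moreover have "order_basis f p M us"
    using order_basis_iff us G by simp
  moreover have "S = order_of M (poly_span us)"
    using order_of_numerators[OF S(3)] us(3) by simp
  ultimately show ?thesis by blast
qed

subsection \<open>Bases\<close>

lemma Span_K_frac:
  assumes "d \<noteq> 0"
  shows "ring.Span K (A_in_K f) (map (\<lambda>g. K_frac f g d) us) = (\<lambda>g. K_frac f g d) ` poly_span us"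
proof (induction us)
  case Nil
  show ?case using assms by (simp add: ring.Span.simps[OF ring_K] K_frac_0)
next
  case (Cons u us)
  have step: "K_frac f [:c:] 1 \<otimes>\<^bsub>K\<^esub> K_frac f u d \<oplus>\<^bsub>K\<^esub> K_frac f h d = K_frac f (smult c u + h) d" for c h
    using assms by (simp add: K_frac_scale K_frac_same_denominator_add)
  have mem: "x \<in> ring.Span K (A_in_K f) (map (\<lambda>g. K_frac f g d) (u # us)) \<longleftrightarrow>
      (\<exists>c. \<exists>h\<in>poly_span us. x = K_frac f [:c:] 1 \<otimes>\<^bsub>K\<^esub> K_frac f u d \<oplus>\<^bsub>K\<^esub> K_frac f h d)" for x
    using Cons
    by (auto simp: ring.Span.simps[OF ring_K] ring.line_extension_mem_iff[OF ring_K] A_in_K_def)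
  show ?case
  proof (rule Set.set_eqI)
    fix x
    show "x \<in> ring.Span K (A_in_K f) (map (\<lambda>g. K_frac f g d) (u # us))
        \<longleftrightarrow> x \<in> (\<lambda>g. K_frac f g d) ` poly_span (u # us)"
      unfolding mem step poly_span.simps by blast
  qed
qed

fun poly_combine :: "'b::comm_ring_1 list \<Rightarrow> 'b poly list \<Rightarrow> 'b poly" where
  "poly_combine (c # cs) (u # us) = smult c u + poly_combine cs us"
| "poly_combine cs us = 0"

lemma combine_K_frac:
  assumes "d \<noteq> 0" "length cs = length us"
  shows "ring.combine K (map (\<lambda>c. K_frac f [:c:] 1) cs) (map (\<lambda>g. K_frac f g d) us)
    = K_frac f (poly_combine cs us) d"
  using assms(2)
proof (induction cs us rule: list_induct2)
  case Nil
  show ?case using assms(1) by (simp add: ring.combine.simps[OF ring_K] K_frac_0)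
next
  case (Cons c cs u us)
  then show ?case
    using assms(1) by (simp add: ring.combine.simps[OF ring_K] K_frac_scale K_frac_same_denominator_add)
qed

lemma poly_combine_snoc:
  "length cs = length us \<Longrightarrow> poly_combine (cs @ [c]) (us @ [u]) = poly_combine cs us + smult c u"
  by (induction cs us rule: list_induct2) (auto simp: add.assoc)

lemma poly_combine_in_span: "poly_combine cs us \<in> poly_span us"
  by (induction cs us rule: poly_combine.induct)
    (auto intro: poly_submoduleD(1)[OF poly_submodule_poly_span, unfolded poly_span.simps] simp del: poly_span.simps
      simp: poly_span_ConsI poly_submoduleD(1)[OF poly_submodule_poly_span])

text \<open>In the highest degree only the last generator contributes, so its coefficient in a
  relation vanishes.\<close>

lemma triangular_independent:
  fixes us :: "'b::idom poly list"
  assumes "triangular us" "length cs = length us" "poly_combine cs us = 0"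
  shows "set cs \<subseteq> {0}"
  using assms
proof (induction us arbitrary: cs rule: rev_induct)
  case (snoc u us)
  then obtain cs' c where cs: "cs = cs' @ [c]" "length cs' = length us"
    by (cases cs rule: rev_cases) auto
  from snoc.prems have tri: "triangular us" "u \<noteq> 0" "degree u = length us"
    by (auto simp: triangular_snoc)
  have sum: "poly_combine cs' us + smult c u = 0"
    using snoc.prems(3) cs by (simp add: poly_combine_snoc)
  have "coeff (poly_combine cs' us) (degree u) = 0"
    using triangular_poly_span_coeff[OF tri(1) poly_combine_in_span] tri(3) by simp
  then have "c * lead_coeff u = 0"
    using arg_cong[OF sum, of "\<lambda>h. coeff h (degree u)"] by simp
  then have "c = 0" using tri(2) by simp
  then show ?case using snoc.IH[OF tri(1) cs(2)] sum cs(1) by simp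
qed simp

lemma lists_A_basis_order_of:
  assumes "triangular us" "length us = degree f"
  shows "lists_A_basis f (map (\<lambda>g. (g, p ^ N)) us) (order_of N (poly_span us))"
proof -
  let ?us = "map (\<lambda>g. K_frac f g (p ^ N)) us"
  have "is_basis K (A_in_K f) (order_of N (poly_span us)) ?us"
    unfolding is_basis_def
  proof (intro conjI allI impI)
    show "set ?us \<subseteq> carrier K" using p_nonzero by auto
    show "order_of N (poly_span us) = ring.Span K (A_in_K f) ?us"
      unfolding Span_K_frac[OF p_nonzero(2)] order_of_def ..
    fix ks assume ks: "set ks \<subseteq> A_in_K f \<and> length ks = length ?us \<and> ring.combine K ks ?us = \<zero>\<^bsub>K\<^esub>"
    then have "ks \<in> lists (range (\<lambda>a. K_frac f [:a:] 1))"
      by (auto simp: A_in_K_def)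
    then obtain cs where cs: "ks = map (\<lambda>c. K_frac f [:c:] 1) cs"
      unfolding lists_image by blast
    have len: "length cs = length us" using ks cs by simp
    have "K_frac f (poly_combine cs us) (p ^ N) = \<zero>\<^bsub>K\<^esub>"
      using ks combine_K_frac[OF p_nonzero(2) len] cs by simp
    \<comment> \<open>A relation in K is a divisibility by \<open>f\<close>; the degree bound turns
      it into a relation between polynomials.\<close>
    then have "f dvd poly_combine cs us" using p_nonzero by (simp add: K_frac_eq_0_iff)
    moreover have "degree (poly_combine cs us) < degree f"
      using triangular_poly_span_coeff[OF assms(1) poly_combine_in_span] assms(2) degree_pos
      by (intro degree_lessI) auto
    ultimately have "poly_combine cs us = 0" by (rule dvd_degree_less_eq_0)
    from triangular_independent[OF assms(1) len this]
    show "set ks \<subseteq> {\<zero>\<^bsub>K\<^esub>}" using cs K_frac_0[of 1] by auto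
  qed
  then show ?thesis
    unfolding lists_A_basis_def using p_nonzero by (simp add: comp_def)
qed

lemma p_overorder_A_overorder:
  assumes "p_overorder S"
  shows "S \<in> A_overorders f"
proof -
  have S: "subring S K" "R_in_K f \<subseteq> S" using assms by (auto simp: p_overorder_def)
  let ?M = "exponent_bound f"
  obtain us where "order_basis f p ?M us" "S = order_of ?M (poly_span us)"
    using p_overorder_listed[OF assms] by blast
  then have basis: "is_basis K (A_in_K f) S (map (\<lambda>g. K_frac f g (p ^ ?M)) us)"
    using lists_A_basis_order_of[of us ?M] order_basis_iff
    by (simp add: lists_A_basis_def comp_def)
  \<comment> \<open>The spanning list may depend on \<open>x\<close>. For x = g / d the single
    element g of R is enough.\<close>
  have "\<exists>us. set us \<subseteq> S \<and> x \<in> ring.Span K (F_in_K f) us" if "x \<in> carrier K" for x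
  proof -
    obtain g d where d: "d \<noteq> 0" "x = K_frac f g d" using \<open>x \<in> carrier K\<close> by (rule K_cases)
    have "F_to_K f (Fract 1 d) = K_frac f 1 d"
      unfolding F_to_K_Fract[OF d(1)] by (simp add: one_pCons)
    moreover have "x = K_frac f 1 d \<otimes>\<^bsub>K\<^esub> K_frac f g 1 \<oplus>\<^bsub>K\<^esub> \<zero>\<^bsub>K\<^esub>"
      using d by (simp add: K_frac_mult K_zero K_frac_add)
    ultimately have "x \<in> ring.Span K (F_in_K f) [K_frac f g 1]"
      unfolding ring.Span.simps[OF ring_K] foldr.simps comp_def id_def
        ring.line_extension_mem_iff[OF ring_K] F_in_K_def by (metis rangeI singletonI)
    then show ?thesis using R_in_order[OF S(2)] by (intro exI[of _ "[K_frac f g 1]"]) simp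
  qed
  then have "is_order K (A_in_K f) (F_in_K f) S"
    unfolding is_order_def using S basis unfolding is_basis_def by blast
  then show ?thesis using S(2) by (simp add: A_overorders_def)
qed

end

section \<open>The completion of $F$ at $\pi$\<close>

context order_setup
begin

abbreviation "P \<equiv> {b. p dvd b}"
abbreviation "V \<equiv> adic_nbhd P"

lemma ideal_power_P: "ideal_power P n = {b. p ^ n dvd b}"
proof (induction n)
  case (Suc n)
  have "p ^ Suc n dvd b" if "b \<in> ideal_prod ring_of_type_algebra P {b. p ^ n dvd b}" for b
    using that by induction (auto intro: mult_dvd_mono)
  moreover have "b \<in> ideal_prod ring_of_type_algebra P {b. p ^ n dvd b}" if "p ^ Suc n dvd b" for b
  proof -
    obtain c where c: "b = p * (p ^ n * c)" using \<open>p ^ Suc n dvd b\<close> by (auto simp: dvd_def mult.assoc)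
    show ?thesis
      unfolding c using ideal_prod.prod[of p P "p ^ n * c" "{b. p ^ n dvd b}" ring_of_type_algebra] by simp
  qed
  ultimately show ?case using Suc by auto
qed simp

lemma not_p_dvd: "\<not> p dvd 1" "\<not> p dvd b \<Longrightarrow> b \<noteq> 0" "\<not> p dvd b \<Longrightarrow> \<not> p dvd c \<Longrightarrow> \<not> p dvd b * c"
  using prime_elem_not_unit[OF prime_p] prime_elem_dvd_multD[OF prime_p] by auto

lemma V_iff: "x \<in> V n \<longleftrightarrow> (\<exists>a b. \<not> p dvd b \<and> x = Fract (p ^ n * a) b)"
  unfolding adic_nbhd_def ideal_power_P mem_Collect_eq by (metis dvdE dvd_triv_left)

lemma V_cases:
  assumes "x \<in> V n"
  obtains a b where "\<not> p dvd b" "b \<noteq> 0" "x = Fract (p ^ n * a) b"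
  using assms V_iff not_p_dvd(2) by auto

lemma V_zero: "0 \<in> V n"
proof -
  have "0 = Fract (p ^ n * 0) 1" by (simp add: Zero_fract_def)
  then show ?thesis using V_iff not_p_dvd(1) by blast
qed

lemma V_add:
  assumes "x \<in> V n" "y \<in> V n"
  shows "x + y \<in> V n"
proof -
  obtain a b c d where b: "\<not> p dvd b" "b \<noteq> 0" "x = Fract (p ^ n * a) b"
    and d: "\<not> p dvd d" "d \<noteq> 0" "y = Fract (p ^ n * c) d"
    using assms by (meson V_cases)
  have "x + y = Fract (p ^ n * (a * d + c * b)) (b * d)"
    using b d by (simp add: algebra_simps)
  then show ?thesis using V_iff not_p_dvd(3)[OF b(1) d(1)] by blast
qed

lemma V_uminus: "x \<in> V n \<Longrightarrow> - x \<in> V n"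
  by (erule V_cases) (auto simp: V_iff simp flip: mult_minus_right)

lemma V_diff: "x \<in> V n \<Longrightarrow> y \<in> V n \<Longrightarrow> x - y \<in> V n"
  using V_add[of x n "- y"] V_uminus by simp

lemma V_mult:
  assumes "x \<in> V n" "y \<in> V m"
  shows "x * y \<in> V (n + m)"
proof -
  obtain a b c d where b: "\<not> p dvd b" "b \<noteq> 0" "x = Fract (p ^ n * a) b"
    and d: "\<not> p dvd d" "d \<noteq> 0" "y = Fract (p ^ m * c) d"
    using assms by (meson V_cases)
  have "x * y = Fract (p ^ (n + m) * (a * c)) (b * d)"
    using b d by (simp add: power_add ac_simps)
  then show ?thesis using V_iff not_p_dvd(3)[OF b(1) d(1)] by blast
qed

lemma V_integral: "p ^ n dvd a \<Longrightarrow> Fract a 1 \<in> V n"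
  unfolding V_iff using not_p_dvd(1) by (metis dvdE)

lemma V_antimono: "x \<in> V n \<Longrightarrow> m \<le> n \<Longrightarrow> x \<in> V m"
  using V_mult[of "Fract 1 1" 0 x m] unfolding V_iff
  by (metis le_add_diff_inverse mult.assoc power_add)

lemma p_fract: "Fract (p ^ k) 1 \<noteq> 0" "Fract a (p ^ k) * Fract (p ^ k) 1 = Fract a 1"
  "Fract (p ^ m) 1 * Fract (p ^ k) 1 = Fract (p ^ (m + k)) 1"
  using p_nonzero by (simp_all add: Zero_fract_def eq_fract power_add mult.commute)

lemma V_scale_iff: "x * Fract (p ^ k) 1 \<in> V (n + k) \<longleftrightarrow> x \<in> V n"
proof
  assume "x * Fract (p ^ k) 1 \<in> V (n + k)"
  then obtain a b where b: "\<not> p dvd b" "b \<noteq> 0" "x * Fract (p ^ k) 1 = Fract (p ^ (n + k) * a) b"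
    by (rule V_cases)
  then have "x * Fract (p ^ k) 1 = Fract (p ^ n * a) b * Fract (p ^ k) 1"
    by (simp add: power_add ac_simps)
  then have "x = Fract (p ^ n * a) b"
    by (rule mult_right_cancel[OF p_fract(1), THEN iffD1])
  then show "x \<in> V n" using b(1) V_iff by blast
qed (intro V_mult V_integral dvd_refl)

lemma integral_V_iff: "Fract a 1 \<in> V n \<longleftrightarrow> p ^ n dvd a"
proof
  assume "Fract a 1 \<in> V n"
  then obtain c b where b: "\<not> p dvd b" "b \<noteq> 0" "Fract a 1 = Fract (p ^ n * c) b" by (rule V_cases)
  then have "a * b = p ^ n * c" by (simp add: eq_fract)
  then show "p ^ n dvd a" using p_power_dvd_cancel[OF b(1), of n a] by simp
qed (rule V_integral)

lemma fract_p_power_V_iff: "Fract a (p ^ k) \<in> V 0 \<longleftrightarrow> p ^ k dvd a"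
  using V_scale_iff[of "Fract a (p ^ k)" k 0] unfolding p_fract(2) integral_V_iff by simp

text \<open>Take for k the exponent of \<open>p\<close> in the denominator.\<close>

lemma V_bounded: "\<exists>k. x * Fract (p ^ k) 1 \<in> V 0"
proof -
  obtain a b where x: "b \<noteq> 0" "x = Fract a b" by (rule fract_cases)
  have "\<exists>k c. b = p ^ k * c \<and> \<not> p dvd c"
    using x(1)
  proof (induction "degree b" arbitrary: b rule: less_induct)
    case less
    show ?case
    proof (cases "p dvd b")
      case True
      then obtain c where c: "b = p * c" by (rule dvdE)
      then have "c \<noteq> 0" using less.prems by auto
      have "degree p > 0"
        using prime_elem_not_unit[OF prime_p] is_unit_iff_degree[OF p_nonzero(1)] by simp
      then have "degree c < degree b"
        using c \<open>c \<noteq> 0\<close> p_nonzero(1) by (simp add: degree_mult_eq)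
      from less.hyps[OF this \<open>c \<noteq> 0\<close>] obtain k d where "c = p ^ k * d" "\<not> p dvd d" by blast
      then show ?thesis
        using c by (intro exI[of _ "Suc k"] exI[of _ d]) (simp add: mult.assoc)
    qed (auto intro: exI[of _ 0])
  qed
  then obtain k c where k: "b = p ^ k * c" "\<not> p dvd c" by blast
  then have "x * Fract (p ^ k) 1 = Fract (p ^ 0 * a) c"
    using x p_nonzero by (simp add: eq_fract)
  then show ?thesis using V_iff k(2) by blast
qed

text \<open>A nonzero element of least degree in the ideal of \<open>b\<close> and \<open>p\<close>
  divides both; as \<open>p\<close> is irreducible and does not divide \<open>b\<close>, it is a
  unit. Multiplying the identity for p by the one for p^n gives the next power.\<close>

lemma bezout_p_power:
  assumes "\<not> p dvd b"
  shows "\<exists>u v. u * b + v * p ^ n = 1"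
proof (induction n)
  case (Suc n)
  define W where "W = {w. w \<noteq> 0 \<and> (\<exists>u v. w = u * b + v * p)}"
  have "p = 0 * b + 1 * p" by simp
  then have "p \<in> W" unfolding W_def using p_nonzero(1) by blast
  then obtain w where w: "w \<in> W" and min: "\<And>x. x \<in> W \<Longrightarrow> degree w \<le> degree x"
    using ex_has_least_nat[of "\<lambda>w. w \<in> W" p degree] by auto
  from w obtain u v where uv: "w = u * b + v * p" and "w \<noteq> 0" unfolding W_def by auto
  have dvd: "w dvd x" if "x = r * b + s * p" for x r s
  proof (rule ccontr)
    assume "\<not> w dvd x"
    then have ne: "x mod w \<noteq> 0" by (simp add: dvd_eq_mod_eq_0)
    have "x mod w = x - x div w * w" by (simp add: minus_div_mult_eq_mod)
    also have "\<dots> = (r - x div w * u) * b + (s - x div w * v) * p"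
      by (simp add: that uv algebra_simps)
    finally have "x mod w \<in> W" using ne unfolding W_def by blast
    then show False using min degree_mod_less[OF \<open>w \<noteq> 0\<close>, of x] ne by fastforce
  qed
  have "w dvd p" using dvd[of p 0 1] by simp
  then obtain c where c: "p = w * c" by (rule dvdE)
  have "w dvd b" using dvd[of b 1 0] by simp
  have "\<not> is_unit c"
  proof
    assume "is_unit c"
    then have "p dvd w" using c by (simp add: mult_unit_dvd_iff)
    then show False using assms \<open>w dvd b\<close> dvd_trans by blast
  qed
  with prime_elem_imp_irreducible[OF prime_p] have "is_unit w"
    using c by (auto simp: Factorial_Ring.irreducible_def)
  then obtain z where z: "1 = w * z" by (rule dvdE)
  from Suc obtain u' v' where "u' * b + v' * p ^ n = 1" by blast
  then have "1 = (u * b + v * p) * z * (u' * b + v' * p ^ n)"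
    using z uv by simp
  also have "\<dots> = (u * z * (u' * b + v' * p ^ n) + v * p * z * u') * b + (v * z * v') * p ^ Suc n"
    by (simp add: algebra_simps)
  finally show ?case by metis
qed (auto intro: exI[of _ 0] exI[of _ 1])

text \<open>A is dense in the local ring at \<open>p\<close>: the denominator b is exchanged for a
  factor u that is inverse to it modulo p^n.\<close>

lemma V_approx:
  assumes "x \<in> V 0"
  shows "\<exists>a. x - Fract a 1 \<in> V n"
proof -
  obtain a b where b: "\<not> p dvd b" "b \<noteq> 0" "x = Fract a b"
    using assms by (auto elim: V_cases)
  obtain u v where uv: "u * b + v * p ^ n = 1" using bezout_p_power[OF b(1)] by blast
  have "a - a * u * b = a * (1 - u * b)" by (simp add: algebra_simps)
  also have "1 - u * b = v * p ^ n" using uv by (simp add: algebra_simps)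
  finally have "x - Fract (a * u) 1 = Fract (p ^ n * (a * v)) b"
    using b by (simp add: ac_simps)
  then show ?thesis using b(1) V_iff by blast
qed

subsection \<open>Cauchy sequences\<close>

lemma null_iff: "s \<in> adic_null P \<longleftrightarrow> (\<forall>n. \<forall>\<^sub>F i in sequentially. s i \<in> V n)"
  by (simp add: adic_null_def eventually_sequentially)

text \<open>The neighbourhoods are groups, so it suffices to be eventually close to one constant for
  each precision. This form has a single index and suits \<open>eventually\<close>.\<close>

lemma Cauchy_iff: "adic_Cauchy P s \<longleftrightarrow> (\<forall>n. \<exists>c. \<forall>\<^sub>F i in sequentially. s i - c \<in> V n)"
proof
  assume "adic_Cauchy P s"
  then show "\<forall>n. \<exists>c. \<forall>\<^sub>F i in sequentially. s i - c \<in> V n"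
    unfolding adic_Cauchy_def eventually_sequentially by (meson order_refl)
next
  assume c: "\<forall>n. \<exists>c. \<forall>\<^sub>F i in sequentially. s i - c \<in> V n"
  show "adic_Cauchy P s"
    unfolding adic_Cauchy_def
  proof
    fix n
    obtain c N where "\<And>i. i \<ge> N \<Longrightarrow> s i - c \<in> V n"
      using c unfolding eventually_sequentially by meson
    then have "s i - s j \<in> V n" if "i \<ge> N" "j \<ge> N" for i j
      using V_diff[of "s i - c" n "s j - c"] that by simp
    then show "\<exists>N. \<forall>i\<ge>N. \<forall>j\<ge>N. s i - s j \<in> V n" by blast
  qed
qed

lemma Cauchy_const: "adic_Cauchy P (\<lambda>i. r)"
  unfolding Cauchy_iff using V_zero by (auto intro!: exI[of _ r])

lemma Cauchy_add:
  assumes "adic_Cauchy P s" "adic_Cauchy P t"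
  shows "adic_Cauchy P (\<lambda>i. s i + t i)"
  unfolding Cauchy_iff
proof
  fix n
  obtain c d where "\<forall>\<^sub>F i in sequentially. s i - c \<in> V n" "\<forall>\<^sub>F i in sequentially. t i - d \<in> V n"
    using assms unfolding Cauchy_iff by meson
  then have "\<forall>\<^sub>F i in sequentially. (s i + t i) - (c + d) \<in> V n"
    by eventually_elim (use V_add in \<open>fastforce simp: add_diff_add\<close>)
  then show "\<exists>c. \<forall>\<^sub>F i in sequentially. (s i + t i) - c \<in> V n" by blast
qed

lemma Cauchy_bounded:
  assumes "adic_Cauchy P s"
  shows "\<exists>k. \<forall>\<^sub>F i in sequentially. s i * Fract (p ^ k) 1 \<in> V 0"
proof -
  obtain c where c: "\<forall>\<^sub>F i in sequentially. s i - c \<in> V 0"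
    using assms unfolding Cauchy_iff by blast
  obtain k where k: "c * Fract (p ^ k) 1 \<in> V 0" using V_bounded by blast
  have "x * Fract (p ^ k) 1 \<in> V 0" if "x - c \<in> V 0" for x
  proof -
    have "(x - c) * Fract (p ^ k) 1 \<in> V (0 + 0)"
      using that by (rule V_mult) (rule V_integral, simp)
    then show ?thesis using V_add[OF _ k, of "(x - c) * Fract (p ^ k) 1"] by (simp add: algebra_simps)
  qed
  then show ?thesis using c eventually_mono by (metis (no_types, lifting))
qed

lemma V_mult_bounded:
  assumes "x * Fract (p ^ k) 1 \<in> V 0" "y \<in> V (n + k)"
  shows "x * y \<in> V n"
proof -
  have "(x * Fract (p ^ k) 1) * y \<in> V (0 + (n + k))" by (rule V_mult[OF assms])
  then show ?thesis using V_scale_iff[of "x * y" k n] by (simp add: ac_simps)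
qed

lemma null_mult:
  assumes "s \<in> adic_null P" "adic_Cauchy P t"
  shows "(\<lambda>i. t i * s i) \<in> adic_null P"
  unfolding null_iff
proof
  fix n
  obtain k where "\<forall>\<^sub>F i in sequentially. t i * Fract (p ^ k) 1 \<in> V 0"
    using Cauchy_bounded[OF assms(2)] by blast
  moreover have "\<forall>\<^sub>F i in sequentially. s i \<in> V (n + k)" using assms(1) null_iff by blast
  ultimately show "\<forall>\<^sub>F i in sequentially. t i * s i \<in> V n"
    by eventually_elim (rule V_mult_bounded)
qed

lemma Cauchy_mult:
  assumes "adic_Cauchy P s" "adic_Cauchy P t"
  shows "adic_Cauchy P (\<lambda>i. s i * t i)"
  unfolding Cauchy_iff
proof
  fix n
  obtain k where k: "\<forall>\<^sub>F i in sequentially. s i * Fract (p ^ k) 1 \<in> V 0"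
    using Cauchy_bounded[OF assms(1)] by blast
  obtain d where d: "\<forall>\<^sub>F i in sequentially. t i - d \<in> V (n + k)"
    using assms(2) unfolding Cauchy_iff by blast
  \<comment> \<open>\<open>d\<close> approximates \<open>t\<close> to a precision set by the bound
    on \<open>s\<close>, and \<open>c\<close> approximates \<open>s\<close> to a precision set by
    the bound on \<open>d\<close>, as needed for st - cd = s(t - d) + d(s - c).\<close>
  obtain k' where k': "d * Fract (p ^ k') 1 \<in> V 0" using V_bounded by blast
  obtain c where c: "\<forall>\<^sub>F i in sequentially. s i - c \<in> V (n + k')"
    using assms(1) unfolding Cauchy_iff by blast
  from k d c have "\<forall>\<^sub>F i in sequentially. s i * t i - c * d \<in> V n"
  proof eventually_elim
    case (elim i)
    have "s i * (t i - d) + d * (s i - c) \<in> V n"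
      by (intro V_add V_mult_bounded[OF elim(1,2)] V_mult_bounded[OF k' elim(3)])
    then show ?case by (simp add: algebra_simps)
  qed
  then show "\<exists>c. \<forall>\<^sub>F i in sequentially. s i * t i - c \<in> V n" by blast
qed

lemma Cauchy_uminus: "adic_Cauchy P s \<Longrightarrow> adic_Cauchy P (\<lambda>i. - s i)"
  using Cauchy_mult[OF Cauchy_const[of "- 1"]] by fastforce

lemma Cauchy_diff: "adic_Cauchy P s \<Longrightarrow> adic_Cauchy P t \<Longrightarrow> adic_Cauchy P (\<lambda>i. s i - t i)"
  using Cauchy_add[OF _ Cauchy_uminus, of s t] by simp

lemma null_Cauchy: "s \<in> adic_null P \<Longrightarrow> adic_Cauchy P s"
  unfolding null_iff Cauchy_iff by (auto intro!: exI[of _ 0])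

lemma nullD: "s \<in> adic_null P \<Longrightarrow> \<forall>\<^sub>F i in sequentially. s i \<in> V n"
  by (simp add: null_iff)

lemma null_add:
  assumes "s \<in> adic_null P" "t \<in> adic_null P"
  shows "(\<lambda>i. s i + t i) \<in> adic_null P"
  unfolding null_iff
proof
  fix n
  from nullD[OF assms(1)] nullD[OF assms(2)] show "\<forall>\<^sub>F i in sequentially. s i + t i \<in> V n"
    by eventually_elim (rule V_add)
qed

lemma null_uminus:
  assumes "s \<in> adic_null P"
  shows "(\<lambda>i. - s i) \<in> adic_null P"
  unfolding null_iff
proof
  fix n
  from nullD[OF assms] show "\<forall>\<^sub>F i in sequentially. - s i \<in> V n"
    by eventually_elim (rule V_uminus)
qed

lemma null_zero: "(\<lambda>i. 0) \<in> adic_null P"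
  unfolding null_iff using V_zero by simp

lemma null_diff: "s \<in> adic_null P \<Longrightarrow> t \<in> adic_null P \<Longrightarrow> (\<lambda>i. s i - t i) \<in> adic_null P"
  using null_add[OF _ null_uminus, of s t] by simp

lemma Cauchy_ring_simps [simp]:
  "carrier (Cauchy_ring P) = {s. adic_Cauchy P s}"
  "s \<otimes>\<^bsub>Cauchy_ring P\<^esub> t = (\<lambda>i. s i * t i)" "s \<oplus>\<^bsub>Cauchy_ring P\<^esub> t = (\<lambda>i. s i + t i)"
  "\<one>\<^bsub>Cauchy_ring P\<^esub> = (\<lambda>i. 1)" "\<zero>\<^bsub>Cauchy_ring P\<^esub> = (\<lambda>i. 0)"
  by (simp_all add: Cauchy_ring_def)

lemma cring_Cauchy_ring: "cring (Cauchy_ring P)"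
proof (rule cringI)
  show "abelian_group (Cauchy_ring P)"
  proof (rule abelian_groupI)
    fix s assume "s \<in> carrier (Cauchy_ring P)"
    then show "\<exists>t\<in>carrier (Cauchy_ring P). t \<oplus>\<^bsub>Cauchy_ring P\<^esub> s = \<zero>\<^bsub>Cauchy_ring P\<^esub>"
      using Cauchy_uminus[of s] by (intro bexI[of _ "\<lambda>i. - s i"]) auto
  qed (auto intro: Cauchy_add Cauchy_const simp: ac_simps)
  show "Group.comm_monoid (Cauchy_ring P)"
    by (rule comm_monoidI) (auto intro: Cauchy_mult Cauchy_const simp: ac_simps)
qed (simp add: distrib_right)

lemma ideal_null: "ideal (adic_null P) (Cauchy_ring P)"
proof (rule idealI)
  show ring: "ring (Cauchy_ring P)" using cring_Cauchy_ring by (rule cring.axioms)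
  have ag: "abelian_group (Cauchy_ring P)" by (rule ring.is_abelian_group[OF ring])
  show "subgroup (adic_null P) (add_monoid (Cauchy_ring P))"
  proof (rule group.subgroupI[OF abelian_group.a_group[OF ag]])
    fix s assume s: "s \<in> adic_null P"
    have "\<ominus>\<^bsub>Cauchy_ring P\<^esub> s = (\<lambda>i. - s i)"
      using s null_Cauchy Cauchy_uminus
      by (intro abelian_group.minus_equality[OF ag]) auto
    then show "inv\<^bsub>add_monoid (Cauchy_ring P)\<^esub> s \<in> adic_null P"
      using null_uminus[OF s] by (simp add: a_inv_def)
  qed (use null_Cauchy null_add null_zero in auto)
qed (use null_mult in \<open>auto simp: mult.commute\<close>)

lemma Cauchy_class_eq: "Cauchy_class P s = {t. (\<lambda>i. t i - s i) \<in> adic_null P}"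
proof -
  have "t \<in> (\<Union>h\<in>adic_null P. {\<lambda>i. h i + s i}) \<longleftrightarrow> (\<lambda>i. t i - s i) \<in> adic_null P" for t
    by (auto intro!: bexI[of _ "\<lambda>i. t i - s i"])
  then show ?thesis
    by (auto simp: Cauchy_class_def a_r_coset_def')
qed

lemma Cauchy_class_eq_iff: "Cauchy_class P s = Cauchy_class P t \<longleftrightarrow> (\<lambda>i. s i - t i) \<in> adic_null P"
proof
  assume "Cauchy_class P s = Cauchy_class P t"
  moreover have "s \<in> Cauchy_class P s" using null_zero by (simp add: Cauchy_class_eq)
  ultimately show "(\<lambda>i. s i - t i) \<in> adic_null P" by (simp add: Cauchy_class_eq)
next
  assume st: "(\<lambda>i. s i - t i) \<in> adic_null P"
  have "(\<lambda>i. u i - s i) \<in> adic_null P \<longleftrightarrow> (\<lambda>i. u i - t i) \<in> adic_null P" for u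
    using null_add[OF _ st, of "\<lambda>i. u i - s i"] null_diff[OF _ st, of "\<lambda>i. u i - t i"] by auto
  then show "Cauchy_class P s = Cauchy_class P t" by (simp add: Cauchy_class_eq)
qed

abbreviation "FP \<equiv> completion_field P"

lemma FP_simps:
  "carrier FP = Cauchy_class P ` {s. adic_Cauchy P s}"
  "adic_Cauchy P s \<Longrightarrow> adic_Cauchy P t
    \<Longrightarrow> Cauchy_class P s \<otimes>\<^bsub>FP\<^esub> Cauchy_class P t = Cauchy_class P (\<lambda>i. s i * t i)"
  "adic_Cauchy P s \<Longrightarrow> adic_Cauchy P t
    \<Longrightarrow> Cauchy_class P s \<oplus>\<^bsub>FP\<^esub> Cauchy_class P t = Cauchy_class P (\<lambda>i. s i + t i)"
  "\<one>\<^bsub>FP\<^esub> = Cauchy_class P (\<lambda>i. 1)" "\<zero>\<^bsub>FP\<^esub> = Cauchy_class P (\<lambda>i. 0)"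
  "cring FP"
proof -
  note hom = ideal.rcos_ring_hom[OF ideal_null]
  show "carrier FP = Cauchy_class P ` {s. adic_Cauchy P s}"
    by (auto simp: completion_field_def FactRing_def A_RCOSETS_def' Cauchy_class_def)
  show "Cauchy_class P s \<otimes>\<^bsub>FP\<^esub> Cauchy_class P t = Cauchy_class P (\<lambda>i. s i * t i)"
    "Cauchy_class P s \<oplus>\<^bsub>FP\<^esub> Cauchy_class P t = Cauchy_class P (\<lambda>i. s i + t i)"
    if "adic_Cauchy P s" "adic_Cauchy P t"
    using ring_hom_mult[OF hom, of s t] ring_hom_add[OF hom, of s t] that
    by (simp_all add: completion_field_def Cauchy_class_def)
  show "\<one>\<^bsub>FP\<^esub> = Cauchy_class P (\<lambda>i. 1)"
    by (simp add: completion_field_def FactRing_def Cauchy_class_def)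
  show "\<zero>\<^bsub>FP\<^esub> = Cauchy_class P (\<lambda>i. 0)"
    by (simp add: completion_field_def FactRing_def Cauchy_class_eq)
  show "cring FP"
    unfolding completion_field_def by (rule ideal.quotient_is_cring[OF ideal_null cring_Cauchy_ring])
qed

lemma FP_cases:
  assumes "c \<in> carrier FP"
  obtains s where "adic_Cauchy P s" "c = Cauchy_class P s"
  using assms by (auto simp: FP_simps)

abbreviation "\<iota> \<equiv> to_completion P"
abbreviation "AP \<equiv> completion_integers P"

lemma \<iota>_simps:
  "\<iota> r \<in> carrier FP" "\<iota> (r + s) = \<iota> r \<oplus>\<^bsub>FP\<^esub> \<iota> s" "\<iota> (r * s) = \<iota> r \<otimes>\<^bsub>FP\<^esub> \<iota> s"
  "\<iota> 1 = \<one>\<^bsub>FP\<^esub>" "\<iota> 0 = \<zero>\<^bsub>FP\<^esub>"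
  by (simp_all add: to_completion_def FP_simps Cauchy_const)

lemma AP_cases:
  assumes "c \<in> AP"
  obtains a where "adic_Cauchy P (\<lambda>i. Fract (a i) 1)" "c = Cauchy_class P (\<lambda>i. Fract (a i) 1)"
  using assms by (auto simp: completion_integers_def)

lemma AP_I: "adic_Cauchy P (\<lambda>i. Fract (a i) 1) \<Longrightarrow> Cauchy_class P (\<lambda>i. Fract (a i) 1) \<in> AP"
  by (auto simp: completion_integers_def)

lemma AP_carrier: "AP \<subseteq> carrier FP"
  by (auto simp: completion_integers_def FP_simps)

lemma \<iota>_integral: "\<iota> (Fract a 1) \<in> AP"
  unfolding to_completion_def by (rule AP_I) (rule Cauchy_const)

lemma AP_closed:
  assumes "c \<in> AP" "d \<in> AP"
  shows "c \<oplus>\<^bsub>FP\<^esub> d \<in> AP" "c \<otimes>\<^bsub>FP\<^esub> d \<in> AP"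
proof -
  obtain a where a: "adic_Cauchy P (\<lambda>i. Fract (a i) 1)" "c = Cauchy_class P (\<lambda>i. Fract (a i) 1)"
    using assms(1) by (rule AP_cases)
  obtain b where b: "adic_Cauchy P (\<lambda>i. Fract (b i) 1)" "d = Cauchy_class P (\<lambda>i. Fract (b i) 1)"
    using assms(2) by (rule AP_cases)
  show "c \<oplus>\<^bsub>FP\<^esub> d \<in> AP"
    using AP_I[of "\<lambda>i. a i + b i"] Cauchy_add[OF a(1) b(1)] a b by (simp add: FP_simps)
  show "c \<otimes>\<^bsub>FP\<^esub> d \<in> AP"
    using AP_I[of "\<lambda>i. a i * b i"] Cauchy_mult[OF a(1) b(1)] a b by (simp add: FP_simps)
qed

text \<open>F_P = A[1/p] + A_P. A constant close to the sequence supplies the polar part a / p^k;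
  what remains is eventually integral at \<open>p\<close> and is replaced term by term by elements
  of A.\<close>

lemma FP_decompose:
  assumes "c \<in> carrier FP"
  shows "\<exists>a k. \<exists>z\<in>AP. c = \<iota> (Fract a (p ^ k)) \<oplus>\<^bsub>FP\<^esub> z"
proof -
  obtain s where s: "adic_Cauchy P s" "c = Cauchy_class P s" using assms by (rule FP_cases)
  obtain d where d: "\<forall>\<^sub>F i in sequentially. s i - d \<in> V 0"
    using s(1) unfolding Cauchy_iff by blast
  obtain k where "d * Fract (p ^ k) 1 \<in> V 0" using V_bounded by blast
  then obtain a where a: "d * Fract (p ^ k) 1 - Fract a 1 \<in> V (0 + k)" using V_approx by fastforce
  have "(d - Fract a (p ^ k)) * Fract (p ^ k) 1 \<in> V (0 + k)"
    unfolding left_diff_distrib p_fract(2) by (rule a)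
  then have da: "d - Fract a (p ^ k) \<in> V 0" unfolding V_scale_iff .
  define u where "u i = s i - Fract a (p ^ k)" for i
  have u: "adic_Cauchy P u" unfolding u_def by (intro Cauchy_diff s Cauchy_const)
  have uV: "\<forall>\<^sub>F i in sequentially. u i \<in> V 0"
    using d
  proof eventually_elim
    case (elim i)
    from V_add[OF this da] show ?case by (simp only: u_def add_diff_eq diff_add_cancel)
  qed
  \<comment> \<open>The precision grows with i, so the error is a null sequence. Terms outside
    \<open>V 0\<close>, of which there are finitely many, get arbitrary values.\<close>
  define b where "b i = (SOME a. u i - Fract a 1 \<in> V i)" for i
  have b: "u i - Fract (b i) 1 \<in> V i" if "u i \<in> V 0" for i
    unfolding b_def by (rule someI_ex[OF V_approx[OF that]])
  have null: "(\<lambda>i. u i - Fract (b i) 1) \<in> adic_null P"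
    unfolding null_iff
  proof
    fix n
    show "\<forall>\<^sub>F i in sequentially. u i - Fract (b i) 1 \<in> V n"
      using uV eventually_ge_at_top[of n]
    proof eventually_elim
      case (elim i)
      show ?case by (rule V_antimono[OF b[OF elim(1)] elim(2)])
    qed
  qed
  have bC: "adic_Cauchy P (\<lambda>i. Fract (b i) 1)"
    using Cauchy_diff[OF u null_Cauchy[OF null]] by simp
  have "c = Cauchy_class P (\<lambda>i. Fract a (p ^ k) + Fract (b i) 1)"
    unfolding s(2) Cauchy_class_eq_iff using null by (simp only: u_def diff_diff_eq)
  also have "\<dots> = \<iota> (Fract a (p ^ k)) \<oplus>\<^bsub>FP\<^esub> Cauchy_class P (\<lambda>i. Fract (b i) 1)"
    unfolding to_completion_def by (rule FP_simps(3)[symmetric, OF Cauchy_const bC])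
  finally show ?thesis using AP_I[OF bC] by blast
qed

text \<open>A_P = A + p^m A_P: the first summand is a term of the sequence from which on it is
  constant modulo p^m.\<close>

lemma AP_decompose:
  assumes "c \<in> AP"
  shows "\<exists>a. \<exists>z\<in>AP. c = \<iota> (Fract a 1) \<oplus>\<^bsub>FP\<^esub> \<iota> (Fract (p ^ m) 1) \<otimes>\<^bsub>FP\<^esub> z"
proof -
  obtain a where a: "adic_Cauchy P (\<lambda>i. Fract (a i) 1)" "c = Cauchy_class P (\<lambda>i. Fract (a i) 1)"
    using assms by (rule AP_cases)
  obtain N where N: "\<And>i j. i \<ge> N \<Longrightarrow> j \<ge> N \<Longrightarrow> Fract (a i) 1 - Fract (a j) 1 \<in> V m"
    using a(1) unfolding adic_Cauchy_def by meson
  \<comment> \<open>The division is exact from index \<open>N\<close> on; the earlier values do not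
    affect the class.\<close>
  define b where "b i = (a i - a N) div p ^ m" for i
  have b: "Fract (b i) 1 * Fract (p ^ m) 1 = Fract (a i) 1 - Fract (a N) 1" if "i \<ge> N" for i
  proof -
    have "p ^ m dvd a i - a N" using N[OF that order_refl] by (simp add: integral_V_iff)
    then show ?thesis by (simp add: b_def)
  qed
  have bC: "adic_Cauchy P (\<lambda>i. Fract (b i) 1)"
    unfolding adic_Cauchy_def
  proof
    fix n
    obtain N' where N': "\<And>i j. i \<ge> N' \<Longrightarrow> j \<ge> N' \<Longrightarrow> Fract (a i) 1 - Fract (a j) 1 \<in> V (n + m)"
      using a(1) unfolding adic_Cauchy_def by meson
    have "Fract (b i) 1 - Fract (b j) 1 \<in> V n" if "i \<ge> max N N'" "j \<ge> max N N'" for i j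
    proof -
      have ij: "i \<ge> N" "j \<ge> N" "i \<ge> N'" "j \<ge> N'" using that by simp_all
      have "(Fract (b i) 1 - Fract (b j) 1) * Fract (p ^ m) 1 = Fract (a i) 1 - Fract (a j) 1"
        unfolding left_diff_distrib b[OF ij(1)] b[OF ij(2)] by (simp only: diff_diff_eq2 diff_add_cancel)
      then have "(Fract (b i) 1 - Fract (b j) 1) * Fract (p ^ m) 1 \<in> V (n + m)"
        using N'[OF ij(3,4)] by (simp only:)
      then show ?thesis unfolding V_scale_iff .
    qed
    then show "\<exists>N. \<forall>i\<ge>N. \<forall>j\<ge>N. Fract (b i) 1 - Fract (b j) 1 \<in> V n" by blast
  qed
  have "\<forall>\<^sub>F i in sequentially. Fract (a i) 1 - (Fract (a N) 1 + Fract (p ^ m) 1 * Fract (b i) 1) = 0"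
    using eventually_ge_at_top[of N]
  proof eventually_elim
    case (elim i)
    have "x - (y + (x - y)) = 0" for x y :: "'a poly fract" by simp
    then show ?case unfolding mult.commute[of "Fract (p ^ m) 1"] b[OF elim] .
  qed
  then have "(\<lambda>i. Fract (a i) 1 - (Fract (a N) 1 + Fract (p ^ m) 1 * Fract (b i) 1)) \<in> adic_null P"
    unfolding null_iff by (auto elim!: eventually_mono simp: V_zero simp del: mult_fract add_fract diff_fract)
  then have "c = Cauchy_class P (\<lambda>i. Fract (a N) 1 + Fract (p ^ m) 1 * Fract (b i) 1)"
    unfolding a(2) Cauchy_class_eq_iff .
  also have "\<dots> = \<iota> (Fract (a N) 1) \<oplus>\<^bsub>FP\<^esub> \<iota> (Fract (p ^ m) 1) \<otimes>\<^bsub>FP\<^esub> Cauchy_class P (\<lambda>i. Fract (b i) 1)"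
    using bC Cauchy_mult[OF Cauchy_const bC] by (simp only: to_completion_def FP_simps Cauchy_const)
  finally show ?thesis using AP_I[OF bC] by blast
qed

text \<open>A[1/p] meets A_P in A: a fraction in A_P differs from some element of A by an element of
  \<open>V 0\<close>, hence has no pole at \<open>p\<close>.\<close>

lemma \<iota>_AP_iff: "\<iota> (Fract a (p ^ k)) \<in> AP \<longleftrightarrow> p ^ k dvd a"
proof
  assume "\<iota> (Fract a (p ^ k)) \<in> AP"
  then obtain b where b: "\<iota> (Fract a (p ^ k)) = Cauchy_class P (\<lambda>i. Fract (b i) 1)"
    by (rule AP_cases)
  then have "(\<lambda>i. Fract a (p ^ k) - Fract (b i) 1) \<in> adic_null P"
    unfolding to_completion_def Cauchy_class_eq_iff .
  then obtain i where "Fract a (p ^ k) - Fract (b i) 1 \<in> V 0"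
    unfolding null_iff eventually_sequentially by blast
  from V_add[OF this V_integral[of 0 "b i"]] show "p ^ k dvd a"
    by (simp add: fract_p_power_V_iff)
next
  assume "p ^ k dvd a"
  then obtain b where "a = p ^ k * b" by (rule dvdE)
  then have "Fract a (p ^ k) = Fract b 1" using p_nonzero by (simp add: eq_fract)
  then show "\<iota> (Fract a (p ^ k)) \<in> AP" by (simp add: \<iota>_integral)
qed

end

section \<open>Monoid rings\<close>

text \<open>An element of \<open>\<int>[M]\<close> is determined by its pairings with functions on \<open>M\<close>, which turns
  convolution into an iterated sum.\<close>

definition pairing :: "('m \<Rightarrow> int) \<Rightarrow> ('m \<Rightarrow> 'r::comm_ring_1) \<Rightarrow> 'r" where
  "pairing g \<phi> = (\<Sum>u | g u \<noteq> 0. of_int (g u) * \<phi> u)"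

lemma pairing_superset:
  assumes "finite U" "{u. g u \<noteq> 0} \<subseteq> U"
  shows "pairing g \<phi> = (\<Sum>u\<in>U. of_int (g u) * \<phi> u)"
  unfolding pairing_def using assms by (intro sum.mono_neutral_left) auto

lemma pairing_delta [simp]: "pairing (delta u) \<phi> = \<phi> u"
  by (subst pairing_superset[of "{u}"]) (auto simp: delta_def)

lemma pairing_cong:
  "g = h \<Longrightarrow> (\<And>u. h u \<noteq> 0 \<Longrightarrow> \<phi> u = \<psi> u) \<Longrightarrow> pairing g \<phi> = pairing h \<psi>"
  unfolding pairing_def by (intro sum.cong) auto

lemma pairing_add:
  assumes "finite {u. g u \<noteq> 0}" "finite {u. h u \<noteq> 0}"
  shows "pairing (\<lambda>m. g m + h m) \<phi> = pairing g \<phi> + pairing h \<phi>"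
proof -
  let ?U = "{u. g u \<noteq> 0} \<union> {u. h u \<noteq> 0}"
  have U: "finite ?U" using assms by simp
  have g: "pairing g \<phi> = (\<Sum>u\<in>?U. of_int (g u) * \<phi> u)"
    by (rule pairing_superset[OF U]) blast
  have h: "pairing h \<phi> = (\<Sum>u\<in>?U. of_int (h u) * \<phi> u)"
    by (rule pairing_superset[OF U]) blast
  have gh: "pairing (\<lambda>m. g m + h m) \<phi> = (\<Sum>u\<in>?U. of_int (g u + h u) * \<phi> u)"
    by (rule pairing_superset[OF U]) auto
  show ?thesis unfolding g h gh by (simp add: sum.distrib distrib_right)
qed

lemma pairing_uminus: "pairing (\<lambda>m. - g m) \<phi> = - pairing g \<phi>"
  by (simp add: pairing_def sum_negf)

lemma pairing_diff:
  assumes "finite {u. g u \<noteq> 0}" "finite {u. h u \<noteq> 0}"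
  shows "pairing (\<lambda>m. g m - h m) \<phi> = pairing g \<phi> - pairing h \<phi>"
  using pairing_add[of g "\<lambda>m. - h m" \<phi>] assms by (simp add: pairing_uminus)

lemma pairing_indicator:
  fixes g :: "'m \<Rightarrow> int"
  assumes "finite {u. g u \<noteq> 0}"
  shows "pairing g (\<lambda>u. if u = m then 1 else 0) = g m"
  using pairing_superset[of "insert m {u. g u \<noteq> 0}" g "\<lambda>u. if u = m then 1 else 0 :: int"] assms
  by (auto simp: if_distrib cong: if_cong)

text \<open>Pairing with the indicator function of a point gives the coefficient at that
  point.\<close>

lemma pairing_ext:
  fixes g h :: "'m \<Rightarrow> int"
  assumes "finite {u. g u \<noteq> 0}" "finite {u. h u \<noteq> 0}"
    and "\<And>\<phi> :: 'm \<Rightarrow> int. pairing g \<phi> = pairing h \<phi>"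
  shows "g = h"
  using pairing_indicator[OF assms(1)] pairing_indicator[OF assms(2)] assms(3) by (metis ext)

context Group.comm_monoid
begin

lemma monoid_ring_simps [simp]:
  "carrier (monoid_ring G) = {g. finite {m. g m \<noteq> 0} \<and> {m. g m \<noteq> 0} \<subseteq> carrier G}"
  "\<one>\<^bsub>monoid_ring G\<^esub> = delta \<one>" "\<zero>\<^bsub>monoid_ring G\<^esub> = (\<lambda>m. 0)"
  "g \<oplus>\<^bsub>monoid_ring G\<^esub> h = (\<lambda>m. g m + h m)"
  by (simp_all add: monoid_ring_def delta_def)

lemma monoid_ring_mult:
  assumes g: "finite {m. g m \<noteq> 0}" and h: "finite {m. h m \<noteq> 0}"
  shows "finite {m. (g \<otimes>\<^bsub>monoid_ring G\<^esub> h) m \<noteq> 0}"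
    "{m. (g \<otimes>\<^bsub>monoid_ring G\<^esub> h) m \<noteq> 0} \<subseteq> (\<lambda>(u, v). u \<otimes> v) ` ({m. g m \<noteq> 0} \<times> {m. h m \<noteq> 0})"
    "pairing (g \<otimes>\<^bsub>monoid_ring G\<^esub> h) \<phi> = pairing g (\<lambda>u. pairing h (\<lambda>v. \<phi> (u \<otimes> v)))"
proof -
  let ?U = "{m. g m \<noteq> 0}" and ?W = "{m. h m \<noteq> 0}"
  let ?T = "(\<lambda>(u, v). u \<otimes> v) ` (?U \<times> ?W)"
  have val: "(g \<otimes>\<^bsub>monoid_ring G\<^esub> h) m = (\<Sum>z\<in>?U \<times> ?W. if fst z \<otimes> snd z = m then g (fst z) * h (snd z) else 0)" for m
  proof -
    have "{(u, v). g u \<noteq> 0 \<and> h v \<noteq> 0 \<and> u \<otimes> v = m} = {z \<in> ?U \<times> ?W. fst z \<otimes> snd z = m}"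
      by auto
    then show ?thesis
      using g h by (simp add: monoid_ring_def case_prod_unfold sum.If_cases Int_def conj_commute)
  qed
  show sub: "{m. (g \<otimes>\<^bsub>monoid_ring G\<^esub> h) m \<noteq> 0} \<subseteq> ?T"
  proof
    fix m assume "m \<in> {m. (g \<otimes>\<^bsub>monoid_ring G\<^esub> h) m \<noteq> 0}"
    then have "(\<Sum>z\<in>?U \<times> ?W. if fst z \<otimes> snd z = m then g (fst z) * h (snd z) else 0) \<noteq> 0"
      by (simp add: val)
    then obtain z where z: "z \<in> ?U \<times> ?W"
        "(if fst z \<otimes> snd z = m then g (fst z) * h (snd z) else 0) \<noteq> 0"
      by (rule sum.not_neutral_contains_not_neutral)
    then have "m = (case z of (u, v) \<Rightarrow> u \<otimes> v)" by (auto split: if_splits)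
    then show "m \<in> ?T" using z(1) by (rule image_eqI)
  qed
  have T: "finite ?T" using g h by simp
  then show "finite {m. (g \<otimes>\<^bsub>monoid_ring G\<^esub> h) m \<noteq> 0}"
    using sub by (rule finite_subset[rotated])
  have "pairing (g \<otimes>\<^bsub>monoid_ring G\<^esub> h) \<phi> = (\<Sum>m\<in>?T. \<Sum>z\<in>?U \<times> ?W.
      if fst z \<otimes> snd z = m then of_int (g (fst z)) * of_int (h (snd z)) * \<phi> m else 0)"
    unfolding pairing_superset[OF T sub] val of_int_sum sum_distrib_right
    by (intro sum.cong refl) auto
  also have "\<dots> = (\<Sum>z\<in>?U \<times> ?W. \<Sum>m\<in>?T.
      if fst z \<otimes> snd z = m then of_int (g (fst z)) * of_int (h (snd z)) * \<phi> m else 0)"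
    by (rule sum.swap)
  also have "\<dots> = (\<Sum>z\<in>?U \<times> ?W. of_int (g (fst z)) * of_int (h (snd z)) * \<phi> (fst z \<otimes> snd z))"
    using T by (intro sum.cong refl) (auto simp: sum.delta)
  also have "\<dots> = pairing g (\<lambda>u. pairing h (\<lambda>v. \<phi> (u \<otimes> v)))"
    by (simp add: pairing_def sum.cartesian_product case_prod_unfold sum_distrib_left mult.assoc)
  finally show "pairing (g \<otimes>\<^bsub>monoid_ring G\<^esub> h) \<phi> = pairing g (\<lambda>u. pairing h (\<lambda>v. \<phi> (u \<otimes> v)))" .
qed

lemma monoid_ring_mult_closed:
  assumes "g \<in> carrier (monoid_ring G)" "h \<in> carrier (monoid_ring G)"
  shows "g \<otimes>\<^bsub>monoid_ring G\<^esub> h \<in> carrier (monoid_ring G)"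
proof -
  have "(\<lambda>(u, v). u \<otimes> v) ` ({m. g m \<noteq> 0} \<times> {m. h m \<noteq> 0}) \<subseteq> carrier G"
    using assms by auto
  then show ?thesis
    using monoid_ring_mult(1,2)[of g h] assms by (simp del: monoid_ring_simps(2-))
qed

lemma delta_carrier [simp]: "u \<in> carrier G \<Longrightarrow> delta u \<in> carrier (monoid_ring G)"
  by (simp add: delta_def)

lemma finite_delta [simp]: "finite {m. delta u m \<noteq> 0}"
  by (simp add: delta_def)

lemma delta_mult: "delta u \<otimes>\<^bsub>monoid_ring G\<^esub> delta v = delta (u \<otimes> v)"
  by (rule pairing_ext) (simp_all add: monoid_ring_mult)

lemma cring_monoid_ring: "cring (monoid_ring G)"
proof (rule cringI)
  show "abelian_group (monoid_ring G)"
  proof (rule abelian_groupI)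
    fix g h k assume g: "g \<in> carrier (monoid_ring G)" and h: "h \<in> carrier (monoid_ring G)"
    have "{m. g m + h m \<noteq> 0} \<subseteq> {m. g m \<noteq> 0} \<union> {m. h m \<noteq> 0}" by auto
    then show "g \<oplus>\<^bsub>monoid_ring G\<^esub> h \<in> carrier (monoid_ring G)"
      using g h by (auto intro: finite_subset)
    show "\<exists>h\<in>carrier (monoid_ring G). h \<oplus>\<^bsub>monoid_ring G\<^esub> g = \<zero>\<^bsub>monoid_ring G\<^esub>"
      using g by (intro bexI[of _ "\<lambda>m. - g m"]) auto
  qed (auto simp: ac_simps)
  show "Group.comm_monoid (monoid_ring G)"
  proof (rule comm_monoidI)
    fix g h k assume ghk: "g \<in> carrier (monoid_ring G)" "h \<in> carrier (monoid_ring G)"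
      "k \<in> carrier (monoid_ring G)"
    have fin: "finite {m. g m \<noteq> 0}" "finite {m. h m \<noteq> 0}" "finite {m. k m \<noteq> 0}"
      using ghk by auto
    have carr: "u \<in> carrier G" if "g u \<noteq> 0 \<or> h u \<noteq> 0 \<or> k u \<noteq> 0" for u
      using that ghk by auto
    show "(g \<otimes>\<^bsub>monoid_ring G\<^esub> h) \<otimes>\<^bsub>monoid_ring G\<^esub> k
        = g \<otimes>\<^bsub>monoid_ring G\<^esub> (h \<otimes>\<^bsub>monoid_ring G\<^esub> k)"
    proof (rule pairing_ext)
      fix \<phi> :: "'a \<Rightarrow> int"
      show "pairing ((g \<otimes>\<^bsub>monoid_ring G\<^esub> h) \<otimes>\<^bsub>monoid_ring G\<^esub> k) \<phi>
          = pairing (g \<otimes>\<^bsub>monoid_ring G\<^esub> (h \<otimes>\<^bsub>monoid_ring G\<^esub> k)) \<phi>"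
        using fin carr by (simp add: monoid_ring_mult m_assoc cong: pairing_cong)
    qed (use fin in \<open>simp_all add: monoid_ring_mult(1)\<close>)
  next
    fix g assume "g \<in> carrier (monoid_ring G)"
    then have fin: "finite {m. g m \<noteq> 0}" and carr: "\<And>u. g u \<noteq> 0 \<Longrightarrow> u \<in> carrier G" by auto
    show "\<one>\<^bsub>monoid_ring G\<^esub> \<otimes>\<^bsub>monoid_ring G\<^esub> g = g"
      by (rule pairing_ext)
        (use fin carr in \<open>simp_all add: monoid_ring_mult cong: pairing_cong\<close>)
  next
    fix g h assume gh: "g \<in> carrier (monoid_ring G)" "h \<in> carrier (monoid_ring G)"
    then have fin: "finite {m. g m \<noteq> 0}" "finite {m. h m \<noteq> 0}" by auto
    have carr: "u \<in> carrier G" if "g u \<noteq> 0 \<or> h u \<noteq> 0" for u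
      using that gh by auto
    show "g \<otimes>\<^bsub>monoid_ring G\<^esub> h = h \<otimes>\<^bsub>monoid_ring G\<^esub> g"
    proof (rule pairing_ext)
      fix \<phi> :: "'a \<Rightarrow> int"
      have "pairing g (\<lambda>u. pairing h (\<lambda>v. \<phi> (u \<otimes> v))) = pairing h (\<lambda>v. pairing g (\<lambda>u. \<phi> (u \<otimes> v)))"
        unfolding pairing_def sum_distrib_left
        by (subst sum.swap) (simp add: mult.left_commute)
      also have "\<dots> = pairing h (\<lambda>v. pairing g (\<lambda>u. \<phi> (v \<otimes> u)))"
        using carr by (intro pairing_cong refl) (simp add: m_comm)
      finally show "pairing (g \<otimes>\<^bsub>monoid_ring G\<^esub> h) \<phi> = pairing (h \<otimes>\<^bsub>monoid_ring G\<^esub> g) \<phi>"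
        using fin by (simp add: monoid_ring_mult)
    qed (use fin in \<open>simp_all add: monoid_ring_mult(1)\<close>)
  qed (simp_all add: monoid_ring_mult_closed del: monoid_ring_simps(1))
  fix g h k assume ghk: "g \<in> carrier (monoid_ring G)" "h \<in> carrier (monoid_ring G)"
      "k \<in> carrier (monoid_ring G)"
  then have fin: "finite {m. g m \<noteq> 0}" "finite {m. h m \<noteq> 0}" "finite {m. k m \<noteq> 0}"
    by auto
  have "{m. a m + b m \<noteq> 0} \<subseteq> {m. a m \<noteq> 0} \<union> {m. b m \<noteq> 0}" for a b :: "'a \<Rightarrow> int" by auto
  then have fin_add: "finite {m. a m + b m \<noteq> 0}"
    if "finite {m. a m \<noteq> 0}" "finite {m. b m \<noteq> 0}" for a b :: "'a \<Rightarrow> int"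
    using that by (meson finite_Un finite_subset)
  show "(g \<oplus>\<^bsub>monoid_ring G\<^esub> h) \<otimes>\<^bsub>monoid_ring G\<^esub> k
      = g \<otimes>\<^bsub>monoid_ring G\<^esub> k \<oplus>\<^bsub>monoid_ring G\<^esub> h \<otimes>\<^bsub>monoid_ring G\<^esub> k"
    by (rule pairing_ext)
      (use fin fin_add in \<open>simp_all add: monoid_ring_mult pairing_add\<close>)
qed

end

section \<open>Tensor products\<close>

locale tensor = B: cring B + C: cring C
  for B :: "('b, 'x) ring_scheme" and C :: "('c, 'y) ring_scheme" +
  fixes i :: "'f \<Rightarrow> 'b" and j :: "'f \<Rightarrow> 'c"
  assumes i_closed: "i r \<in> carrier B" and j_closed: "j r \<in> carrier C"
begin

sublocale M: Group.comm_monoid "B \<times>\<times> C"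
  by (rule comm_monoidI) (auto simp: B.m_assoc C.m_assoc intro: B.m_comm C.m_comm)

abbreviation "ZM \<equiv> monoid_ring (B \<times>\<times> C)"
abbreviation "J \<equiv> tensor_ideal B C i j"
abbreviation "T \<equiv> tensor_product B C i j"
abbreviation "pure \<equiv> pure_tensor B C i j"

sublocale ZM: cring ZM by (rule M.cring_monoid_ring)

lemma diff_closed:
  assumes "g \<in> carrier ZM" "h \<in> carrier ZM"
  shows "(\<lambda>m. g m - h m) \<in> carrier ZM"
proof -
  have "{m. g m - h m \<noteq> 0} \<subseteq> {m. g m \<noteq> 0} \<union> {m. h m \<noteq> 0}" by auto
  then show ?thesis using assms by (auto intro: finite_subset)
qed

lemma relations_closed: "tensor_relations B C i j \<subseteq> carrier ZM"
  unfolding tensor_relations_def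
  by (auto simp: i_closed j_closed simp del: M.monoid_ring_simps(1) intro!: diff_closed M.delta_carrier)

lemma ideal_J: "ideal J ZM"
  unfolding tensor_ideal_def by (rule ZM.genideal_ideal[OF relations_closed])

lemma relations_J: "tensor_relations B C i j \<subseteq> J"
  unfolding tensor_ideal_def by (rule ZM.genideal_self[OF relations_closed])

sublocale T: cring T
  unfolding tensor_product_def by (rule ideal.quotient_is_cring[OF ideal_J ZM.is_cring])

lemma coset_hom: "(+>\<^bsub>ZM\<^esub>) J \<in> ring_hom ZM T"
  unfolding tensor_product_def by (rule ideal.rcos_ring_hom[OF ideal_J])

lemma T_carrier: "carrier T = (+>\<^bsub>ZM\<^esub>) J ` carrier ZM"
  by (auto simp: tensor_product_def FactRing_def A_RCOSETS_def')

lemma coset_eq: "J +>\<^bsub>ZM\<^esub> g = {h. (\<lambda>m. h m - g m) \<in> J}"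
proof -
  have "h \<in> (\<Union>k\<in>J. {\<lambda>m. k m + g m}) \<longleftrightarrow> (\<lambda>m. h m - g m) \<in> J" for h
    by (auto intro!: bexI[of _ "\<lambda>m. h m - g m"])
  then show ?thesis by (auto simp: a_r_coset_def')
qed

lemma zero_J: "(\<lambda>m. 0) \<in> J"
  using additive_subgroup.zero_closed[OF ideal.axioms(1)[OF ideal_J]] by simp

lemma coset_zero: "J +>\<^bsub>ZM\<^esub> (\<lambda>m. 0) = \<zero>\<^bsub>T\<^esub>"
  by (simp add: coset_eq tensor_product_def FactRing_def)

lemma coset_eqI:
  assumes "(\<lambda>m. g m - h m) \<in> J" "h \<in> carrier ZM"
  shows "J +>\<^bsub>ZM\<^esub> g = J +>\<^bsub>ZM\<^esub> h"
proof -
  have "g \<in> J +>\<^bsub>ZM\<^esub> h" using assms(1) by (simp add: coset_eq)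
  then show ?thesis
    using ZM.a_repr_independence[OF _ assms(2)] additive_subgroup.a_subgroup[OF ideal.axioms(1)[OF ideal_J]]
    by metis
qed

lemma pure_closed [simp]: "b \<in> carrier B \<Longrightarrow> c \<in> carrier C \<Longrightarrow> pure b c \<in> carrier T"
  using ring_hom_closed[OF coset_hom M.delta_carrier[of "(b, c)"]] by (simp add: pure_tensor_def)

lemma coset_add:
  assumes "g \<in> carrier ZM" "h \<in> carrier ZM"
  shows "(J +>\<^bsub>ZM\<^esub> g) \<oplus>\<^bsub>T\<^esub> (J +>\<^bsub>ZM\<^esub> h) = J +>\<^bsub>ZM\<^esub> (\<lambda>m. g m + h m)"
  using ring_hom_add[OF coset_hom assms] by simp

lemma pure_mult:
  assumes "b \<in> carrier B" "c \<in> carrier C" "b' \<in> carrier B" "c' \<in> carrier C"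
  shows "pure b c \<otimes>\<^bsub>T\<^esub> pure b' c' = pure (b \<otimes>\<^bsub>B\<^esub> b') (c \<otimes>\<^bsub>C\<^esub> c')"
  using ring_hom_mult[OF coset_hom, of "delta (b, c)" "delta (b', c')"] assms
  by (simp add: pure_tensor_def M.delta_mult del: M.monoid_ring_simps)

lemma pure_one: "\<one>\<^bsub>T\<^esub> = pure \<one>\<^bsub>B\<^esub> \<one>\<^bsub>C\<^esub>"
  using ring_hom_one[OF coset_hom] by (simp add: pure_tensor_def)

lemma pure_add_left:
  assumes "b \<in> carrier B" "b' \<in> carrier B" "c \<in> carrier C"
  shows "pure (b \<oplus>\<^bsub>B\<^esub> b') c = pure b c \<oplus>\<^bsub>T\<^esub> pure b' c"
proof -
  have "(\<lambda>m. delta (b \<oplus>\<^bsub>B\<^esub> b', c) m - delta (b, c) m - delta (b', c) m) \<in> tensor_relations B C i j"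
    unfolding tensor_relations_def using assms by blast
  then have "(\<lambda>m. delta (b \<oplus>\<^bsub>B\<^esub> b', c) m - (delta (b, c) m + delta (b', c) m)) \<in> J"
    using relations_J by (auto simp: diff_diff_eq)
  then show ?thesis
    using coset_eqI[OF _ ZM.add.m_closed[of "delta (b, c)" "delta (b', c)"]] assms
    by (simp add: pure_tensor_def coset_add del: M.monoid_ring_simps(1))
qed

lemma pure_add_right:
  assumes "b \<in> carrier B" "c \<in> carrier C" "c' \<in> carrier C"
  shows "pure b (c \<oplus>\<^bsub>C\<^esub> c') = pure b c \<oplus>\<^bsub>T\<^esub> pure b c'"
proof -
  have "(\<lambda>m. delta (b, c \<oplus>\<^bsub>C\<^esub> c') m - delta (b, c) m - delta (b, c') m) \<in> tensor_relations B C i j"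
    unfolding tensor_relations_def using assms by blast
  then have "(\<lambda>m. delta (b, c \<oplus>\<^bsub>C\<^esub> c') m - (delta (b, c) m + delta (b, c') m)) \<in> J"
    using relations_J by (auto simp: diff_diff_eq)
  then show ?thesis
    using coset_eqI[OF _ ZM.add.m_closed[of "delta (b, c)" "delta (b, c')"]] assms
    by (simp add: pure_tensor_def coset_add del: M.monoid_ring_simps(1))
qed

lemma pure_balanced:
  assumes "b \<in> carrier B" "c \<in> carrier C"
  shows "pure (i r \<otimes>\<^bsub>B\<^esub> b) c = pure b (j r \<otimes>\<^bsub>C\<^esub> c)"
proof -
  have "(\<lambda>m. delta (i r \<otimes>\<^bsub>B\<^esub> b, c) m - delta (b, j r \<otimes>\<^bsub>C\<^esub> c) m) \<in> tensor_relations B C i j"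
    unfolding tensor_relations_def using assms by blast
  then show ?thesis
    unfolding pure_tensor_def using relations_J assms j_closed
    by (intro coset_eqI M.delta_carrier) auto
qed

lemma pure_zero_left: "c \<in> carrier C \<Longrightarrow> pure \<zero>\<^bsub>B\<^esub> c = \<zero>\<^bsub>T\<^esub>"
  using pure_add_left[of "\<zero>\<^bsub>B\<^esub>" "\<zero>\<^bsub>B\<^esub>" c] T.add.l_cancel_one[of "pure \<zero>\<^bsub>B\<^esub> c" "pure \<zero>\<^bsub>B\<^esub> c"] by simp

lemma pure_zero_right: "b \<in> carrier B \<Longrightarrow> pure b \<zero>\<^bsub>C\<^esub> = \<zero>\<^bsub>T\<^esub>"
  using pure_add_right[of b "\<zero>\<^bsub>C\<^esub>" "\<zero>\<^bsub>C\<^esub>"] T.add.l_cancel_one[of "pure b \<zero>\<^bsub>C\<^esub>" "pure b \<zero>\<^bsub>C\<^esub>"] by simp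

lemma pure_minus_left:
  assumes "b \<in> carrier B" "c \<in> carrier C"
  shows "\<ominus>\<^bsub>T\<^esub> pure b c = pure (\<ominus>\<^bsub>B\<^esub> b) c"
  using pure_add_left[of "\<ominus>\<^bsub>B\<^esub> b" b c] assms
  by (intro T.minus_equality) (simp_all add: B.l_neg pure_zero_left)

text \<open>Every element is a finite sum of pure tensors. Each round takes one unit off a
  coefficient, so the induction runs on the sum of the absolute values; negative units are allowed
  because the negative of a pure tensor is again pure.\<close>

lemma T_induct [consumes 1, case_names pure add]:
  assumes "x \<in> carrier T"
    and pure: "\<And>b c. b \<in> carrier B \<Longrightarrow> c \<in> carrier C \<Longrightarrow> Q (pure b c)"
    and add: "\<And>x y. x \<in> carrier T \<Longrightarrow> y \<in> carrier T \<Longrightarrow> Q x \<Longrightarrow> Q y \<Longrightarrow> Q (x \<oplus>\<^bsub>T\<^esub> y)"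
  shows "Q x"
proof -
  obtain g where g: "g \<in> carrier ZM" "x = J +>\<^bsub>ZM\<^esub> g" using assms(1) T_carrier by auto
  have "Q (J +>\<^bsub>ZM\<^esub> g)" if "g \<in> carrier ZM" for g
    using that
  proof (induction "\<Sum>m | g m \<noteq> 0. nat \<bar>g m\<bar>" arbitrary: g rule: less_induct)
    case less
    have fin: "finite {m. g m \<noteq> 0}" and sub: "{m. g m \<noteq> 0} \<subseteq> carrier B \<times> carrier C"
      using less.prems by auto
    show ?case
    proof (cases "g = (\<lambda>m. 0)")
      case True
      have "J +>\<^bsub>ZM\<^esub> g = \<zero>\<^bsub>T\<^esub>"
        unfolding True by (rule coset_zero)
      also have "\<dots> = pure \<zero>\<^bsub>B\<^esub> \<zero>\<^bsub>C\<^esub>" by (simp add: pure_zero_left)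
      finally show ?thesis using pure by simp
    next
      case False
      then obtain b c where m: "g (b, c) \<noteq> 0" by (auto simp: fun_eq_iff)
      then have bc: "b \<in> carrier B" "c \<in> carrier C" using sub by auto
      define d where "d = (if g (b, c) > 0 then delta (b, c) else (\<lambda>m. - delta (b, c) m))"
      have d: "d \<in> carrier ZM" unfolding d_def using bc by (auto simp: delta_def)
      define h where "h = (\<lambda>m. g m - d m)"
      have h: "h \<in> carrier ZM" unfolding h_def by (rule diff_closed[OF less.prems d])
      have val: "h m = (if m = (b, c) then g m - sgn (g m) else g m)" for m
        using m by (auto simp: h_def d_def delta_def)
      have "(\<Sum>m | h m \<noteq> 0. nat \<bar>h m\<bar>) \<le> (\<Sum>m | g m \<noteq> 0. nat \<bar>h m\<bar>)"
        using m by (intro sum_mono2 fin) (auto simp: val split: if_splits)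
      also have "\<dots> < (\<Sum>m | g m \<noteq> 0. nat \<bar>g m\<bar>)"
      proof (rule sum_strict_mono_ex1[OF fin])
        show "\<forall>m\<in>{m. g m \<noteq> 0}. nat \<bar>h m\<bar> \<le> nat \<bar>g m\<bar>"
          by (auto simp: val sgn_if)
        show "\<exists>m\<in>{m. g m \<noteq> 0}. nat \<bar>h m\<bar> < nat \<bar>g m\<bar>"
          using m by (intro bexI[of _ "(b, c)"]) (auto simp: val sgn_if)
      qed
      finally have "Q (J +>\<^bsub>ZM\<^esub> h)" using less.hyps h by blast
      moreover have "Q (J +>\<^bsub>ZM\<^esub> d)"
      proof (cases "g (b, c) > 0")
        case True
        then show ?thesis using pure[OF bc] by (simp add: d_def pure_tensor_def)
      next
        case False
        then have "(\<lambda>m. d m + delta (b, c) m) = (\<lambda>m. 0)" by (simp add: d_def)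
        then have "(J +>\<^bsub>ZM\<^esub> d) \<oplus>\<^bsub>T\<^esub> pure b c = \<zero>\<^bsub>T\<^esub>"
          using coset_add[OF d M.delta_carrier[of "(b, c)"]] bc
          by (simp add: pure_tensor_def coset_zero)
        then have "J +>\<^bsub>ZM\<^esub> d = \<ominus>\<^bsub>T\<^esub> pure b c"
          using T.minus_equality[of "J +>\<^bsub>ZM\<^esub> d" "pure b c"] ring_hom_closed[OF coset_hom d] bc
          by simp
        then show ?thesis using pure[of "\<ominus>\<^bsub>B\<^esub> b" c] bc by (simp add: pure_minus_left)
      qed
      ultimately have "Q ((J +>\<^bsub>ZM\<^esub> h) \<oplus>\<^bsub>T\<^esub> (J +>\<^bsub>ZM\<^esub> d))"
        using add ring_hom_closed[OF coset_hom] h d by blast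
      then show ?thesis using coset_add[OF h d] by (simp add: h_def)
    qed
  qed
  then show ?thesis using g by simp
qed

end

section \<open>Coordinates on $K_P$\<close>

primrec range_sum :: "('r, 'm) ring_scheme \<Rightarrow> (nat \<Rightarrow> 'r) \<Rightarrow> nat \<Rightarrow> 'r" where
  "range_sum R h 0 = \<zero>\<^bsub>R\<^esub>"
| "range_sum R h (Suc n) = range_sum R h n \<oplus>\<^bsub>R\<^esub> h n"

lemma range_sum_mem:
  assumes "subgroup H (add_monoid R)" "\<And>j. j < n \<Longrightarrow> h j \<in> H"
  shows "range_sum R h n \<in> H"
  using assms(2)
proof (induction n)
  case 0
  show ?case using subgroup.one_closed[OF assms(1)] by simp
next
  case (Suc n)
  then show ?case using subgroup.m_closed[OF assms(1), of "range_sum R h n" "h n"] by simp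
qed

lemma (in abelian_group) range_sum_closed:
  "(\<And>j. j < n \<Longrightarrow> h j \<in> carrier G) \<Longrightarrow> range_sum G h n \<in> carrier G"
  by (induction n) auto

lemma (in abelian_group) range_sum_add:
  assumes "\<And>j. j < n \<Longrightarrow> h j \<in> carrier G" "\<And>j. j < n \<Longrightarrow> k j \<in> carrier G"
  shows "range_sum G h n \<oplus> range_sum G k n = range_sum G (\<lambda>j. h j \<oplus> k j) n"
  using assms
proof (induction n)
  case (Suc n)
  then have "range_sum G h n \<in> carrier G" "range_sum G k n \<in> carrier G"
    by (auto intro: range_sum_closed)
  then have "range_sum G h (Suc n) \<oplus> range_sum G k (Suc n)
      = (range_sum G h n \<oplus> range_sum G k n) \<oplus> (h n \<oplus> k n)"
    using Suc.prems by (simp add: a_ac)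
  then show ?case using Suc by simp
qed simp

lemma range_sum_cong: "(\<And>j. j < n \<Longrightarrow> h j = k j) \<Longrightarrow> range_sum R h n = range_sum R k n"
  by (induction n) auto

context order_setup
begin

lemma F_to_K_closed: "F_to_K f r \<in> carrier K"
proof -
  obtain a b where "b \<noteq> 0" "r = Fract a b" by (rule fract_cases)
  then show ?thesis by (simp add: F_to_K_Fract)
qed

sublocale KP: tensor "K_field f" "completion_field P" "F_to_K f" "to_completion P"
  using cring_K FP_simps(6) F_to_K_closed \<iota>_simps(1)
  by (intro tensor.intro tensor_axioms.intro) auto

abbreviation "T \<equiv> KP.T"
abbreviation "pure \<equiv> KP.pure"

lemma KP_ring_eq: "KP_ring f P = T" and KP_pure_eq: "KP_pure f P = pure"
  by (simp_all add: KP_ring_def KP_pure_def fun_eq_iff)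

section \<open>Coordinate maps that vanish on the tensor ideal\<close>

definition rep :: "(nat \<Rightarrow> 'a poly fract) set \<Rightarrow> nat \<Rightarrow> 'a poly fract" where
  "rep c = (SOME s. adic_Cauchy P s \<and> c = Cauchy_class P s)"

lemma rep:
  assumes "c \<in> carrier FP"
  shows "adic_Cauchy P (rep c)" "Cauchy_class P (rep c) = c"
proof -
  have "\<exists>s. adic_Cauchy P s \<and> c = Cauchy_class P s" using assms by (blast elim: FP_cases)
  then show "adic_Cauchy P (rep c)" "Cauchy_class P (rep c) = c"
    unfolding rep_def by (metis (mono_tags, lifting) someI_ex)+
qed

text \<open>Representatives are chosen independently for each class, so they are additive only up to
  null sequences.\<close>

lemma rep_add_null:
  assumes "c \<in> carrier FP" "d \<in> carrier FP"
  shows "(\<lambda>i. rep (c \<oplus>\<^bsub>FP\<^esub> d) i - (rep c i + rep d i)) \<in> adic_null P"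
proof -
  have "Cauchy_class P (rep (c \<oplus>\<^bsub>FP\<^esub> d)) = c \<oplus>\<^bsub>FP\<^esub> d"
    by (intro rep(2) KP.C.a_closed assms)
  also have "\<dots> = Cauchy_class P (\<lambda>i. rep c i + rep d i)"
    using FP_simps(3)[OF rep(1)[OF assms(1)] rep(1)[OF assms(2)]] rep(2)[OF assms(1)] rep(2)[OF assms(2)]
    by simp
  finally have "Cauchy_class P (rep (c \<oplus>\<^bsub>FP\<^esub> d)) = Cauchy_class P (\<lambda>i. rep c i + rep d i)" .
  then show ?thesis unfolding Cauchy_class_eq_iff .
qed

lemma rep_scale_null:
  assumes "c \<in> carrier FP"
  shows "(\<lambda>i. rep (\<iota> r \<otimes>\<^bsub>FP\<^esub> c) i - r * rep c i) \<in> adic_null P"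
proof -
  have "Cauchy_class P (rep (\<iota> r \<otimes>\<^bsub>FP\<^esub> c)) = \<iota> r \<otimes>\<^bsub>FP\<^esub> c"
    by (intro rep(2) KP.C.m_closed \<iota>_simps(1) assms)
  also have "\<dots> = Cauchy_class P (\<lambda>i. r * rep c i)"
    using FP_simps(2)[OF Cauchy_const[of r] rep(1)[OF assms]] rep(2)[OF assms]
    by (simp add: to_completion_def)
  finally have "Cauchy_class P (rep (\<iota> r \<otimes>\<^bsub>FP\<^esub> c)) = Cauchy_class P (\<lambda>i. r * rep c i)" .
  then show ?thesis unfolding Cauchy_class_eq_iff .
qed

lemma null_const_mult: "s \<in> adic_null P \<Longrightarrow> (\<lambda>i. r * s i) \<in> adic_null P"
  using null_mult[OF _ Cauchy_const] .

lemma null_sum: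
  "(\<And>x. x \<in> Y \<Longrightarrow> s x \<in> adic_null P) \<Longrightarrow> (\<lambda>i. \<Sum>x\<in>Y. s x i) \<in> adic_null P"
  by (induction Y rule: infinite_finite_induct) (auto intro: null_zero null_add)

lemma Cauchy_sum:
  "(\<And>x. x \<in> Y \<Longrightarrow> adic_Cauchy P (s x)) \<Longrightarrow> adic_Cauchy P (\<lambda>i. \<Sum>x\<in>Y. s x i)"
  by (induction Y rule: infinite_finite_induct) (auto intro: Cauchy_const Cauchy_add)

text \<open>Terms of a sequence for the product of a coordinate of the K-component with the
  F_P-component. Termwise values lie in F, where \<open>pairing\<close> can sum them; classes are
  formed only at the end.\<close>

definition coord_seq :: "nat \<Rightarrow> nat \<Rightarrow> 'a Kelem \<times> (nat \<Rightarrow> 'a poly fract) set \<Rightarrow> 'a poly fract" where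
  "coord_seq j i v = coord j (fst v) * rep (snd v) i"

text \<open>Asking for null coordinates after multiplication by every monoid element
  \<open>u\<close> makes this set an ideal; the case u = 1 is the one of interest.\<close>

definition coord_kernel :: "('a Kelem \<times> (nat \<Rightarrow> 'a poly fract) set \<Rightarrow> int) set" where
  "coord_kernel = {g \<in> carrier KP.ZM. \<forall>j. \<forall>u \<in> carrier (K_field f \<times>\<times> FP).
     (\<lambda>i. pairing g (\<lambda>v. coord_seq j i (v \<otimes>\<^bsub>K_field f \<times>\<times> FP\<^esub> u))) \<in> adic_null P}"

lemma coord_kernelD:
  assumes "g \<in> coord_kernel"
  shows "g \<in> carrier KP.ZM" "u \<in> carrier (K_field f \<times>\<times> FP) \<Longrightarrow>
    (\<lambda>i. pairing g (\<lambda>v. coord_seq j i (v \<otimes>\<^bsub>K_field f \<times>\<times> FP\<^esub> u))) \<in> adic_null P"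
  using assms unfolding coord_kernel_def by blast+

lemma coord_kernel_diff:
  assumes "g \<in> coord_kernel" "h \<in> coord_kernel"
  shows "(\<lambda>m. g m - h m) \<in> coord_kernel"
proof -
  have fin: "finite {m. g m \<noteq> 0}" "finite {m. h m \<noteq> 0}"
    using coord_kernelD(1)[OF assms(1)] coord_kernelD(1)[OF assms(2)] by simp_all
  show ?thesis
    unfolding coord_kernel_def mem_Collect_eq
  proof (intro conjI allI ballI)
    show "(\<lambda>m. g m - h m) \<in> carrier KP.ZM"
      by (intro KP.diff_closed coord_kernelD(1) assms)
    fix j u assume u: "u \<in> carrier (K_field f \<times>\<times> FP)"
    show "(\<lambda>i. pairing (\<lambda>m. g m - h m) (\<lambda>v. coord_seq j i (v \<otimes>\<^bsub>K_field f \<times>\<times> FP\<^esub> u))) \<in> adic_null P"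
      unfolding pairing_diff[OF fin]
      by (intro null_diff coord_kernelD(2) assms u)
  qed
qed

lemma coord_kernel_mult:
  assumes "g \<in> coord_kernel" "h \<in> carrier KP.ZM"
  shows "h \<otimes>\<^bsub>KP.ZM\<^esub> g \<in> coord_kernel"
  unfolding coord_kernel_def mem_Collect_eq
proof (intro conjI allI ballI)
  let ?M = "K_field f \<times>\<times> FP"
  have g: "g \<in> carrier KP.ZM" by (rule coord_kernelD(1)[OF assms(1)])
  have fin: "finite {m. g m \<noteq> 0}" "finite {m. h m \<noteq> 0}" using g assms(2) by simp_all
  have carr: "\<And>v. g v \<noteq> 0 \<Longrightarrow> v \<in> carrier ?M" "\<And>v. h v \<noteq> 0 \<Longrightarrow> v \<in> carrier ?M"
    using g assms(2) by auto
  show "h \<otimes>\<^bsub>KP.ZM\<^esub> g \<in> carrier KP.ZM" using KP.ZM.m_closed[OF assms(2) g] .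
  fix j u assume u: "u \<in> carrier ?M"
  \<comment> \<open>Multiplying \<open>g\<close> by a monoid element w amounts to replacing u by w
    u, and the condition on \<open>g\<close> covers all u.\<close>
  have "pairing (h \<otimes>\<^bsub>KP.ZM\<^esub> g) (\<lambda>v. coord_seq j i (v \<otimes>\<^bsub>?M\<^esub> u))
      = (\<Sum>w | h w \<noteq> 0. of_int (h w) * pairing g (\<lambda>v. coord_seq j i (v \<otimes>\<^bsub>?M\<^esub> (w \<otimes>\<^bsub>?M\<^esub> u))))" for i
  proof -
    have "pairing g (\<lambda>v. coord_seq j i ((w \<otimes>\<^bsub>?M\<^esub> v) \<otimes>\<^bsub>?M\<^esub> u))
        = pairing g (\<lambda>v. coord_seq j i (v \<otimes>\<^bsub>?M\<^esub> (w \<otimes>\<^bsub>?M\<^esub> u)))" if "h w \<noteq> 0" for w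
      using carr(1) carr(2)[OF that] u
      by (intro pairing_cong refl arg_cong[of _ _ "coord_seq j i"]) (metis KP.M.m_assoc KP.M.m_comm)
    then show ?thesis
      unfolding KP.M.monoid_ring_mult(3)[OF fin(2,1)]
      by (subst pairing_def) (intro sum.cong refl, simp)
  qed
  moreover have "(\<lambda>i. \<Sum>w | h w \<noteq> 0. of_int (h w) *
      pairing g (\<lambda>v. coord_seq j i (v \<otimes>\<^bsub>?M\<^esub> (w \<otimes>\<^bsub>?M\<^esub> u)))) \<in> adic_null P"
    by (intro null_sum null_const_mult coord_kernelD(2)[OF assms(1)] KP.M.m_closed u carr(2)) simp
  ultimately show "(\<lambda>i. pairing (h \<otimes>\<^bsub>KP.ZM\<^esub> g) (\<lambda>v. coord_seq j i (v \<otimes>\<^bsub>?M\<^esub> u))) \<in> adic_null P"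
    by simp
qed

lemma ideal_coord_kernel: "ideal coord_kernel KP.ZM"
proof (rule idealI)
  show "ring KP.ZM" by (rule KP.ZM.ring_axioms)
  have zero: "(\<lambda>m. 0) \<in> coord_kernel"
    unfolding coord_kernel_def by (simp add: pairing_def null_zero)
  have neg: "(\<lambda>m. - g m) \<in> coord_kernel" if "g \<in> coord_kernel" for g
    using coord_kernel_diff[OF zero that] by simp
  show "subgroup coord_kernel (add_monoid KP.ZM)"
  proof (rule group.subgroupI[OF KP.ZM.a_group])
    fix g assume g: "g \<in> coord_kernel"
    have "(\<lambda>m. - g m) \<oplus>\<^bsub>KP.ZM\<^esub> g = \<zero>\<^bsub>KP.ZM\<^esub>" by simp
    then have "\<ominus>\<^bsub>KP.ZM\<^esub> g = (\<lambda>m. - g m)"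
      using coord_kernelD(1)[OF g] coord_kernelD(1)[OF neg[OF g]] by (rule KP.ZM.minus_equality)
    then show "inv\<^bsub>add_monoid KP.ZM\<^esub> g \<in> coord_kernel" using neg[OF g] by (simp add: a_inv_def)
    fix h assume "h \<in> coord_kernel"
    then show "g \<otimes>\<^bsub>add_monoid KP.ZM\<^esub> h \<in> coord_kernel"
      using coord_kernel_diff[OF g neg, of h] by simp
  qed (use zero coord_kernelD(1) in auto)
  fix g h assume g: "g \<in> coord_kernel" and h: "h \<in> carrier KP.ZM"
  show "h \<otimes>\<^bsub>KP.ZM\<^esub> g \<in> coord_kernel" by (rule coord_kernel_mult[OF g h])
  then show "g \<otimes>\<^bsub>KP.ZM\<^esub> h \<in> coord_kernel"
    using KP.ZM.m_comm[OF h coord_kernelD(1)[OF g]] by simp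
qed

text \<open>Additivity in the K-component gives exactly zero because \<open>coord\<close> is
  additive. The other two relations hold up to a null sequence, since \<open>rep\<close> is a
  choice.\<close>

lemma relations_coord_kernel:
  "tensor_relations (K_field f) FP (F_to_K f) (to_completion P) \<subseteq> coord_kernel"
proof
  fix g assume g: "g \<in> tensor_relations (K_field f) FP (F_to_K f) (to_completion P)"
  have fin: "finite {m. delta u m - delta v m \<noteq> 0}" for u v :: "'a Kelem \<times> (nat \<Rightarrow> 'a poly fract) set"
    by (rule finite_subset[of _ "{u, v}"]) (auto simp: delta_def)
  note pair = pairing_diff[OF fin KP.M.finite_delta] pairing_diff[OF KP.M.finite_delta KP.M.finite_delta]
  show "g \<in> coord_kernel"
    unfolding coord_kernel_def mem_Collect_eq
  proof (intro conjI allI ballI)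
    show "g \<in> carrier KP.ZM" using g KP.relations_closed by blast
    fix j u assume "u \<in> carrier (K_field f \<times>\<times> FP)"
    then obtain x y where u: "u = (x, y)" "x \<in> carrier K" "y \<in> carrier FP" by auto
    from g[unfolded tensor_relations_def]
    show "(\<lambda>i. pairing g (\<lambda>v. coord_seq j i (v \<otimes>\<^bsub>K_field f \<times>\<times> FP\<^esub> u))) \<in> adic_null P"
    proof (elim UnE CollectE exE conjE)
      fix b b' c assume 1: "g = (\<lambda>m. delta (b \<oplus>\<^bsub>K\<^esub> b', c) m - delta (b, c) m - delta (b', c) m)"
        "b \<in> carrier K" "b' \<in> carrier K" "c \<in> carrier FP"
      have "pairing g (\<lambda>v. coord_seq j i (v \<otimes>\<^bsub>K_field f \<times>\<times> FP\<^esub> u)) = 0" for i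
        unfolding 1(1) pair pairing_delta using 1(2-) u
        by (simp add: coord_seq_def KP.B.l_distr coord_add algebra_simps)
      then show ?thesis by (simp only: null_zero)
    next
      fix b c c' assume 2: "g = (\<lambda>m. delta (b, c \<oplus>\<^bsub>FP\<^esub> c') m - delta (b, c) m - delta (b, c') m)"
        "b \<in> carrier K" "c \<in> carrier FP" "c' \<in> carrier FP"
      let ?d = "\<lambda>i. rep (c \<otimes>\<^bsub>FP\<^esub> y \<oplus>\<^bsub>FP\<^esub> c' \<otimes>\<^bsub>FP\<^esub> y) i - (rep (c \<otimes>\<^bsub>FP\<^esub> y) i + rep (c' \<otimes>\<^bsub>FP\<^esub> y) i)"
      have "pairing g (\<lambda>v. coord_seq j i (v \<otimes>\<^bsub>K_field f \<times>\<times> FP\<^esub> u)) = coord j (b \<otimes>\<^bsub>K\<^esub> x) * ?d i" for i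
        unfolding 2(1) pair pairing_delta using 2(2-) u
        by (simp add: coord_seq_def KP.C.l_distr algebra_simps)
      moreover have "(\<lambda>i. coord j (b \<otimes>\<^bsub>K\<^esub> x) * ?d i) \<in> adic_null P"
        using 2(2-) u by (intro null_const_mult rep_add_null) auto
      ultimately show ?thesis by (simp only:)
    next
      fix r b c assume 3: "g = (\<lambda>m. delta (F_to_K f r \<otimes>\<^bsub>K\<^esub> b, c) m - delta (b, \<iota> r \<otimes>\<^bsub>FP\<^esub> c) m)"
        "b \<in> carrier K" "c \<in> carrier FP"
      let ?d = "\<lambda>i. rep (\<iota> r \<otimes>\<^bsub>FP\<^esub> (c \<otimes>\<^bsub>FP\<^esub> y)) i - r * rep (c \<otimes>\<^bsub>FP\<^esub> y) i"
      have "pairing g (\<lambda>v. coord_seq j i (v \<otimes>\<^bsub>K_field f \<times>\<times> FP\<^esub> u))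
          = - coord j (b \<otimes>\<^bsub>K\<^esub> x) * ?d i" for i
        unfolding 3(1) pair pairing_delta using 3(2-) u F_to_K_closed[of r] \<iota>_simps(1)[of r]
        by (simp add: coord_seq_def KP.B.m_assoc KP.C.m_assoc coord_scale algebra_simps)
      moreover have "(\<lambda>i. - coord j (b \<otimes>\<^bsub>K\<^esub> x) * ?d i) \<in> adic_null P"
        using 3(2-) u by (intro null_const_mult rep_scale_null) auto
      ultimately show ?thesis by (simp only:)
    qed
  qed
qed

lemma J_coord_kernel: "KP.J \<subseteq> coord_kernel"
  unfolding tensor_ideal_def
  by (rule KP.ZM.genideal_minimal[OF ideal_coord_kernel relations_coord_kernel])

text \<open>Any representative in the monoid ring may be chosen: two of them differ by an element of
  \<open>coord_kernel\<close>.\<close>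

definition tcoord :: "nat \<Rightarrow> 'a KPelem \<Rightarrow> (nat \<Rightarrow> 'a poly fract) set" where
  "tcoord j x = Cauchy_class P (\<lambda>i. pairing (SOME g. g \<in> carrier KP.ZM \<and> g \<in> x) (coord_seq j i))"

lemma tcoord_coset:
  assumes g: "g \<in> carrier KP.ZM"
  shows "tcoord j (KP.J +>\<^bsub>KP.ZM\<^esub> g) = Cauchy_class P (\<lambda>i. pairing g (coord_seq j i))"
proof -
  let ?x = "KP.J +>\<^bsub>KP.ZM\<^esub> g"
  define h where "h = (SOME h. h \<in> carrier KP.ZM \<and> h \<in> ?x)"
  have "g \<in> carrier KP.ZM \<and> g \<in> ?x" using g KP.zero_J by (simp add: KP.coset_eq)
  then have h: "h \<in> carrier KP.ZM" "h \<in> ?x"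
    unfolding h_def using someI_ex[of "\<lambda>h. h \<in> carrier KP.ZM \<and> h \<in> ?x"] by blast+
  then have k: "(\<lambda>m. h m - g m) \<in> coord_kernel"
    using J_coord_kernel by (auto simp: KP.coset_eq)
  have fin: "finite {m. h m \<noteq> 0}" "finite {m. g m \<noteq> 0}" using g h by simp_all
  have one: "pairing (\<lambda>m. h m - g m) (\<lambda>v. coord_seq j i (v \<otimes>\<^bsub>K_field f \<times>\<times> FP\<^esub> \<one>\<^bsub>K_field f \<times>\<times> FP\<^esub>))
      = pairing (\<lambda>m. h m - g m) (coord_seq j i)" for i
    using coord_kernelD(1)[OF k] by (intro pairing_cong refl) (auto simp: KP.M.r_one simp del: one_DirProd)
  have "(\<lambda>i. pairing h (coord_seq j i) - pairing g (coord_seq j i)) \<in> adic_null P"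
    using coord_kernelD(2)[OF k KP.M.one_closed, of j] unfolding one pairing_diff[OF fin] .
  then show ?thesis unfolding tcoord_def h_def[symmetric] Cauchy_class_eq_iff .
qed

lemma pairing_Cauchy:
  assumes g: "g \<in> carrier KP.ZM"
  shows "adic_Cauchy P (\<lambda>i. pairing g (coord_seq j i))"
  unfolding pairing_def coord_seq_def using g
  by (intro Cauchy_sum Cauchy_mult Cauchy_const rep(1)) auto

lemma tcoord_closed: "x \<in> carrier T \<Longrightarrow> tcoord j x \<in> carrier FP"
  using KP.T_carrier tcoord_coset pairing_Cauchy by (auto simp: FP_simps(1))

lemma tcoord_add:
  assumes "x \<in> carrier T" "y \<in> carrier T"
  shows "tcoord j (x \<oplus>\<^bsub>T\<^esub> y) = tcoord j x \<oplus>\<^bsub>FP\<^esub> tcoord j y"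
proof -
  obtain g h where g: "g \<in> carrier KP.ZM" "x = KP.J +>\<^bsub>KP.ZM\<^esub> g"
    and h: "h \<in> carrier KP.ZM" "y = KP.J +>\<^bsub>KP.ZM\<^esub> h"
    using assms KP.T_carrier by auto
  have gh: "(\<lambda>m. g m + h m) \<in> carrier KP.ZM" using KP.ZM.a_closed[OF g(1) h(1)] by simp
  have fin: "finite {m. g m \<noteq> 0}" "finite {m. h m \<noteq> 0}" using g h by simp_all
  show ?thesis
    unfolding g(2) h(2) KP.coset_add[OF g(1) h(1)] tcoord_coset[OF g(1)] tcoord_coset[OF h(1)]
      tcoord_coset[OF gh] pairing_add[OF fin] FP_simps(3)[OF pairing_Cauchy[OF g(1)] pairing_Cauchy[OF h(1)]] ..
qed

lemma tcoord_pure: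
  assumes "b \<in> carrier K" "c \<in> carrier FP"
  shows "tcoord j (pure b c) = \<iota> (coord j b) \<otimes>\<^bsub>FP\<^esub> c"
proof -
  have "delta (b, c) \<in> carrier KP.ZM" using assms by (intro KP.M.delta_carrier) simp
  from tcoord_coset[OF this] have "tcoord j (pure b c) = Cauchy_class P (\<lambda>i. coord j b * rep c i)"
    by (simp add: pure_tensor_def coord_seq_def)
  also have "\<dots> = \<iota> (coord j b) \<otimes>\<^bsub>FP\<^esub> Cauchy_class P (rep c)"
    unfolding to_completion_def by (rule FP_simps(2)[symmetric, OF Cauchy_const rep(1)[OF assms(2)]])
  finally show ?thesis using rep(2)[OF assms(2)] by simp
qed

lemma tcoord_zero: "tcoord j \<zero>\<^bsub>T\<^esub> = \<zero>\<^bsub>FP\<^esub>"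
  using tcoord_add[of "\<zero>\<^bsub>T\<^esub>" "\<zero>\<^bsub>T\<^esub>" j] KP.C.add.l_cancel_one[of "tcoord j \<zero>\<^bsub>T\<^esub>" "tcoord j \<zero>\<^bsub>T\<^esub>"]
    tcoord_closed[of "\<zero>\<^bsub>T\<^esub>" j] by simp

lemma tcoord_minus: "x \<in> carrier T \<Longrightarrow> tcoord j (\<ominus>\<^bsub>T\<^esub> x) = \<ominus>\<^bsub>FP\<^esub> tcoord j x"
  using tcoord_add[of "\<ominus>\<^bsub>T\<^esub> x" x j]
  by (intro KP.C.minus_equality[symmetric]) (simp_all add: KP.T.l_neg tcoord_zero tcoord_closed)

lemma tcoord_scale:
  assumes "a \<in> carrier FP" "x \<in> carrier T"
  shows "tcoord j (pure \<one>\<^bsub>K\<^esub> a \<otimes>\<^bsub>T\<^esub> x) = a \<otimes>\<^bsub>FP\<^esub> tcoord j x"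
  using assms(2)
proof (induction rule: KP.T_induct)
  case (pure b c)
  then show ?case
    using assms(1) \<iota>_simps(1)[of "coord j b"]
    by (simp add: KP.pure_mult tcoord_pure KP.C.m_lcomm)
next
  case (add x y)
  then show ?case
    using assms(1) by (simp add: KP.T.r_distr tcoord_add KP.C.r_distr tcoord_closed)
qed

subsection \<open>Expansion in the basis $1, x, \dots, x^{n-1}$\<close>

definition x_power :: "nat \<Rightarrow> 'a Kelem" where
  "x_power j = K_frac f (monom 1 j) 1"

lemma x_power_closed [simp]: "x_power j \<in> carrier K"
  by (simp add: x_power_def)

lemma coord_expansion:
  assumes "b \<in> carrier K"
  shows "b = range_sum K (\<lambda>j. F_to_K f (coord j b) \<otimes>\<^bsub>K\<^esub> x_power j) (degree f)"
proof -
  obtain g d where d: "d \<noteq> 0" "b = K_frac f g d" using assms by (rule K_cases)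
  let ?g = "mod_monic f g"
  have "F_to_K f (coord j b) \<otimes>\<^bsub>K\<^esub> x_power j = K_frac f (monom (coeff ?g j) j) d" for j
    using d by (simp add: coord_K_frac F_to_K_Fract x_power_def K_frac_mult smult_monom)
  moreover have "range_sum K (\<lambda>j. K_frac f (monom (coeff ?g j) j) d) n
      = K_frac f (\<Sum>j<n. monom (coeff ?g j) j) d" for n
    using d by (induction n) (simp_all add: K_frac_0 K_frac_same_denominator_add)
  ultimately show ?thesis
    using d K_frac_mod_monic[of d g] poly_eq_sum_monom[OF degree_mod_monic, of g] by simp
qed

lemma pure_range_sum:
  assumes "\<And>j. j < n \<Longrightarrow> h j \<in> carrier K" "c \<in> carrier FP"
  shows "pure (range_sum K h n) c = range_sum T (\<lambda>j. pure (h j) c) n"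
  using assms
proof (induction n)
  case (Suc n)
  then show ?case
    using KP.B.range_sum_closed[of n h] by (simp add: KP.pure_add_left)
qed (simp add: KP.pure_zero_left)

text \<open>Elements of K_P are determined by their coordinates. On a pure tensor the scalars from F
  are moved across to the second factor, and both sides are additive.\<close>

lemma tcoord_expansion:
  assumes "x \<in> carrier T"
  shows "x = range_sum T (\<lambda>j. pure (x_power j) (tcoord j x)) (degree f)"
  using assms
proof (induction rule: KP.T_induct)
  case (pure b c)
  have "pure b c = pure (range_sum K (\<lambda>j. F_to_K f (coord j b) \<otimes>\<^bsub>K\<^esub> x_power j) (degree f)) c"
    using coord_expansion[OF pure(1)] by simp
  also have "\<dots> = range_sum T (\<lambda>j. pure (F_to_K f (coord j b) \<otimes>\<^bsub>K\<^esub> x_power j) c) (degree f)"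
    using pure F_to_K_closed by (intro pure_range_sum) auto
  also have "\<dots> = range_sum T (\<lambda>j. pure (x_power j) (tcoord j (pure b c))) (degree f)"
    using pure by (intro range_sum_cong) (simp add: KP.pure_balanced tcoord_pure)
  finally show ?case .
next
  case (add x y)
  have "x \<oplus>\<^bsub>T\<^esub> y = range_sum T (\<lambda>j. pure (x_power j) (tcoord j x)) (degree f)
      \<oplus>\<^bsub>T\<^esub> range_sum T (\<lambda>j. pure (x_power j) (tcoord j y)) (degree f)"
    using add by simp
  also have "\<dots> = range_sum T (\<lambda>j. pure (x_power j) (tcoord j x) \<oplus>\<^bsub>T\<^esub> pure (x_power j) (tcoord j y)) (degree f)"
    using add by (intro KP.T.range_sum_add) (simp_all add: tcoord_closed)
  also have "\<dots> = range_sum T (\<lambda>j. pure (x_power j) (tcoord j (x \<oplus>\<^bsub>T\<^esub> y))) (degree f)"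
    using add by (intro range_sum_cong) (simp add: tcoord_add KP.pure_add_right tcoord_closed)
  finally show ?case .
qed

end

section \<open>Spans over subrings\<close>

context ring
begin

lemma Span_least:
  assumes "subgroup H (add_monoid R)" "\<And>d u. d \<in> D \<Longrightarrow> u \<in> set us \<Longrightarrow> d \<otimes> u \<in> H"
  shows "Span D us \<subseteq> H"
  using assms(2)
proof (induction us)
  case Nil
  then show ?case using subgroup.one_closed[OF assms(1)] by simp
next
  case (Cons u us)
  then have IH: "Span D us \<subseteq> H" by simp
  have eq: "Span D (u # us) = line_extension D u (Span D us)" by simp
  show ?case
  proof
    fix x assume "x \<in> Span D (u # us)"
    then obtain d v where "d \<in> D" "v \<in> Span D us" "x = d \<otimes> u \<oplus> v"
      unfolding eq line_extension_mem_iff by blast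
    then show "x \<in> H"
      using subgroup.m_closed[OF assms(1), of "d \<otimes> u" v] IH Cons.prems[of d u] by auto
  qed
qed

lemma Span_subgroup:
  assumes D: "subgroup D (add_monoid R)" and "set us \<subseteq> carrier R"
  shows "subgroup (Span D us) (add_monoid R)"
  using assms(2)
proof (induction us)
  case Nil
  then show ?case using add.one_is_normal normal_imp_subgroup by auto
next
  case (Cons u us)
  have S: "subgroup (Span D us) (add_monoid R)" and u: "u \<in> carrier R" using Cons by auto
  note Dc = subgroup.m_closed[OF D] subgroup.one_closed[OF D] subgroup.m_inv_closed[OF D]
  note Sc = subgroup.m_closed[OF S] subgroup.one_closed[OF S] subgroup.m_inv_closed[OF S]
  have carr: "d \<in> carrier R" if "d \<in> D" for d using subgroup.mem_carrier[OF D that] by simp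
  have carr': "v \<in> carrier R" if "v \<in> Span D us" for v using subgroup.mem_carrier[OF S that] by simp
  have eq: "Span D (u # us) = line_extension D u (Span D us)" by simp
  show ?case
    unfolding eq
  proof (rule add.subgroupI)
    show "line_extension D u (Span D us) \<subseteq> carrier R"
      using u carr carr' by (auto simp: line_extension_mem_iff)
    have "\<zero> = \<zero> \<otimes> u \<oplus> \<zero>" using u by simp
    moreover have "\<zero> \<in> D" "\<zero> \<in> Span D us" using Dc(2) Sc(2) by simp_all
    ultimately have "\<zero> \<in> line_extension D u (Span D us)"
      unfolding line_extension_mem_iff by blast
    then show "line_extension D u (Span D us) \<noteq> {}" by blast
    fix x assume "x \<in> line_extension D u (Span D us)"
    then obtain d v where x: "d \<in> D" "v \<in> Span D us" "x = d \<otimes> u \<oplus> v"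
      by (auto simp: line_extension_mem_iff)
    have "\<ominus> x = (\<ominus> d) \<otimes> u \<oplus> (\<ominus> v)"
      using x carr[OF x(1)] carr'[OF x(2)] u by (simp add: minus_add l_minus)
    then show "\<ominus> x \<in> line_extension D u (Span D us)"
      using Dc(3)[OF x(1)] Sc(3)[OF x(2)] unfolding line_extension_mem_iff a_inv_def by blast
    fix y assume "y \<in> line_extension D u (Span D us)"
    then obtain e w where y: "e \<in> D" "w \<in> Span D us" "y = e \<otimes> u \<oplus> w"
      by (auto simp: line_extension_mem_iff)
    have "x \<oplus> y = (d \<oplus> e) \<otimes> u \<oplus> (v \<oplus> w)"
      using x y carr[OF x(1)] carr'[OF x(2)] carr[OF y(1)] carr'[OF y(2)] u
      by (simp add: l_distr a_ac)
    then show "x \<oplus> y \<in> line_extension D u (Span D us)"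
      using Dc(1)[OF x(1) y(1)] Sc(1)[OF x(2) y(2)] unfolding line_extension_mem_iff by auto
  qed
qed

lemma Span_mem:
  assumes D: "subgroup D (add_monoid R)" and us: "set us \<subseteq> carrier R" and "d \<in> D" "u \<in> set us"
  shows "d \<otimes> u \<in> Span D us"
  using us assms(4)
proof (induction us)
  case (Cons v us)
  have eq: "Span D (v # us) = line_extension D v (Span D us)" by simp
  have S: "subgroup (Span D us) (add_monoid R)" using Cons by (intro Span_subgroup[OF D]) simp
  have d: "d \<in> carrier R" using subgroup.mem_carrier[OF D assms(3)] by simp
  show ?case
  proof (cases "u = v")
    case True
    then have "d \<otimes> u = d \<otimes> v \<oplus> \<zero>" using Cons.prems d by simp
    then show ?thesis
      unfolding eq line_extension_mem_iff using assms(3) subgroup.one_closed[OF S] by auto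
  next
    case False
    then have "d \<otimes> u \<in> Span D us" using Cons by simp
    moreover have "d \<otimes> u = \<zero> \<otimes> v \<oplus> d \<otimes> u" using Cons.prems d by auto
    ultimately show ?thesis
      unfolding eq line_extension_mem_iff using subgroup.one_closed[OF D] by auto
  qed
qed simp

end

lemma (in abelian_group) add_diff_cancel:
  assumes "x \<in> carrier G" "y \<in> carrier G"
  shows "x \<oplus> y \<ominus> x = y" "x \<ominus> y \<oplus> y = x" "x \<ominus> (x \<ominus> y) = y"
proof -
  have "x \<oplus> y \<ominus> x = (y \<oplus> x) \<oplus> \<ominus> x" using assms by (simp add: a_minus_def a_comm)
  also have "\<dots> = y" using assms by (simp add: a_assoc r_neg)
  finally show "x \<oplus> y \<ominus> x = y" .
  show "x \<ominus> y \<oplus> y = x" using assms by (simp add: a_minus_def a_assoc l_neg)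
  have "x \<ominus> (x \<ominus> y) = x \<oplus> (\<ominus> x \<oplus> y)" using assms by (simp add: a_minus_def minus_add)
  also have "\<dots> = y" using assms by (simp add: a_assoc[symmetric] r_neg)
  finally show "x \<ominus> (x \<ominus> y) = y" .
qed

section \<open>Orders of $K_P$ and orders of $K$\<close>

context order_setup
begin

lemma AP_one: "\<one>\<^bsub>FP\<^esub> \<in> AP"
  using \<iota>_integral[of 1] \<iota>_simps(4) by (simp add: One_fract_def)

lemma AP_zero: "\<zero>\<^bsub>FP\<^esub> \<in> AP"
  using \<iota>_integral[of 0] \<iota>_simps(5) by (simp add: Zero_fract_def)

lemma AP_minus:
  assumes "c \<in> AP"
  shows "\<ominus>\<^bsub>FP\<^esub> c \<in> AP"
proof -
  have c: "c \<in> carrier FP" using assms AP_carrier by blast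
  have "\<iota> (Fract (- 1) 1) \<oplus>\<^bsub>FP\<^esub> \<one>\<^bsub>FP\<^esub> = \<zero>\<^bsub>FP\<^esub>"
    unfolding \<iota>_simps(4,5)[symmetric] \<iota>_simps(2)[symmetric] by (simp add: One_fract_def Zero_fract_def)
  then have "\<iota> (Fract (- 1) 1) \<otimes>\<^bsub>FP\<^esub> c \<oplus>\<^bsub>FP\<^esub> c = \<zero>\<^bsub>FP\<^esub>"
    using KP.C.l_distr[OF \<iota>_simps(1) KP.C.one_closed c, of "Fract (- 1) 1"] c by simp
  then have "\<ominus>\<^bsub>FP\<^esub> c = \<iota> (Fract (- 1) 1) \<otimes>\<^bsub>FP\<^esub> c"
    using c \<iota>_simps(1) by (intro KP.C.minus_equality) auto
  then show ?thesis using AP_closed(2)[OF \<iota>_integral assms] by simp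
qed

lemma completion_at_eq:
  "completion_at f P S = generate (add_monoid T) {pure s a | s a. s \<in> S \<and> a \<in> AP}"
  by (simp add: completion_at_def KP_ring_eq KP_pure_eq)

lemma pure_mem_completion: "s \<in> S \<Longrightarrow> a \<in> AP \<Longrightarrow> pure s a \<in> completion_at f P S"
  unfolding completion_at_eq by (rule generate.incl) blast

lemma completion_subgroup:
  assumes "S \<subseteq> carrier K"
  shows "subgroup (completion_at f P S) (add_monoid T)"
  unfolding completion_at_eq
proof (rule group.generate_is_subgroup[OF KP.T.a_group], clarify)
  fix s a assume "s \<in> S" "a \<in> AP"
  then have "s \<in> carrier K" "a \<in> carrier FP" using assms AP_carrier by blast+
  then show "pure s a \<in> carrier (add_monoid T)" by simp
qed

lemma completion_least:
  assumes "subgroup H (add_monoid T)" "\<And>s a. s \<in> S \<Longrightarrow> a \<in> AP \<Longrightarrow> pure s a \<in> H"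
  shows "completion_at f P S \<subseteq> H"
  unfolding completion_at_eq
  using assms by (intro group.generate_subgroup_incl[OF KP.T.a_group]) auto

lemma T_subgroupI:
  assumes "H \<subseteq> carrier T" "\<zero>\<^bsub>T\<^esub> \<in> H" "\<And>x. x \<in> H \<Longrightarrow> \<ominus>\<^bsub>T\<^esub> x \<in> H"
    "\<And>x y. x \<in> H \<Longrightarrow> y \<in> H \<Longrightarrow> x \<oplus>\<^bsub>T\<^esub> y \<in> H"
  shows "subgroup H (add_monoid T)"
  using assms by (intro KP.T.add.subgroupI) auto

lemma T_subgroupD:
  assumes "subgroup H (add_monoid T)"
  shows "\<zero>\<^bsub>T\<^esub> \<in> H" "x \<in> H \<Longrightarrow> x \<in> carrier T" "x \<in> H \<Longrightarrow> \<ominus>\<^bsub>T\<^esub> x \<in> H"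
    "x \<in> H \<Longrightarrow> y \<in> H \<Longrightarrow> x \<oplus>\<^bsub>T\<^esub> y \<in> H" "x \<in> H \<Longrightarrow> y \<in> H \<Longrightarrow> x \<ominus>\<^bsub>T\<^esub> y \<in> H"
proof -
  show *: "\<zero>\<^bsub>T\<^esub> \<in> H" "x \<in> H \<Longrightarrow> x \<in> carrier T" "x \<in> H \<Longrightarrow> \<ominus>\<^bsub>T\<^esub> x \<in> H"
    "x \<in> H \<Longrightarrow> y \<in> H \<Longrightarrow> x \<oplus>\<^bsub>T\<^esub> y \<in> H" for x y
    using subgroup.one_closed[OF assms] subgroup.mem_carrier[OF assms]
      subgroup.m_inv_closed[OF assms] subgroup.m_closed[OF assms] by (auto simp: a_inv_def)
  show "x \<in> H \<Longrightarrow> y \<in> H \<Longrightarrow> x \<ominus>\<^bsub>T\<^esub> y \<in> H"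
    unfolding a_minus_def using *(3,4) by blast
qed

lemma R_in_K_carrier: "R_in_K f \<subseteq> carrier K"
  by (auto simp: R_in_K_def)

lemma R_completion_subset:
  "completion_at f P (R_in_K f) \<subseteq> {x \<in> carrier T. \<forall>j<degree f. tcoord j x \<in> AP}"
proof (rule completion_least)
  show "subgroup {x \<in> carrier T. \<forall>j<degree f. tcoord j x \<in> AP} (add_monoid T)"
    by (rule T_subgroupI) (auto simp: tcoord_zero tcoord_minus tcoord_add AP_zero AP_minus AP_closed)
  fix s a assume "s \<in> R_in_K f" "a \<in> AP"
  then obtain g where s: "s = K_frac f g 1" by (auto simp: R_in_K_def)
  have a: "a \<in> carrier FP" using \<open>a \<in> AP\<close> AP_carrier by blast
  have "tcoord j (pure s a) = \<iota> (Fract (coeff (mod_monic f g) j) 1) \<otimes>\<^bsub>FP\<^esub> a" for j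
    using a by (simp add: s tcoord_pure coord_K_frac)
  then show "pure s a \<in> {x \<in> carrier T. \<forall>j<degree f. tcoord j x \<in> AP}"
    using AP_closed(2)[OF \<iota>_integral \<open>a \<in> AP\<close>] a s by simp
qed

text \<open>R_P is generated over A_P by 1, x, ..., x^(n-1), so membership means integrality of the
  coordinates.\<close>

lemma R_completion_iff:
  assumes "x \<in> carrier T"
  shows "x \<in> completion_at f P (R_in_K f) \<longleftrightarrow> (\<forall>j<degree f. tcoord j x \<in> AP)"
proof
  assume *: "\<forall>j<degree f. tcoord j x \<in> AP"
  have "range_sum T (\<lambda>j. pure (x_power j) (tcoord j x)) (degree f) \<in> completion_at f P (R_in_K f)"
  proof (rule range_sum_mem[OF completion_subgroup[OF R_in_K_carrier]])
    fix j assume "j < degree f"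
    then show "pure (x_power j) (tcoord j x) \<in> completion_at f P (R_in_K f)"
      using * by (intro pure_mem_completion) (auto simp: x_power_def R_in_K_def)
  qed
  then show "x \<in> completion_at f P (R_in_K f)" using tcoord_expansion[OF assms] by simp
qed (use R_completion_subset in blast)

text \<open>Integrality in the completion is turned back into divisibility in A by
  \<open>\<iota>_AP_iff\<close>, one coordinate at a time.\<close>

lemma K_frac_denominator:
  assumes "\<And>j. j < degree f \<Longrightarrow> \<iota> (Fract (p ^ k) 1) \<otimes>\<^bsub>FP\<^esub> \<iota> (coord j (K_frac f g (p ^ N))) \<in> AP"
  shows "\<exists>h. K_frac f g (p ^ N) = K_frac f h (p ^ k)"
proof -
  let ?g = "mod_monic f g"
  have "p ^ N dvd coeff (smult (p ^ k) ?g) j" for j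
  proof (cases "j < degree f")
    case True
    have "Fract (p ^ k) 1 * coord j (K_frac f g (p ^ N)) = Fract (coeff (smult (p ^ k) ?g) j) (p ^ N)"
      using p_nonzero by (simp add: coord_K_frac)
    then show ?thesis
      using assms[OF True] unfolding \<iota>_simps(3)[symmetric] by (simp only: \<iota>_AP_iff)
  next
    case False
    then show ?thesis by (simp add: coeff_mod_monic)
  qed
  then have "[:p ^ N:] dvd smult (p ^ k) ?g" unfolding const_poly_dvd_iff by blast
  then obtain h where "smult (p ^ k) ?g = [:p ^ N:] * h" by (rule dvdE)
  then have "K_frac f ?g (p ^ N) = K_frac f h (p ^ k)"
    using p_nonzero by (intro K_frac_cong) auto
  then show ?thesis using p_nonzero by (auto simp: K_frac_mod_monic)
qed

lemma K_frac_integral: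
  assumes "\<And>j. j < degree f \<Longrightarrow> \<iota> (coord j (K_frac f g (p ^ N))) \<in> AP"
  shows "K_frac f g (p ^ N) \<in> R_in_K f"
proof -
  have "\<iota> (Fract (p ^ 0) 1) \<otimes>\<^bsub>FP\<^esub> \<iota> (coord j (K_frac f g (p ^ N))) \<in> AP" if "j < degree f" for j
    using assms[OF that] \<iota>_simps(1) by (simp add: One_fract_def[symmetric] \<iota>_simps(4))
  from K_frac_denominator[OF this] show ?thesis by (auto simp: R_in_K_def)
qed

text \<open>K_P = R[1/p] + R_P, from the decomposition of F_P in each coordinate.\<close>

lemma T_decompose:
  assumes x: "x \<in> carrier T"
  shows "\<exists>g N. x \<ominus>\<^bsub>T\<^esub> pure (K_frac f g (p ^ N)) \<one>\<^bsub>FP\<^esub> \<in> completion_at f P (R_in_K f)"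
proof -
  have "\<forall>j. \<exists>a k z. z \<in> AP \<and> tcoord j x = \<iota> (Fract a (p ^ k)) \<oplus>\<^bsub>FP\<^esub> z"
    using FP_decompose[OF tcoord_closed[OF x]] by blast
  then obtain a k z where z: "\<And>j. z j \<in> AP" "\<And>j. tcoord j x = \<iota> (Fract (a j) (p ^ k j)) \<oplus>\<^bsub>FP\<^esub> z j"
    by metis
  \<comment> \<open>The sum is a common upper bound for the exponents of the separate
    coordinates.\<close>
  define N where "N = sum k {..<degree f}"
  define g where "g = (\<Sum>j<degree f. monom (a j * p ^ (N - k j)) j)"
  have coeff_g: "coeff g j = (if j < degree f then a j * p ^ (N - k j) else 0)" for j
    by (simp add: g_def coeff_sum if_distrib cong: if_cong)
  have deg_g: "degree g < degree f"
    using degree_pos coeff_g by (intro degree_lessI) auto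
  let ?y = "K_frac f g (p ^ N)"
  have y: "?y \<in> carrier K" using p_nonzero by simp
  have coord: "coord j ?y = Fract (a j) (p ^ k j)" if "j < degree f" for j
  proof -
    have "k j \<le> N" unfolding N_def using that by (intro member_le_sum) auto
    then have "p ^ N = p ^ (N - k j) * p ^ k j" by (simp flip: power_add)
    then show ?thesis
      using p_nonzero that coeff_g by (simp add: coord_K_frac mod_monic_self[OF deg_g] eq_fract)
  qed
  have "x \<ominus>\<^bsub>T\<^esub> pure ?y \<one>\<^bsub>FP\<^esub> \<in> completion_at f P (R_in_K f)"
  proof (subst R_completion_iff)
    show "x \<ominus>\<^bsub>T\<^esub> pure ?y \<one>\<^bsub>FP\<^esub> \<in> carrier T" using x y by simp
    show "\<forall>j<degree f. tcoord j (x \<ominus>\<^bsub>T\<^esub> pure ?y \<one>\<^bsub>FP\<^esub>) \<in> AP"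
    proof (intro allI impI)
      fix j assume j: "j < degree f"
      have zc: "z j \<in> carrier FP" using z(1) AP_carrier by blast
      have "tcoord j (x \<ominus>\<^bsub>T\<^esub> pure ?y \<one>\<^bsub>FP\<^esub>)
          = (\<iota> (Fract (a j) (p ^ k j)) \<oplus>\<^bsub>FP\<^esub> z j) \<oplus>\<^bsub>FP\<^esub> \<ominus>\<^bsub>FP\<^esub> \<iota> (Fract (a j) (p ^ k j))"
        using x y \<iota>_simps(1) by (simp add: a_minus_def tcoord_add tcoord_minus tcoord_pure coord[OF j] z(2))
      also have "\<dots> = z j"
        unfolding a_minus_def[symmetric] by (rule KP.C.add_diff_cancel(1)[OF \<iota>_simps(1) zc])
      finally show "tcoord j (x \<ominus>\<^bsub>T\<^esub> pure ?y \<one>\<^bsub>FP\<^esub>) \<in> AP" using z(1) by simp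
    qed
  qed
  then show ?thesis by blast
qed

lemma pure_diff_left:
  "x \<in> carrier K \<Longrightarrow> y \<in> carrier K \<Longrightarrow> c \<in> carrier FP
    \<Longrightarrow> pure x c \<ominus>\<^bsub>T\<^esub> pure y c = pure (x \<ominus>\<^bsub>K\<^esub> y) c"
  by (simp add: a_minus_def KP.pure_minus_left KP.pure_add_left)

lemma F_to_K_integral: "F_to_K f (Fract c 1) = K_frac f [:c:] 1"
  by (simp add: F_to_K_Fract)

subsection \<open>An order is determined by its completion\<close>

text \<open>S_P lies in S + R_P. For a = c + p^M z the tensor of s with a splits into c s, which is
  in S, and the tensor of p^M s with z, where p^M s is in R.\<close>

lemma completion_approx:
  assumes S: "p_overorder S"
  shows "completion_at f P S \<subseteq> {x \<in> carrier T. \<exists>s\<in>S. x \<ominus>\<^bsub>T\<^esub> pure s \<one>\<^bsub>FP\<^esub> \<in> completion_at f P (R_in_K f)}"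
    (is "_ \<subseteq> ?H")
proof (rule completion_least)
  let ?R = "completion_at f P (R_in_K f)"
  from S obtain M where sub: "subring S K" and R: "R_in_K f \<subseteq> S"
    and M: "\<forall>x\<in>S. \<exists>g. x = K_frac f g (p ^ M)"
    unfolding p_overorder_def by blast
  note Sc = subringE[OF sub]
  note Rc = T_subgroupD[OF completion_subgroup[OF R_in_K_carrier]]
  have carr: "s \<in> carrier K" if "s \<in> S" for s using Sc(1) that by blast
  show "subgroup ?H (add_monoid T)"
  proof (rule T_subgroupI)
    have "\<zero>\<^bsub>T\<^esub> \<ominus>\<^bsub>T\<^esub> pure \<zero>\<^bsub>K\<^esub> \<one>\<^bsub>FP\<^esub> = \<zero>\<^bsub>T\<^esub>"
      by (simp add: KP.pure_zero_left a_minus_def)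
    with Rc(1) have "\<zero>\<^bsub>T\<^esub> \<ominus>\<^bsub>T\<^esub> pure \<zero>\<^bsub>K\<^esub> \<one>\<^bsub>FP\<^esub> \<in> ?R" by (simp only:)
    then show "\<zero>\<^bsub>T\<^esub> \<in> ?H" using Sc(2) by (intro CollectI conjI KP.T.zero_closed bexI)
    fix x assume "x \<in> ?H"
    then obtain s where s: "x \<in> carrier T" "s \<in> S" "x \<ominus>\<^bsub>T\<^esub> pure s \<one>\<^bsub>FP\<^esub> \<in> ?R" by blast
    have "(\<ominus>\<^bsub>T\<^esub> x) \<ominus>\<^bsub>T\<^esub> pure (\<ominus>\<^bsub>K\<^esub> s) \<one>\<^bsub>FP\<^esub> = \<ominus>\<^bsub>T\<^esub> (x \<ominus>\<^bsub>T\<^esub> pure s \<one>\<^bsub>FP\<^esub>)"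
      using s carr[OF s(2)] by (simp add: a_minus_def KP.pure_minus_left[symmetric] KP.T.minus_add)
    with Rc(3)[OF s(3)] have "(\<ominus>\<^bsub>T\<^esub> x) \<ominus>\<^bsub>T\<^esub> pure (\<ominus>\<^bsub>K\<^esub> s) \<one>\<^bsub>FP\<^esub> \<in> ?R" by (simp only:)
    then show "\<ominus>\<^bsub>T\<^esub> x \<in> ?H" using Sc(5)[OF s(2)] by (intro CollectI conjI bexI KP.T.a_inv_closed s(1))
    fix y assume "y \<in> ?H"
    then obtain t where t: "y \<in> carrier T" "t \<in> S" "y \<ominus>\<^bsub>T\<^esub> pure t \<one>\<^bsub>FP\<^esub> \<in> ?R" by blast
    have "(x \<oplus>\<^bsub>T\<^esub> y) \<ominus>\<^bsub>T\<^esub> pure (s \<oplus>\<^bsub>K\<^esub> t) \<one>\<^bsub>FP\<^esub>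
        = (x \<ominus>\<^bsub>T\<^esub> pure s \<one>\<^bsub>FP\<^esub>) \<oplus>\<^bsub>T\<^esub> (y \<ominus>\<^bsub>T\<^esub> pure t \<one>\<^bsub>FP\<^esub>)"
      using s t carr[OF s(2)] carr[OF t(2)]
      by (simp add: a_minus_def KP.pure_add_left KP.T.minus_add KP.T.a_ac)
    with Rc(4)[OF s(3) t(3)] have "(x \<oplus>\<^bsub>T\<^esub> y) \<ominus>\<^bsub>T\<^esub> pure (s \<oplus>\<^bsub>K\<^esub> t) \<one>\<^bsub>FP\<^esub> \<in> ?R" by (simp only:)
    then show "x \<oplus>\<^bsub>T\<^esub> y \<in> ?H"
      using Sc(7)[OF s(2) t(2)] by (intro CollectI conjI bexI KP.T.a_closed s(1) t(1))
  qed (auto)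
  fix s a assume s: "s \<in> S" and a: "a \<in> AP"
  obtain c z where z: "z \<in> AP" "a = \<iota> (Fract c 1) \<oplus>\<^bsub>FP\<^esub> \<iota> (Fract (p ^ M) 1) \<otimes>\<^bsub>FP\<^esub> z"
    using AP_decompose[OF a] by blast
  have zc: "z \<in> carrier FP" using z(1) AP_carrier by blast
  obtain g where g: "s = K_frac f g (p ^ M)" using M s by blast
  define t where "t = K_frac f [:c:] 1 \<otimes>\<^bsub>K\<^esub> s"
  have t: "t \<in> S" unfolding t_def using Sc(6) R_in_order[OF R] s by blast
  have 1: "pure s (\<iota> (Fract c 1)) = pure t \<one>\<^bsub>FP\<^esub>"
    using KP.pure_balanced[OF carr[OF s] KP.C.one_closed, of "Fract c 1"] \<iota>_simps(1)
    by (simp add: t_def F_to_K_integral)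
  have "K_frac f [:p ^ M:] 1 \<otimes>\<^bsub>K\<^esub> s = K_frac f (smult (p ^ M) g) (p ^ (0 + M))"
    using p_nonzero by (simp add: g K_frac_scale)
  also have "\<dots> = K_frac f g 1" unfolding K_frac_cancel by simp
  finally have 2: "pure s (\<iota> (Fract (p ^ M) 1) \<otimes>\<^bsub>FP\<^esub> z) = pure (K_frac f g 1) z"
    using KP.pure_balanced[OF carr[OF s] zc, of "Fract (p ^ M) 1"]
    by (simp add: F_to_K_integral)
  have "pure s a = pure t \<one>\<^bsub>FP\<^esub> \<oplus>\<^bsub>T\<^esub> pure (K_frac f g 1) z"
    unfolding z(2) using KP.pure_add_right[OF carr[OF s] \<iota>_simps(1) KP.C.m_closed[OF \<iota>_simps(1) zc]] 1 2
    by simp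
  then have "pure s a \<ominus>\<^bsub>T\<^esub> pure t \<one>\<^bsub>FP\<^esub> = pure (K_frac f g 1) z"
    using KP.T.add_diff_cancel(1)[of "pure t \<one>\<^bsub>FP\<^esub>" "pure (K_frac f g 1) z"] carr[OF t] zc by simp
  moreover have "pure (K_frac f g 1) z \<in> ?R"
    using z(1) by (intro pure_mem_completion) (auto simp: R_in_K_def)
  moreover have "a \<in> carrier FP" using a AP_carrier by blast
  ultimately show "pure s a \<in> ?H"
    using t carr[OF s] by (intro CollectI conjI bexI[OF _ t] KP.pure_closed) simp_all
qed

text \<open>S_P meets R[1/p] in S: if y differs from s in S by an element of R_P, then y - s lies in
  R[1/p] and has integral coordinates, so it is in R.\<close>

lemma completion_recover:
  assumes S: "p_overorder S" and y: "pure (K_frac f g (p ^ N)) \<one>\<^bsub>FP\<^esub> \<in> completion_at f P S"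
  shows "K_frac f g (p ^ N) \<in> S"
proof -
  let ?y = "K_frac f g (p ^ N)"
  from S obtain M where sub: "subring S K" and R: "R_in_K f \<subseteq> S"
    and M: "\<forall>x\<in>S. \<exists>g. x = K_frac f g (p ^ M)"
    unfolding p_overorder_def by blast
  note Sc = subringE[OF sub]
  have yc: "?y \<in> carrier K" using p_nonzero by simp
  obtain s where s: "s \<in> S" "pure ?y \<one>\<^bsub>FP\<^esub> \<ominus>\<^bsub>T\<^esub> pure s \<one>\<^bsub>FP\<^esub> \<in> completion_at f P (R_in_K f)"
    using completion_approx[OF S] y by blast
  have sc: "s \<in> carrier K" using s(1) Sc(1) by blast
  obtain h where h: "s = K_frac f h (p ^ M)" using M s(1) by blast
  have "?y \<ominus>\<^bsub>K\<^esub> s = K_frac f (smult (p ^ M) g + smult (p ^ N) (- h)) (p ^ N * p ^ M)"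
    using p_nonzero by (simp add: h a_minus_def K_frac_minus K_frac_add)
  then have eq: "?y \<ominus>\<^bsub>K\<^esub> s = K_frac f (smult (p ^ M) g + smult (p ^ N) (- h)) (p ^ (N + M))"
    by (simp add: power_add)
  have dc: "?y \<ominus>\<^bsub>K\<^esub> s \<in> carrier K" using yc sc by simp
  have "pure (?y \<ominus>\<^bsub>K\<^esub> s) \<one>\<^bsub>FP\<^esub> \<in> completion_at f P (R_in_K f)"
    using s(2) yc sc by (simp add: pure_diff_left)
  then have "\<forall>j<degree f. tcoord j (pure (?y \<ominus>\<^bsub>K\<^esub> s) \<one>\<^bsub>FP\<^esub>) \<in> AP"
    using dc by (subst (asm) R_completion_iff) simp_all
  then have "\<iota> (coord j (?y \<ominus>\<^bsub>K\<^esub> s)) \<in> AP" if "j < degree f" for j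
    using that dc \<iota>_simps(1) by (simp add: tcoord_pure)
  then have "?y \<ominus>\<^bsub>K\<^esub> s \<in> R_in_K f"
    unfolding eq by (rule K_frac_integral)
  then have "(?y \<ominus>\<^bsub>K\<^esub> s) \<oplus>\<^bsub>K\<^esub> s \<in> S" using R Sc(7) s(1) by blast
  moreover have "(?y \<ominus>\<^bsub>K\<^esub> s) \<oplus>\<^bsub>K\<^esub> s = ?y"
    by (rule KP.B.add_diff_cancel(2)[OF yc sc])
  ultimately show ?thesis by simp
qed

lemma completion_inj: "inj_on (completion_at f P) {S. p_overorder S}"
proof (rule inj_onI)
  have "S \<subseteq> S'" if S: "p_overorder S" and S': "p_overorder S'"
    and eq: "completion_at f P S = completion_at f P S'" for S S'
  proof
    fix y assume y: "y \<in> S"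
    then obtain g N where g: "y = K_frac f g (p ^ N)" using S unfolding p_overorder_def by blast
    have "pure y \<one>\<^bsub>FP\<^esub> \<in> completion_at f P S'"
      using pure_mem_completion[OF y AP_one] eq by simp
    then show "y \<in> S'" unfolding g by (rule completion_recover[OF S'])
  qed
  then show "S = S'" if "S \<in> {S. p_overorder S}" "S' \<in> {S. p_overorder S}"
    "completion_at f P S = completion_at f P S'" for S S'
    using that by (metis mem_Collect_eq subset_antisym)
qed

subsection \<open>The completion of an order is an order\<close>

lemma AP_in_KP_eq: "AP_in_KP f P = pure \<one>\<^bsub>K\<^esub> ` AP" and FP_in_KP_eq: "FP_in_KP f P = pure \<one>\<^bsub>K\<^esub> ` carrier FP"
  by (simp_all add: AP_in_KP_def FP_in_KP_def KP_pure_eq)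

lemma pure_one_image_subgroup:
  assumes "C \<subseteq> carrier FP" "\<zero>\<^bsub>FP\<^esub> \<in> C" "\<And>c. c \<in> C \<Longrightarrow> \<ominus>\<^bsub>FP\<^esub> c \<in> C"
    "\<And>c d. c \<in> C \<Longrightarrow> d \<in> C \<Longrightarrow> c \<oplus>\<^bsub>FP\<^esub> d \<in> C"
  shows "subgroup (pure \<one>\<^bsub>K\<^esub> ` C) (add_monoid T)"
proof (rule T_subgroupI)
  show "pure \<one>\<^bsub>K\<^esub> ` C \<subseteq> carrier T" using assms(1) by auto
  have "pure \<one>\<^bsub>K\<^esub> \<zero>\<^bsub>FP\<^esub> = \<zero>\<^bsub>T\<^esub>" by (simp add: KP.pure_zero_right)
  then show "\<zero>\<^bsub>T\<^esub> \<in> pure \<one>\<^bsub>K\<^esub> ` C" using assms(2) by (metis image_eqI)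
  fix x assume "x \<in> pure \<one>\<^bsub>K\<^esub> ` C"
  then obtain c where c: "c \<in> C" "x = pure \<one>\<^bsub>K\<^esub> c" by blast
  have cc: "c \<in> carrier FP" using c(1) assms(1) by blast
  have "pure \<one>\<^bsub>K\<^esub> (\<ominus>\<^bsub>FP\<^esub> c) \<oplus>\<^bsub>T\<^esub> x = \<zero>\<^bsub>T\<^esub>"
    using cc KP.pure_add_right[of "\<one>\<^bsub>K\<^esub>" "\<ominus>\<^bsub>FP\<^esub> c" c] by (simp add: c(2) KP.C.l_neg KP.pure_zero_right)
  then have "\<ominus>\<^bsub>T\<^esub> x = pure \<one>\<^bsub>K\<^esub> (\<ominus>\<^bsub>FP\<^esub> c)"
    using cc by (intro KP.T.minus_equality) (simp_all add: c(2))
  then show "\<ominus>\<^bsub>T\<^esub> x \<in> pure \<one>\<^bsub>K\<^esub> ` C" using assms(3)[OF c(1)] by blast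
  fix y assume "y \<in> pure \<one>\<^bsub>K\<^esub> ` C"
  then obtain d where d: "d \<in> C" "y = pure \<one>\<^bsub>K\<^esub> d" by blast
  have dc: "d \<in> carrier FP" using d(1) assms(1) by blast
  have "x \<oplus>\<^bsub>T\<^esub> y = pure \<one>\<^bsub>K\<^esub> (c \<oplus>\<^bsub>FP\<^esub> d)"
    using cc dc by (simp add: c(2) d(2) KP.pure_add_right)
  then show "x \<oplus>\<^bsub>T\<^esub> y \<in> pure \<one>\<^bsub>K\<^esub> ` C" using assms(4)[OF c(1) d(1)] by blast
qed

lemma AP_in_KP_subgroup: "subgroup (AP_in_KP f P) (add_monoid T)"
  unfolding AP_in_KP_eq
  by (rule pure_one_image_subgroup) (auto simp: AP_carrier AP_zero AP_minus AP_closed)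

lemma FP_in_KP_subgroup: "subgroup (FP_in_KP f P) (add_monoid T)"
  unfolding FP_in_KP_eq by (rule pure_one_image_subgroup) auto

lemma pure_factor:
  "b \<in> carrier K \<Longrightarrow> c \<in> carrier FP \<Longrightarrow> pure b c = pure \<one>\<^bsub>K\<^esub> c \<otimes>\<^bsub>T\<^esub> pure b \<one>\<^bsub>FP\<^esub>"
  by (simp add: KP.pure_mult)

lemma completion_mult_closed:
  assumes S: "subring S K" and x: "x \<in> completion_at f P S" and y: "y \<in> completion_at f P S"
  shows "x \<otimes>\<^bsub>T\<^esub> y \<in> completion_at f P S"
proof -
  let ?C = "completion_at f P S"
  note Sc = subringE[OF S]
  note C = T_subgroupD[OF completion_subgroup[OF Sc(1)]]
  have sub: "subgroup {y \<in> carrier T. x \<otimes>\<^bsub>T\<^esub> y \<in> ?C} (add_monoid T)" if "x \<in> carrier T" for x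
    using that by (intro T_subgroupI) (auto simp: C KP.T.r_minus KP.T.r_distr)
  have carr: "s \<in> carrier K" "a \<in> carrier FP" if "s \<in> S" "a \<in> AP" for s a
    using that Sc(1) AP_carrier by auto
  have 1: "pure s a \<otimes>\<^bsub>T\<^esub> y \<in> ?C" if s: "s \<in> S" and a: "a \<in> AP" and y: "y \<in> ?C" for s a y
  proof -
    have "?C \<subseteq> {y \<in> carrier T. pure s a \<otimes>\<^bsub>T\<^esub> y \<in> ?C}"
    proof (rule completion_least[OF sub])
      fix t b assume t: "t \<in> S" "b \<in> AP"
      have "pure s a \<otimes>\<^bsub>T\<^esub> pure t b = pure (s \<otimes>\<^bsub>K\<^esub> t) (a \<otimes>\<^bsub>FP\<^esub> b)"
        using carr[OF s a] carr[OF t] by (simp add: KP.pure_mult)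
      then show "pure t b \<in> {y \<in> carrier T. pure s a \<otimes>\<^bsub>T\<^esub> y \<in> ?C}"
        using pure_mem_completion[OF Sc(6)[OF s t(1)] AP_closed(2)[OF a t(2)]] carr[OF t] by simp
    qed (use carr[OF s a] in simp)
    then show ?thesis using y by blast
  qed
  \<comment> \<open>The first factor was a generator so far; by commutativity it is now extended to
    the whole completion in the same way.\<close>
  have "?C \<subseteq> {x \<in> carrier T. y \<otimes>\<^bsub>T\<^esub> x \<in> ?C}"
  proof (rule completion_least[OF sub])
    show "y \<in> carrier T" by (rule C(2)[OF y])
    fix s a assume s: "s \<in> S" "a \<in> AP"
    then show "pure s a \<in> {x \<in> carrier T. y \<otimes>\<^bsub>T\<^esub> x \<in> ?C}"
      using 1[OF s y] KP.T.m_comm[OF C(2)[OF y] KP.pure_closed[OF carr[OF s]]] carr[OF s] by simp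
  qed
  then have "y \<otimes>\<^bsub>T\<^esub> x \<in> ?C" using x by blast
  then show ?thesis using KP.T.m_comm[OF C(2)[OF x] C(2)[OF y]] by simp
qed

text \<open>Generators of a module over A generate its completion over A_P, because scalars from A
  cross the tensor sign.\<close>

lemma pure_span:
  assumes "d \<noteq> 0" "g \<in> poly_span us" "a \<in> AP"
  shows "pure (K_frac f g d) a \<in> KP.T.Span (AP_in_KP f P) (map (\<lambda>g. pure (K_frac f g d) \<one>\<^bsub>FP\<^esub>) us)"
  using assms(2)
proof (induction us arbitrary: g)
  case Nil
  then show ?case using assms AP_carrier by (simp add: K_frac_0 KP.pure_zero_left subset_iff)
next
  case (Cons u us)
  have a: "a \<in> carrier FP" using assms(3) AP_carrier by blast
  obtain c h where g: "g = smult c u + h" "h \<in> poly_span us" using Cons.prems by auto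
  have "K_frac f g d = K_frac f [:c:] 1 \<otimes>\<^bsub>K\<^esub> K_frac f u d \<oplus>\<^bsub>K\<^esub> K_frac f h d"
    using assms(1) by (simp add: g K_frac_scale K_frac_same_denominator_add)
  then have "pure (K_frac f g d) a
      = pure (F_to_K f (Fract c 1) \<otimes>\<^bsub>K\<^esub> K_frac f u d) a \<oplus>\<^bsub>T\<^esub> pure (K_frac f h d) a"
    using assms(1) a by (simp add: F_to_K_integral KP.pure_add_left)
  also have "pure (F_to_K f (Fract c 1) \<otimes>\<^bsub>K\<^esub> K_frac f u d) a
      = pure (K_frac f u d) (\<iota> (Fract c 1) \<otimes>\<^bsub>FP\<^esub> a)"
    using assms(1) a by (intro KP.pure_balanced) auto
  also have "\<dots> = pure \<one>\<^bsub>K\<^esub> (\<iota> (Fract c 1) \<otimes>\<^bsub>FP\<^esub> a) \<otimes>\<^bsub>T\<^esub> pure (K_frac f u d) \<one>\<^bsub>FP\<^esub>"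
    using assms(1) a \<iota>_simps(1) by (intro pure_factor) auto
  finally have "pure (K_frac f g d) a = pure \<one>\<^bsub>K\<^esub> (\<iota> (Fract c 1) \<otimes>\<^bsub>FP\<^esub> a) \<otimes>\<^bsub>T\<^esub> pure (K_frac f u d) \<one>\<^bsub>FP\<^esub>
      \<oplus>\<^bsub>T\<^esub> pure (K_frac f h d) a" .
  moreover have "pure \<one>\<^bsub>K\<^esub> (\<iota> (Fract c 1) \<otimes>\<^bsub>FP\<^esub> a) \<in> AP_in_KP f P"
    unfolding AP_in_KP_eq using AP_closed(2)[OF \<iota>_integral assms(3)] by blast
  ultimately show ?case
    using Cons.IH[OF g(2)] unfolding list.map KP.T.Span.simps foldr.simps comp_def KP.T.line_extension_mem_iff
    by blast
qed

lemma completion_overorder: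
  assumes S: "p_overorder S"
  shows "completion_at f P S \<in> AP_overorders f P"
proof -
  let ?C = "completion_at f P S"
  have sub: "subring S K" and R: "R_in_K f \<subseteq> S" using S by (auto simp: p_overorder_def)
  note Sc = subringE[OF sub]
  note Csub = completion_subgroup[OF Sc(1)]
  note C = T_subgroupD[OF Csub]
  have RC: "completion_at f P (R_in_K f) \<subseteq> ?C"
    using R by (intro completion_least[OF Csub] pure_mem_completion) auto
  have ring: "subring ?C T"
  proof (rule KP.T.subringI)
    show "\<one>\<^bsub>T\<^esub> \<in> ?C" unfolding KP.pure_one by (rule pure_mem_completion[OF Sc(3) AP_one])
  qed (use C completion_mult_closed[OF sub] in auto)
  let ?M = "exponent_bound f"
  obtain us where us: "S = order_of ?M (poly_span us)"
    using p_overorder_listed[OF S] by blast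
  let ?us = "map (\<lambda>g. pure (K_frac f g (p ^ ?M)) \<one>\<^bsub>FP\<^esub>) us"
  have us_carrier: "set ?us \<subseteq> carrier T" using p_nonzero by auto
  have "?C = KP.T.Span (AP_in_KP f P) ?us"
  proof
    show "?C \<subseteq> KP.T.Span (AP_in_KP f P) ?us"
    proof (rule completion_least[OF KP.T.Span_subgroup[OF AP_in_KP_subgroup us_carrier]])
      fix s a assume "s \<in> S" "a \<in> AP"
      then show "pure s a \<in> KP.T.Span (AP_in_KP f P) ?us"
        using pure_span[OF p_nonzero(2)] unfolding us order_of_def by blast
    qed
    show "KP.T.Span (AP_in_KP f P) ?us \<subseteq> ?C"
    proof (rule KP.T.Span_least[OF Csub])
      fix d u assume "d \<in> AP_in_KP f P" "u \<in> set ?us"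
      then obtain a g where *: "a \<in> AP" "d = pure \<one>\<^bsub>K\<^esub> a" "g \<in> set us"
        "u = pure (K_frac f g (p ^ ?M)) \<one>\<^bsub>FP\<^esub>"
        by (auto simp: AP_in_KP_eq)
      have "K_frac f g (p ^ ?M) \<in> S"
        using *(3) poly_span_superset[of us] unfolding us order_of_def by blast
      moreover have "d \<otimes>\<^bsub>T\<^esub> u = pure (K_frac f g (p ^ ?M)) a"
        unfolding *(2,4) using p_nonzero *(1) AP_carrier by (intro pure_factor[symmetric]) auto
      ultimately show "d \<otimes>\<^bsub>T\<^esub> u \<in> ?C" using pure_mem_completion *(1) by simp
    qed
  qed
  moreover have "\<exists>us. set us \<subseteq> ?C \<and> x \<in> KP.T.Span (FP_in_KP f P) us" if x: "x \<in> carrier T" for x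
  proof -
    \<comment> \<open>The powers of x lie in R and span K_P over F_P.\<close>
    let ?vs = "map (\<lambda>j. pure (x_power j) \<one>\<^bsub>FP\<^esub>) [0..<degree f]"
    have vs: "set ?vs \<subseteq> carrier T" by auto
    have "pure (x_power j) (tcoord j x) \<in> KP.T.Span (FP_in_KP f P) ?vs" if j: "j < degree f" for j
    proof (subst pure_factor)
      show "pure \<one>\<^bsub>K\<^esub> (tcoord j x) \<otimes>\<^bsub>T\<^esub> pure (x_power j) \<one>\<^bsub>FP\<^esub> \<in> KP.T.Span (FP_in_KP f P) ?vs"
        using tcoord_closed[OF x] j
        by (intro KP.T.Span_mem[OF FP_in_KP_subgroup vs]) (auto simp: FP_in_KP_eq)
    qed (simp_all add: tcoord_closed[OF x])
    then have "range_sum T (\<lambda>j. pure (x_power j) (tcoord j x)) (degree f)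
        \<in> KP.T.Span (FP_in_KP f P) ?vs"
      by (intro range_sum_mem KP.T.Span_subgroup[OF FP_in_KP_subgroup vs])
    then have "x \<in> KP.T.Span (FP_in_KP f P) ?vs" using tcoord_expansion[OF x] by simp
    moreover have "set ?vs \<subseteq> ?C"
      using R AP_one by (auto simp: x_power_def R_in_order intro!: pure_mem_completion)
    ultimately show ?thesis by blast
  qed
  ultimately have "is_order T (AP_in_KP f P) (FP_in_KP f P) ?C"
    unfolding is_order_def using ring us_carrier by blast
  then show ?thesis
    using RC by (simp add: AP_overorders_def KP_ring_eq)
qed

subsection \<open>Every order of $K_P$ is a completion\<close>

text \<open>This is p^-k R_P, described by coordinates.\<close>

definition bounded_part :: "nat \<Rightarrow> 'a KPelem set" where
  "bounded_part k = {x \<in> carrier T. \<forall>j<degree f. \<iota> (Fract (p ^ k) 1) \<otimes>\<^bsub>FP\<^esub> tcoord j x \<in> AP}"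

lemma bounded_part_subgroup: "subgroup (bounded_part k) (add_monoid T)"
  unfolding bounded_part_def using \<iota>_simps(1)[of "Fract (p ^ k) 1"]
  by (intro T_subgroupI)
    (auto simp: tcoord_zero tcoord_minus tcoord_add tcoord_closed AP_zero AP_minus AP_closed
      KP.C.r_minus KP.C.r_distr)

lemma \<iota>_p_power_add:
  "\<iota> (Fract (p ^ (k + l)) 1) = \<iota> (Fract (p ^ k) 1) \<otimes>\<^bsub>FP\<^esub> \<iota> (Fract (p ^ l) 1)"
  unfolding p_fract(3)[symmetric] by (rule \<iota>_simps(3))

lemma bounded_part_scale:
  assumes "c \<in> carrier FP" "\<iota> (Fract (p ^ k) 1) \<otimes>\<^bsub>FP\<^esub> c \<in> AP" "k \<le> l"
  shows "\<iota> (Fract (p ^ l) 1) \<otimes>\<^bsub>FP\<^esub> c \<in> AP"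
proof -
  have "\<iota> (Fract (p ^ (l - k + k)) 1) \<otimes>\<^bsub>FP\<^esub> c
      = \<iota> (Fract (p ^ (l - k)) 1) \<otimes>\<^bsub>FP\<^esub> (\<iota> (Fract (p ^ k) 1) \<otimes>\<^bsub>FP\<^esub> c)"
    unfolding \<iota>_p_power_add using assms(1) \<iota>_simps(1) by (intro KP.C.m_assoc)
  also have "\<dots> \<in> AP" by (intro AP_closed(2) \<iota>_integral assms(2))
  finally show ?thesis using assms(3) by simp
qed

lemma bounded_part_mono: "k \<le> l \<Longrightarrow> bounded_part k \<subseteq> bounded_part l"
  unfolding bounded_part_def using bounded_part_scale tcoord_closed by blast

lemma bounded_part_exhaust:
  assumes x: "x \<in> carrier T"
  shows "\<exists>k. x \<in> bounded_part k"
proof -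
  have "\<exists>k. \<iota> (Fract (p ^ k) 1) \<otimes>\<^bsub>FP\<^esub> tcoord j x \<in> AP" for j
  proof -
    obtain a k z where z: "z \<in> AP" "tcoord j x = \<iota> (Fract a (p ^ k)) \<oplus>\<^bsub>FP\<^esub> z"
      using FP_decompose[OF tcoord_closed[OF x]] by blast
    have zc: "z \<in> carrier FP" using z(1) AP_carrier by blast
    have "\<iota> (Fract (p ^ k) 1) \<otimes>\<^bsub>FP\<^esub> tcoord j x
        = \<iota> (Fract (p ^ k) 1) \<otimes>\<^bsub>FP\<^esub> \<iota> (Fract a (p ^ k)) \<oplus>\<^bsub>FP\<^esub> \<iota> (Fract (p ^ k) 1) \<otimes>\<^bsub>FP\<^esub> z"
      unfolding z(2) by (intro KP.C.r_distr \<iota>_simps(1) zc)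
    also have "\<iota> (Fract (p ^ k) 1) \<otimes>\<^bsub>FP\<^esub> \<iota> (Fract a (p ^ k)) = \<iota> (Fract a 1)"
      unfolding \<iota>_simps(3)[symmetric] mult.commute[of "Fract (p ^ k) 1"] p_fract(2) ..
    also have "\<iota> (Fract a 1) \<oplus>\<^bsub>FP\<^esub> \<iota> (Fract (p ^ k) 1) \<otimes>\<^bsub>FP\<^esub> z \<in> AP"
      by (intro AP_closed \<iota>_integral z(1))
    finally show ?thesis by blast
  qed
  then obtain k where k: "\<And>j. \<iota> (Fract (p ^ k j) 1) \<otimes>\<^bsub>FP\<^esub> tcoord j x \<in> AP" by metis
  have "\<iota> (Fract (p ^ sum k {..<degree f}) 1) \<otimes>\<^bsub>FP\<^esub> tcoord j x \<in> AP" if "j < degree f" for j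
    using that by (intro bounded_part_scale[OF tcoord_closed[OF x] k] member_le_sum) auto
  then show ?thesis using x unfolding bounded_part_def by blast
qed

lemma bounded_part_list: "set us \<subseteq> carrier T \<Longrightarrow> \<exists>k. set us \<subseteq> bounded_part k"
proof (induction us)
  case (Cons u us)
  then obtain k l where "u \<in> bounded_part k" "set us \<subseteq> bounded_part l"
    using bounded_part_exhaust[of u] by auto
  then show ?case
    using bounded_part_mono[of k "max k l"] bounded_part_mono[of l "max k l"]
    by (intro exI[of _ "max k l"]) auto
qed simp

lemma completion_surj:
  assumes "S' \<in> AP_overorders f P"
  shows "\<exists>S. p_overorder S \<and> completion_at f P S = S'"
proof -
  let ?R = "completion_at f P (R_in_K f)"
  from assms have ord: "is_order T (AP_in_KP f P) (FP_in_KP f P) S'" and R: "?R \<subseteq> S'"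
    by (auto simp: AP_overorders_def KP_ring_eq)
  from ord obtain us where sub: "subring S' T" and us: "set us \<subseteq> carrier T"
    "S' = KP.T.Span (AP_in_KP f P) us"
    unfolding is_order_def by blast
  note S' = subringE[OF sub]
  have S'_sub: "subgroup S' (add_monoid T)"
    by (rule T_subgroupI) (use S' in auto)
  define S where "S = {y. (\<exists>g N. y = K_frac f g (p ^ N)) \<and> pure y \<one>\<^bsub>FP\<^esub> \<in> S'}"
  have carr: "y \<in> carrier K" if "y \<in> S" for y using that p_nonzero by (auto simp: S_def)
  have R_S: "K_frac f g 1 \<in> S" for g
  proof -
    have "pure (K_frac f g 1) \<one>\<^bsub>FP\<^esub> \<in> S'"
      using R pure_mem_completion[OF _ AP_one, of "K_frac f g 1" "R_in_K f"] by (auto simp: R_in_K_def)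
    moreover have "K_frac f g 1 = K_frac f g (p ^ 0)" by simp
    ultimately show ?thesis unfolding S_def by blast
  qed
  have S_sub: "subring S K"
  proof (rule ring.subringI[OF ring_K])
    show "S \<subseteq> carrier K" using carr by blast
    show "\<one>\<^bsub>K\<^esub> \<in> S" unfolding K_one by (rule R_S)
    fix x assume x: "x \<in> S"
    then obtain g N where g: "x = K_frac f g (p ^ N)" and xS: "pure x \<one>\<^bsub>FP\<^esub> \<in> S'" by (auto simp: S_def)
    have "pure (\<ominus>\<^bsub>K\<^esub> x) \<one>\<^bsub>FP\<^esub> \<in> S'"
      using S'(5)[OF xS] carr[OF x] by (simp add: KP.pure_minus_left)
    moreover have "\<ominus>\<^bsub>K\<^esub> x = K_frac f (- g) (p ^ N)" using p_nonzero by (simp add: g K_frac_minus)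
    ultimately show "\<ominus>\<^bsub>K\<^esub> x \<in> S" unfolding S_def by blast
    fix y assume y: "y \<in> S"
    then obtain h M where h: "y = K_frac f h (p ^ M)" and yS: "pure y \<one>\<^bsub>FP\<^esub> \<in> S'" by (auto simp: S_def)
    have "pure (x \<otimes>\<^bsub>K\<^esub> y) \<one>\<^bsub>FP\<^esub> \<in> S'"
      using S'(6)[OF xS yS] carr[OF x] carr[OF y] by (simp add: KP.pure_mult)
    then show "x \<otimes>\<^bsub>K\<^esub> y \<in> S" unfolding S_def g h K_frac_p_power_mult by blast
    have "pure (x \<oplus>\<^bsub>K\<^esub> y) \<one>\<^bsub>FP\<^esub> \<in> S'"
      using S'(7)[OF xS yS] carr[OF x] carr[OF y] by (simp add: KP.pure_add_left)
    moreover have "x \<oplus>\<^bsub>K\<^esub> y = K_frac f (smult (p ^ M) g + smult (p ^ N) h) (p ^ (N + M))"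
      using p_nonzero by (simp add: g h K_frac_add power_add)
    ultimately show "x \<oplus>\<^bsub>K\<^esub> y \<in> S" unfolding S_def by blast
  qed
  \<comment> \<open>Finite generation over A_P gives all of S' a common denominator p^k, which then
    bounds the denominators in \<open>S\<close>.\<close>
  obtain k where k: "set us \<subseteq> bounded_part k" using bounded_part_list[OF us(1)] by blast
  have "S' \<subseteq> bounded_part k"
    unfolding us(2)
  proof (rule KP.T.Span_least[OF bounded_part_subgroup])
    fix d u assume "d \<in> AP_in_KP f P" and u: "u \<in> set us"
    then obtain a where a: "a \<in> AP" "d = pure \<one>\<^bsub>K\<^esub> a" by (auto simp: AP_in_KP_eq)
    have ac: "a \<in> carrier FP" using a(1) AP_carrier by blast
    have uk: "u \<in> carrier T" "\<And>j. j < degree f \<Longrightarrow> \<iota> (Fract (p ^ k) 1) \<otimes>\<^bsub>FP\<^esub> tcoord j u \<in> AP"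
      using k u by (auto simp: bounded_part_def)
    have "\<iota> (Fract (p ^ k) 1) \<otimes>\<^bsub>FP\<^esub> tcoord j (d \<otimes>\<^bsub>T\<^esub> u) \<in> AP" if "j < degree f" for j
    proof -
      have "\<iota> (Fract (p ^ k) 1) \<otimes>\<^bsub>FP\<^esub> tcoord j (d \<otimes>\<^bsub>T\<^esub> u)
          = a \<otimes>\<^bsub>FP\<^esub> (\<iota> (Fract (p ^ k) 1) \<otimes>\<^bsub>FP\<^esub> tcoord j u)"
        unfolding a(2) tcoord_scale[OF ac uk(1)]
        using ac tcoord_closed[OF uk(1)] \<iota>_simps(1) by (intro KP.C.m_lcomm)
      then show ?thesis using AP_closed(2)[OF a(1) uk(2)[OF that]] by simp
    qed
    then show "d \<otimes>\<^bsub>T\<^esub> u \<in> bounded_part k"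
      using uk(1) ac by (simp add: bounded_part_def a(2))
  qed
  have "\<exists>h. y = K_frac f h (p ^ k)" if y: "y \<in> S" for y
  proof -
    obtain g N where g: "y = K_frac f g (p ^ N)" and "pure y \<one>\<^bsub>FP\<^esub> \<in> S'" using y by (auto simp: S_def)
    then have "pure y \<one>\<^bsub>FP\<^esub> \<in> bounded_part k" using \<open>S' \<subseteq> bounded_part k\<close> by blast
    then have "\<iota> (Fract (p ^ k) 1) \<otimes>\<^bsub>FP\<^esub> \<iota> (coord j y) \<in> AP" if "j < degree f" for j
      using that carr[OF y] \<iota>_simps(1) by (simp add: bounded_part_def tcoord_pure)
    then show ?thesis unfolding g by (rule K_frac_denominator)
  qed
  then have S: "p_overorder S"
    unfolding p_overorder_def using S_sub R_S by (auto simp: R_in_K_def)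
  moreover have "completion_at f P S = S'"
  proof
    show "completion_at f P S \<subseteq> S'"
    proof (rule completion_least[OF S'_sub])
      fix s a assume s: "s \<in> S" and a: "a \<in> AP"
      have "pure \<one>\<^bsub>K\<^esub> a \<in> S'"
        using R pure_mem_completion[OF _ a, of "\<one>\<^bsub>K\<^esub>" "R_in_K f"] by (auto simp: R_in_K_def K_one)
      moreover have "pure s \<one>\<^bsub>FP\<^esub> \<in> S'" using s by (simp add: S_def)
      ultimately have "pure \<one>\<^bsub>K\<^esub> a \<otimes>\<^bsub>T\<^esub> pure s \<one>\<^bsub>FP\<^esub> \<in> S'" by (rule S'(6))
      then show "pure s a \<in> S'" using pure_factor[of s a] carr[OF s] a AP_carrier by auto
    qed
    show "S' \<subseteq> completion_at f P S"
    proof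
      fix x assume x: "x \<in> S'"
      then have xc: "x \<in> carrier T" using S'(1) by blast
      \<comment> \<open>The difference lies in R_P and hence in S'. So the subtracted element lies
        both in S' and in R[1/p], that is, it comes from \<open>S\<close>.\<close>
      obtain g N where g: "x \<ominus>\<^bsub>T\<^esub> pure (K_frac f g (p ^ N)) \<one>\<^bsub>FP\<^esub> \<in> ?R"
        using T_decompose[OF xc] by blast
      let ?y = "K_frac f g (p ^ N)"
      have yc: "?y \<in> carrier K" using p_nonzero by simp
      let ?z = "x \<ominus>\<^bsub>T\<^esub> pure ?y \<one>\<^bsub>FP\<^esub>"
      have "x \<ominus>\<^bsub>T\<^esub> ?z \<in> S'"
        using T_subgroupD(5)[OF S'_sub x] g R by blast
      moreover have "x \<ominus>\<^bsub>T\<^esub> ?z = pure ?y \<one>\<^bsub>FP\<^esub>"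
        using yc by (intro KP.T.add_diff_cancel(3) xc) simp
      ultimately have "?y \<in> S" unfolding S_def by auto
      then have y: "pure ?y \<one>\<^bsub>FP\<^esub> \<in> completion_at f P S" using pure_mem_completion AP_one by blast
      have Csub: "subgroup (completion_at f P S) (add_monoid T)"
        using carr by (intro completion_subgroup) blast
      have "?R \<subseteq> completion_at f P S"
        using R_S by (intro completion_least[OF Csub] pure_mem_completion) (auto simp: R_in_K_def)
      then have "?z \<oplus>\<^bsub>T\<^esub> pure ?y \<one>\<^bsub>FP\<^esub> \<in> completion_at f P S"
        using T_subgroupD(4)[OF Csub _ y] g by blast
      moreover have "?z \<oplus>\<^bsub>T\<^esub> pure ?y \<one>\<^bsub>FP\<^esub> = x"
        using yc by (intro KP.T.add_diff_cancel(2) xc) simp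
      ultimately show "x \<in> completion_at f P S" by simp
    qed
  qed
  ultimately show ?thesis by blast
qed

lemma completion_bij: "bij_betw (completion_at f P) {S. p_overorder S} (AP_overorders f P)"
  unfolding bij_betw_def
  using completion_inj completion_overorder completion_surj by blast

lemma overorder_bases_correct:
  defines "SS \<equiv> {S. p_overorder S}"
  shows "\<forall>us\<in>set (overorder_bases f p). \<exists>S\<in>SS. lists_A_basis f us S"
    "\<forall>S\<in>SS. \<exists>us\<in>set (overorder_bases f p). lists_A_basis f us S"
    "finite SS" "SS \<subseteq> A_overorders f"
proof -
  let ?M = "exponent_bound f"
  have mem: "us \<in> set (overorder_bases f p) \<longleftrightarrow>
      (\<exists>vs\<in>set (candidates (degree f) (?M * degree p)). order_basis f p ?M vs \<and> us = map (\<lambda>g. (g, p ^ ?M)) vs)" for us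
    by (auto simp: overorder_bases_def)
  have basis: "lists_A_basis f (map (\<lambda>g. (g, p ^ ?M)) vs) (order_of ?M (poly_span vs))"
    "p_overorder (order_of ?M (poly_span vs))" if "order_basis f p ?M vs" for vs
    using that order_basis_iff lists_A_basis_order_of order_of_p_overorder by blast+
  show "\<forall>us\<in>set (overorder_bases f p). \<exists>S\<in>SS. lists_A_basis f us S"
  proof
    fix us assume "us \<in> set (overorder_bases f p)"
    then obtain vs where vs: "order_basis f p ?M vs" "us = map (\<lambda>g. (g, p ^ ?M)) vs"
      unfolding mem by blast
    show "\<exists>S\<in>SS. lists_A_basis f us S"
      unfolding vs(2) SS_def using basis[OF vs(1)] by blast
  qed
  show "\<forall>S\<in>SS. \<exists>us\<in>set (overorder_bases f p). lists_A_basis f us S"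
  proof
    fix S assume "S \<in> SS"
    then obtain vs where vs: "vs \<in> set (candidates (degree f) (?M * degree p))"
      "order_basis f p ?M vs" "S = order_of ?M (poly_span vs)"
      using p_overorder_listed unfolding SS_def by blast
    then have "map (\<lambda>g. (g, p ^ ?M)) vs \<in> set (overorder_bases f p)"
      unfolding mem by blast
    then show "\<exists>us\<in>set (overorder_bases f p). lists_A_basis f us S"
      using basis(1)[OF vs(2)] vs(3) by blast
  qed
  have "SS \<subseteq> (\<lambda>vs. order_of ?M (poly_span vs)) ` set (candidates (degree f) (?M * degree p))"
    using p_overorder_listed unfolding SS_def by blast
  then show "finite SS" by (rule finite_subset) simp
  show "SS \<subseteq> A_overorders f"
    using p_overorder_A_overorder unfolding SS_def by blast
qed

end

section \<open>From the prime ideal to its generator, and the final statement\<close>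

lemma prime_elem_of_primeideal:
  fixes p :: "'a::field poly"
  assumes "primeideal (PIdl\<^bsub>ring_of_type_algebra\<^esub> p) ring_of_type_algebra"
    and "PIdl\<^bsub>ring_of_type_algebra\<^esub> p \<noteq> {0}"
  shows "prime_elem p"
proof (rule prime_elemI)
  show "p \<noteq> 0" using assms(2) by (auto simp: PIdl_type_algebra)
  show "\<not> p dvd 1"
  proof
    assume "p dvd 1"
    then have "PIdl\<^bsub>ring_of_type_algebra\<^esub> p = UNIV"
      by (auto simp: PIdl_type_algebra intro: dvd_trans)
    then show False using primeideal.I_notcarr[OF assms(1)] by simp
  qed
  fix a b assume "p dvd a * b"
  then show "p dvd a \<or> p dvd b"
    using primeideal.I_prime[OF assms(1), of a b] by (simp add: PIdl_type_algebra)
qed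

theorem mainTheorem2:
  fixes e :: "'a::{field, finite} \<Rightarrow> nat"
  assumes "inj e"
  shows "\<exists>prog. \<forall>(f :: 'a poly poly) (P :: 'a poly set) \<pi>.
    Polynomial.lead_coeff f = 1 \<and> Factorial_Ring.irreducible f \<and>
    primeideal P ring_of_type_algebra \<and> P \<noteq> {0} \<and> P = PIdl\<^bsub>ring_of_type_algebra\<^esub> \<pi> \<longrightarrow>
    (\<exists>bs SS.
       rec_eval prog [poly_poly_code e f, poly_code e \<pi>] (bases_code e bs) \<and>
       (\<forall>us\<in>set bs. \<exists>S\<in>SS. lists_A_basis f us S) \<and>
       (\<forall>S\<in>SS. \<exists>us\<in>set bs. lists_A_basis f us S) \<and>
       finite SS \<and> SS \<subseteq> A_overorders f \<and>
       bij_betw (completion_at f P) SS (AP_overorders f P))"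
proof -
  obtain prog where prog: "\<And>f p. rec_eval prog [poly_poly_code e f, poly_code e p]
      (bases_code e (overorder_bases f p))"
    using overorder_bases_program[OF assms] by blast
  show ?thesis
  proof (intro exI[of _ prog] allI impI, elim conjE)
    fix f :: "'a poly poly" and P :: "'a poly set" and \<pi>
    assume f: "Polynomial.lead_coeff f = 1" "Factorial_Ring.irreducible f"
      and P: "primeideal P ring_of_type_algebra" "P \<noteq> {0}" "P = PIdl\<^bsub>ring_of_type_algebra\<^esub> \<pi>"
    interpret order_setup f \<pi>
      using f prime_elem_of_primeideal P by (intro order_setup.intro) auto
    have P_eq: "P = {b. \<pi> dvd b}" using P(3) by (simp add: PIdl_type_algebra)
    show "\<exists>bs SS.
       rec_eval prog [poly_poly_code e f, poly_code e \<pi>] (bases_code e bs) \<and>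
       (\<forall>us\<in>set bs. \<exists>S\<in>SS. lists_A_basis f us S) \<and>
       (\<forall>S\<in>SS. \<exists>us\<in>set bs. lists_A_basis f us S) \<and>
       finite SS \<and> SS \<subseteq> A_overorders f \<and>
       bij_betw (completion_at f P) SS (AP_overorders f P)"
      unfolding P_eq
      by (rule exI[of _ "overorder_bases f \<pi>"], rule exI[of _ "{S. p_overorder S}"],
          intro conjI prog overorder_bases_correct completion_bij)
  qed
qed

end
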